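(* Let $m,n\ge 2$ be integers and $\mathcal{T}\in\mathbb{T}(\mathbb{C}^n,m)$. Suppose that there exists an integer $k$ with $1\leq k\leq n-1$ such that $t_{ii_2\ldots i_m}=0$ for every $i\in\{k+1,\ldots,n\}$ and all indices $i_2,\ldots,i_m$ with $\{i_2,\ldots,i_m\}\cap\{1,\ldots,k\}\neq\emptyset$. Let $\mathcal{U}\in\mathbb{T}(\mathbb{C}^k,m)$ and $\mathcal{V}\in\mathbb{T}(\mathbb{C}^{n-k},m)$ be the sub-tensors of $\mathcal{T}$ associated to $\{1,\ldots,k\}$ and $\{k+1,\ldots,n\}$, respectively. Then $$\mathrm{Edet}(\mathcal{T})=\left[\mathrm{Edet}(\mathcal{U})\right]^{(m-1)^{n-k}}\left[\mathrm{Edet}(\mathcal{V})\right]^{(m-1)^k}.$$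
   Context: $\mathbb{T}(\mathbb{C}^n,m)$ is the space of $m$-th order $n$-dimensional complex tensors $\mathcal{T}=(t_{i_1\ldots i_m})$, $1\le i_1,\ldots,i_m\le n$. For $\mathbf{x}\in\mathbb{C}^n$, $\mathcal{T}\mathbf{x}^{m-1}\in\mathbb{C}^n$ is the vector with $i$-th entry $\sum_{i_2,\ldots,i_m=1}^n t_{ii_2\ldots i_m}x_{i_2}\cdots x_{i_m}$. The resultant $\mathrm{Res}$ of $n$ homogeneous polynomials in $n$ variables, each of degree $m-1$, is the irreducible polynomial in their coefficients that vanishes if and only if the polynomials have a common zero in $\mathbb{C}^n\setminus\{\mathbf{0}\}$, normalized by $\mathrm{Res}(x_1^{m-1},\ldots,x_n^{m-1})=1$. The E-determinant $\mathrm{Edet}(\mathcal{T})$ is the resultant of the $n$ components of $\mathcal{T}\mathbf{x}^{m-1}$; in dimension $1$, $\mathrm{Edet}(\mathcal{T})=t_{1\ldots1}$. A tensor $\mathcal{U}\in\mathbb{T}(\mathbb{C}^k,m)$ is the sub-tensor of $\mathcal{T}$ associated to the index set $\{j_1<\cdots<j_k\}\subseteq\{1,\ldots,n\}$ if $u_{i_1\ldots i_m}=t_{j_{i_1}\ldots j_{i_m}}$ for all $i_1,\ldots,i_m\in\{1,\ldots,k\}$. *)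

theory Defs
  imports Complex_Main "HOL-Library.Poly_Mapping" "HOL-Computational_Algebra.Factorial_Ring"
begin

section \<open>Complex polynomials in several variables\<close>

text \<open>
  Polynomials in commuting variables from the type \<open>'v\<close>, as finitely supported maps from
  exponent vectors to coefficients; the ring structure (convolution product) is the one of
  \<^theory>\<open>HOL-Library.Poly_Mapping\<close>.
\<close>

type_synonym 'v cpoly = "('v \<Rightarrow>\<^sub>0 nat) \<Rightarrow>\<^sub>0 complex"

definition poly_vars :: "'v cpoly \<Rightarrow> 'v set" where
  "poly_vars p = (\<Union>\<alpha>\<in>Poly_Mapping.keys p. Poly_Mapping.keys \<alpha>)"

definition poly_eval :: "('v \<Rightarrow> complex) \<Rightarrow> 'v cpoly \<Rightarrow> complex" where
  "poly_eval x p = (\<Sum>\<alpha>\<in>Poly_Mapping.keys p. Poly_Mapping.lookup p \<alpha> *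
       (\<Prod>v\<in>Poly_Mapping.keys \<alpha>. x v ^ Poly_Mapping.lookup \<alpha> v))"


section \<open>The resultant\<close>

definition monoms :: "nat \<Rightarrow> nat \<Rightarrow> (nat \<Rightarrow>\<^sub>0 nat) set" where
  "monoms n d = {\<alpha>. Poly_Mapping.keys \<alpha> \<subseteq> {1..n} \<and> (\<Sum>j\<in>{1..n}. Poly_Mapping.lookup \<alpha> j) = d}"

text \<open>Forms of degree \<open>d\<close> in the variables \<open>x\<^sub>1, \<dots>, x\<^sub>n\<close>, the zero form included.\<close>

definition forms :: "nat \<Rightarrow> nat \<Rightarrow> nat cpoly set" where
  "forms n d = {f. Poly_Mapping.keys f \<subseteq> monoms n d}"

text \<open>
  The variable \<open>(i, \<alpha>)\<close> stands for the coefficient of the monomial \<open>x\<^sup>\<alpha>\<close> in the \<open>i\<close>-th of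
  \<open>n\<close> generic forms of degree \<open>d\<close>. The resultant is a polynomial in these variables.
\<close>

type_synonym coeff_var = "nat \<times> (nat \<Rightarrow>\<^sub>0 nat)"

definition coeff_vars :: "nat \<Rightarrow> nat \<Rightarrow> coeff_var set" where
  "coeff_vars n d = {1..n} \<times> monoms n d"

definition eval_at_forms :: "(nat \<Rightarrow> nat cpoly) \<Rightarrow> coeff_var cpoly \<Rightarrow> complex" where
  "eval_at_forms f R = poly_eval (\<lambda>(i, \<alpha>). Poly_Mapping.lookup (f i) \<alpha>) R"

definition common_nontrivial_zero :: "nat \<Rightarrow> (nat \<Rightarrow> nat cpoly) \<Rightarrow> bool" where
  "common_nontrivial_zero n f \<longleftrightarrow>
     (\<exists>x :: nat \<Rightarrow> complex. (\<exists>i\<in>{1..n}. x i \<noteq> 0) \<and> (\<forall>i\<in>{1..n}. poly_eval x (f i) = 0))"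

text \<open>
  In the last conjunct, \<open>single (single i d) 1\<close> is the form \<open>x\<^sub>i\<^sup>d\<close>. Irreducibility is taken in
  the polynomial ring over all variables of type \<^typ>\<open>coeff_var\<close>; for a polynomial whose
  variables lie in \<open>coeff_vars n d\<close> this agrees with irreducibility in the subring of
  polynomials in those variables, since factors of such a polynomial involve no other variables.
\<close>

definition is_resultant :: "nat \<Rightarrow> nat \<Rightarrow> coeff_var cpoly \<Rightarrow> bool" where
  "is_resultant n d R \<longleftrightarrow>
     poly_vars R \<subseteq> coeff_vars n d \<and>
     irreducible R \<and>
     (\<forall>f. (\<forall>i\<in>{1..n}. f i \<in> forms n d) \<longrightarrow>
        (eval_at_forms f R = 0 \<longleftrightarrow> common_nontrivial_zero n f)) \<and>
     eval_at_forms (\<lambda>i. Poly_Mapping.single (Poly_Mapping.single i d) 1) R = 1"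

definition resultant_poly :: "nat \<Rightarrow> nat \<Rightarrow> coeff_var cpoly" where
  "resultant_poly n d = (THE R. is_resultant n d R)"

text \<open>The resultant of the forms \<open>f 1, \<dots>, f n\<close> of degree \<open>d\<close> in \<open>n\<close> variables.\<close>

definition Res :: "nat \<Rightarrow> nat \<Rightarrow> (nat \<Rightarrow> nat cpoly) \<Rightarrow> complex" where
  "Res n d f = eval_at_forms f (resultant_poly n d)"


section \<open>Tensors and the E-determinant\<close>

text \<open>
  A tensor maps the index list \<open>[i\<^sub>1, \<dots>, i\<^sub>m]\<close> to the entry \<open>t\<close> with these indices (counted
  from 1). Order \<open>m\<close> and dimension \<open>n\<close> are passed separately; a tensor of order \<open>m\<close> and
  dimension \<open>n\<close> is only ever accessed at the lists in \<open>index_lists n m\<close>.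
\<close>

type_synonym tensor = "nat list \<Rightarrow> complex"

definition index_lists :: "nat \<Rightarrow> nat \<Rightarrow> nat list set" where
  "index_lists n m = {js. length js = m \<and> set js \<subseteq> {1..n}}"

definition tensor_apply :: "nat \<Rightarrow> nat \<Rightarrow> tensor \<Rightarrow> (nat \<Rightarrow> complex) \<Rightarrow> nat \<Rightarrow> complex" where
  "tensor_apply n m T x i = (\<Sum>js\<in>index_lists n (m - 1). T (i # js) * (\<Prod>j\<leftarrow>js. x j))"

text \<open>The \<open>i\<close>-th component of \<open>T x\<^sup>m\<^sup>-\<^sup>1\<close> as a form of degree \<open>m - 1\<close> in \<open>x\<^sub>1, \<dots>, x\<^sub>n\<close>.\<close>

definition tensor_form :: "nat \<Rightarrow> nat \<Rightarrow> tensor \<Rightarrow> nat \<Rightarrow> nat cpoly" where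
  "tensor_form n m T i =
     (\<Sum>js\<in>index_lists n (m - 1).
        Poly_Mapping.single (\<Sum>j\<leftarrow>js. Poly_Mapping.single j 1) (T (i # js)))"

definition Edet :: "nat \<Rightarrow> nat \<Rightarrow> tensor \<Rightarrow> complex" where
  "Edet n m T = Res n (m - 1) (tensor_form n m T)"

text \<open>
  \<open>U\<close>, of order \<open>m\<close> and dimension \<open>card J\<close>, is the sub-tensor of \<open>T\<close> associated to the index set
  \<open>J = {j\<^sub>1 < \<dots> < j\<^sub>k}\<close>; here \<open>j\<^sub>i\<close> is \<open>sorted_list_of_set J ! (i - 1)\<close>.
\<close>

definition is_subtensor :: "nat \<Rightarrow> nat \<Rightarrow> tensor \<Rightarrow> nat set \<Rightarrow> tensor \<Rightarrow> bool" where
  "is_subtensor n m T J U \<longleftrightarrow>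
     J \<subseteq> {1..n} \<and>
     (\<forall>js\<in>index_lists (card J) m. U js = T (map (\<lambda>i. sorted_list_of_set J ! (i - 1)) js))"


section \<open>The forms of a tensor evaluate to its components\<close>

lemma poly_eval_superset:
  assumes "finite A" "Poly_Mapping.keys p \<subseteq> A"
  shows "poly_eval x p = (\<Sum>\<alpha>\<in>A. Poly_Mapping.lookup p \<alpha> *
                          (\<Prod>v\<in>Poly_Mapping.keys \<alpha>. x v ^ Poly_Mapping.lookup \<alpha> v))"
  unfolding poly_eval_def
  by (rule sum.mono_neutral_left) (use assms in \<open>auto simp: in_keys_iff\<close>)

lemma poly_eval_zero [simp]: "poly_eval x 0 = 0"
  by (simp add: poly_eval_def)

lemma poly_eval_add: "poly_eval x (p + q) = poly_eval x p + poly_eval x q"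
proof -
  let ?A = "Poly_Mapping.keys p \<union> Poly_Mapping.keys q"
  have "Poly_Mapping.keys (p + q) \<subseteq> ?A" by (rule Poly_Mapping.keys_add)
  then show ?thesis
    by (simp add: poly_eval_superset[of ?A] lookup_add distrib_right sum.distrib)
qed

lemma poly_eval_sum: "poly_eval x (\<Sum>i\<in>A. p i) = (\<Sum>i\<in>A. poly_eval x (p i))"
  by (induction A rule: infinite_finite_induct) (auto simp: poly_eval_add)

lemma poly_eval_single:
  "poly_eval x (Poly_Mapping.single \<alpha> c) =
     c * (\<Prod>v\<in>Poly_Mapping.keys \<alpha>. x v ^ Poly_Mapping.lookup \<alpha> v)"
  by (simp add: poly_eval_superset[of "{\<alpha>}"])

lemma monomial_eval_superset:
  fixes x :: "'v \<Rightarrow> complex"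
  assumes "finite A" "Poly_Mapping.keys \<alpha> \<subseteq> A"
  shows "(\<Prod>v\<in>Poly_Mapping.keys \<alpha>. x v ^ Poly_Mapping.lookup \<alpha> v) =
           (\<Prod>v\<in>A. x v ^ Poly_Mapping.lookup \<alpha> v)"
  by (rule prod.mono_neutral_left) (use assms in \<open>auto simp: in_keys_iff\<close>)

lemma monomial_eval_add:
  fixes x :: "'v \<Rightarrow> complex" and \<alpha> \<beta> :: "'v \<Rightarrow>\<^sub>0 nat"
  shows "(\<Prod>v\<in>Poly_Mapping.keys (\<alpha> + \<beta>). x v ^ Poly_Mapping.lookup (\<alpha> + \<beta>) v) =
           (\<Prod>v\<in>Poly_Mapping.keys \<alpha>. x v ^ Poly_Mapping.lookup \<alpha> v) *
           (\<Prod>v\<in>Poly_Mapping.keys \<beta>. x v ^ Poly_Mapping.lookup \<beta> v)"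
proof -
  let ?A = "Poly_Mapping.keys \<alpha> \<union> Poly_Mapping.keys \<beta>"
  have A: "finite ?A" by simp
  have "Poly_Mapping.keys (\<alpha> + \<beta>) \<subseteq> ?A" by (rule Poly_Mapping.keys_add)
  note eqs = monomial_eval_superset[OF A this] monomial_eval_superset[OF A, of \<alpha>]
    monomial_eval_superset[OF A, of \<beta>]
  show ?thesis
    unfolding eqs(1) eqs(2)[OF Un_upper1] eqs(3)[OF Un_upper2]
    by (simp add: lookup_add power_add prod.distrib)
qed

lemma monomial_eval_list:
  fixes x :: "'v \<Rightarrow> complex"
  shows "(\<Prod>v\<in>Poly_Mapping.keys (\<Sum>j\<leftarrow>js. Poly_Mapping.single j (1::nat)).
            x v ^ Poly_Mapping.lookup (\<Sum>j\<leftarrow>js. Poly_Mapping.single j (1::nat)) v) =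
         (\<Prod>j\<leftarrow>js. x j)"
  by (induction js) (simp_all add: monomial_eval_add del: One_nat_def)

lemma poly_eval_tensor_form: "poly_eval x (tensor_form n m T i) = tensor_apply n m T x i"
  unfolding tensor_form_def tensor_apply_def
  by (simp only: poly_eval_sum poly_eval_single monomial_eval_list)

lemma list_monomial_in_monoms:
  assumes "js \<in> index_lists n d"
  shows "(\<Sum>j\<leftarrow>js. Poly_Mapping.single j (1::nat)) \<in> monoms n d"
  using assms
proof (induction js arbitrary: d)
  case Nil
  then show ?case by (simp add: index_lists_def monoms_def)
next
  case (Cons j js)
  then obtain d' where d: "d = Suc d'" and js: "js \<in> index_lists n d'" and j: "j \<in> {1..n}"
    by (cases d) (auto simp: index_lists_def)
  let ?s = "\<Sum>j\<leftarrow>js. Poly_Mapping.single j (1::nat)"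
  have s: "Poly_Mapping.keys ?s \<subseteq> {1..n}" "(\<Sum>i\<in>{1..n}. Poly_Mapping.lookup ?s i) = d'"
    using Cons.IH[OF js] by (auto simp: monoms_def)
  have k: "Poly_Mapping.keys (Poly_Mapping.single j 1 + ?s) \<subseteq> {1..n}"
    using Poly_Mapping.keys_add[of "Poly_Mapping.single j (1::nat)" ?s] s(1) j by auto
  have "(\<Sum>i\<in>{1..n}. Poly_Mapping.lookup (Poly_Mapping.single j (1::nat)) i) = 1"
    using j by (simp add: lookup_single when_def)
  then have "(\<Sum>i\<in>{1..n}. Poly_Mapping.lookup (Poly_Mapping.single j 1 + ?s) i) = d"
    using s(2) d by (simp add: lookup_add sum.distrib)
  with k show ?case by (simp add: monoms_def)
qed

lemma tensor_form_in_forms: "tensor_form n m T i \<in> forms n (m - 1)"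
proof -
  have "Poly_Mapping.keys (tensor_form n m T i) \<subseteq>
      (\<Union>js\<in>index_lists n (m - 1).
         Poly_Mapping.keys (Poly_Mapping.single (\<Sum>j\<leftarrow>js. Poly_Mapping.single j (1::nat)) (T (i # js))))"
    unfolding tensor_form_def by (rule keys_sum)
  also have "\<dots> \<subseteq> monoms n (m - 1)"
    by (auto simp: list_monomial_in_monoms simp del: One_nat_def split: if_splits)
  finally show ?thesis by (simp add: forms_def)
qed

end

theory Submission
  imports Defs "HOL-Library.Product_Lexorder" "Jordan_Normal_Form.Determinant"
    "HOL-Computational_Algebra.Fundamental_Theorem_Algebra" "HOL-Analysis.Continuum_Not_Denumerable"
begin

text \<open>
  The polynomials in the coefficients that vanish on all systems with a nontrivial zero form a
  prime ideal. Its nonzero elements all involve the coefficient of \<open>x\<^sub>n\<^sup>d\<close> in \<open>f\<^sub>n\<close>, so eliminating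
  that variable shows that the ideal is generated by one irreducible polynomial \<open>R\<close>; by the projective
  Nullstellensatz the zeros of \<open>R\<close> are exactly the systems with a nontrivial zero. Hence the resultant
  exists. It is homogeneous of degree \<open>d\<^bsup>n-1\<^esup>\<close> in each form: Macaulay's determinant gives the upper
  bound and a cyclic system with \<open>d\<^bsup>n-1\<^esup>\<close> degenerate parameter values the lower one.

  For a block system with \<open>V\<close> fixed and nonsingular, the resultant is a polynomial in the
  coefficients of \<open>U\<close> whose zeros are zeros of the irreducible resultant of \<open>U\<close>. So it is a constant
  times a power of that resultant, and the degrees determine the exponent; similarly for \<open>V\<close>.
\<close>

section \<open>Evaluation of polynomials\<close>

text \<open>The resultant is a \<open>THE\<close>, so nothing can be said about it before existence
  and uniqueness are proved. Instead of a dimension count (systems with a zero form a hypersurface),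
  elimination is used: if an irreducible \<open>R\<close> of the ideal did not divide some
  \<open>g\<close> in it, a combination \<open>u * R + v * g\<close> would be a nonzero element of
  the ideal without the top coefficient. This needs irreducible polynomials to be prime, which is
  proved by adjoining one variable at a time.

  The exponents come from degrees in one row: \<open>d^(n-1)\<close> for the whole system against
  \<open>d^(k-1)\<close> for the upper block leaves \<open>d^(n-k)\<close>. The constant in front is
  found at the system of pure powers. Two gaps remain: coefficients of the first \<open>k\<close>
  rows at monomials with later variables, removed because a complex polynomial without roots is
  constant, and blocks with vanishing resultant, reached along a line to the system of
  powers.\<close>

abbreviation (input) "plookup \<equiv> Poly_Mapping.lookup"
abbreviation (input) "pkeys \<equiv> Poly_Mapping.keys"

definition Cst :: "complex \<Rightarrow> 'v cpoly" where
  "Cst c = Poly_Mapping.single 0 c"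

definition Var :: "'v \<Rightarrow> 'v cpoly" where
  "Var v = Poly_Mapping.single (Poly_Mapping.single v 1) 1"

definition mon :: "('v \<Rightarrow> 'b) \<Rightarrow> ('v \<Rightarrow>\<^sub>0 nat) \<Rightarrow> 'b::comm_ring_1" where
  "mon x \<alpha> = (\<Prod>v\<in>pkeys \<alpha>. x v ^ plookup \<alpha> v)"

text \<open>The coefficient map \<open>\<iota>\<close> lets one evaluation serve for values at
  points (\<open>id\<close>), substitution of polynomials (\<open>Cst\<close>), the view as a
  polynomial in one variable, and restriction to a curve (\<open>[:c:]\<close>).\<close>

definition ev :: "(complex \<Rightarrow> 'b) \<Rightarrow> ('v \<Rightarrow> 'b) \<Rightarrow> 'v cpoly \<Rightarrow> 'b::comm_ring_1" where
  "ev \<iota> x p = (\<Sum>\<alpha>\<in>pkeys p. \<iota> (plookup p \<alpha>) * mon x \<alpha>)"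

lemma mon_superset:
  assumes "finite A" "pkeys \<alpha> \<subseteq> A"
  shows "mon x \<alpha> = (\<Prod>v\<in>A. x v ^ plookup \<alpha> v)"
  unfolding mon_def
  by (rule prod.mono_neutral_left) (use assms in \<open>auto simp: in_keys_iff\<close>)

lemma mon_0 [simp]: "mon x 0 = 1"
  by (simp add: mon_def)

lemma mon_add: "mon x (\<alpha> + \<beta>) = mon x \<alpha> * mon x \<beta>"
proof -
  let ?A = "pkeys \<alpha> \<union> pkeys \<beta>"
  have A: "finite ?A" by simp
  have "pkeys (\<alpha> + \<beta>) \<subseteq> ?A" by (rule Poly_Mapping.keys_add)
  then show ?thesis
    by (simp add: mon_superset[OF A] lookup_add power_add prod.distrib)
qed

lemma mon_single: "mon x (Poly_Mapping.single v k) = x v ^ k"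
  by (cases "k = 0") (auto simp: mon_def)

lemma mon_cong: "(\<And>v. v \<in> pkeys \<alpha> \<Longrightarrow> x v = y v) \<Longrightarrow> mon x \<alpha> = mon y \<alpha>"
  unfolding mon_def by (rule prod.cong) auto

lemma poly_eval_eq_ev: "poly_eval x = ev id x"
  by (rule ext) (simp add: poly_eval_def ev_def mon_def)

context
  fixes \<iota> :: "complex \<Rightarrow> 'b::comm_ring_1"
  assumes \<iota>: "comm_ring_hom \<iota>"
begin

interpretation comm_ring_hom \<iota> by (rule \<iota>)

lemma ev_superset:
  assumes "finite A" "pkeys p \<subseteq> A"
  shows "ev \<iota> x p = (\<Sum>\<alpha>\<in>A. \<iota> (plookup p \<alpha>) * mon x \<alpha>)"
  unfolding ev_def
  by (rule sum.mono_neutral_left) (use assms in \<open>auto simp: in_keys_iff\<close>)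

lemma ev_single: "ev \<iota> x (Poly_Mapping.single \<alpha> c) = \<iota> c * mon x \<alpha>"
  by (simp add: ev_superset[of "{\<alpha>}"])

lemma ev_add: "ev \<iota> x (p + q) = ev \<iota> x p + ev \<iota> x q"
proof -
  let ?A = "pkeys p \<union> pkeys q"
  have "pkeys (p + q) \<subseteq> ?A" by (rule Poly_Mapping.keys_add)
  then show ?thesis
    by (simp add: ev_superset[of ?A] lookup_add hom_add distrib_right sum.distrib)
qed

lemma ev_0: "ev \<iota> x 0 = 0"
  by (simp add: ev_def)

lemma ev_sum: "ev \<iota> x (sum f A) = (\<Sum>a\<in>A. ev \<iota> x (f a))"
  by (induction A rule: infinite_finite_induct) (auto simp: ev_add ev_0)

end

lemma sum_single: "(p :: 'a \<Rightarrow>\<^sub>0 'b::comm_monoid_add) = (\<Sum>\<alpha>\<in>pkeys p. Poly_Mapping.single \<alpha> (plookup p \<alpha>))"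
  by (rule poly_mapping_eqI)
    (auto simp: lookup_sum lookup_single when_def in_keys_iff if_distrib sum.delta cong: if_cong)

lemma ev_mult:
  assumes \<iota>: "comm_ring_hom \<iota>"
  shows "ev \<iota> x (p * q) = ev \<iota> x p * ev \<iota> x q"
proof -
  interpret comm_ring_hom \<iota> by (rule \<iota>)
  have *: "ev \<iota> x (Poly_Mapping.single \<alpha> c * Poly_Mapping.single \<beta> d) =
     \<iota> c * mon x \<alpha> * (\<iota> d * mon x \<beta>)" for \<alpha> \<beta> c d
    by (simp add: mult_single ev_single[OF \<iota>] hom_mult mon_add algebra_simps)
  have "ev \<iota> x (p * q) = ev \<iota> x ((\<Sum>\<alpha>\<in>pkeys p. Poly_Mapping.single \<alpha> (plookup p \<alpha>)) *
      (\<Sum>\<beta>\<in>pkeys q. Poly_Mapping.single \<beta> (plookup q \<beta>)))"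
    by (simp only: sum_single[symmetric])
  also have "\<dots> = ev \<iota> x p * ev \<iota> x q"
    by (simp add: sum_product ev_sum[OF \<iota>] *) (simp add: ev_def sum_product)
  finally show ?thesis .
qed

lemma ev_hom:
  assumes \<iota>: "comm_ring_hom \<iota>"
  shows "comm_ring_hom (ev \<iota> x)"
proof -
  interpret comm_ring_hom \<iota> by (rule \<iota>)
  have 1: "ev \<iota> x 1 = 1"
    using ev_single[OF \<iota>, of x 0 1] by simp
  show ?thesis
    by unfold_locales (simp_all add: ev_mult \<iota> ev_add ev_0 1)
qed

lemma ev_Cst:
  assumes "comm_ring_hom \<iota>"
  shows "ev \<iota> x (Cst c) = \<iota> c"
  by (simp add: Cst_def ev_single[OF assms])

lemma ev_Var:
  assumes "comm_ring_hom \<iota>"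
  shows "ev \<iota> x (Var v) = x v"
proof -
  interpret comm_ring_hom \<iota> by fact
  show ?thesis by (simp add: Var_def mon_single ev_single[OF assms])
qed

lemma hom_mon:
  assumes "comm_ring_hom h"
  shows "h (mon x \<alpha>) = mon (\<lambda>v. h (x v)) \<alpha>"
proof -
  interpret comm_ring_hom h by fact
  show ?thesis by (simp add: mon_def hom_prod hom_power)
qed

lemma hom_ev:
  assumes "comm_ring_hom h"
  shows "h (ev \<iota> x p) = ev (\<lambda>c. h (\<iota> c)) (\<lambda>v. h (x v)) p"
proof -
  interpret comm_ring_hom h by fact
  show ?thesis by (simp add: ev_def hom_sum hom_mult hom_mon[OF assms])
qed

lemma ev_cong:
  assumes "\<And>v. v \<in> poly_vars p \<Longrightarrow> x v = y v"
  shows "ev \<iota> x p = ev \<iota> y p"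
  unfolding ev_def
  by (intro sum.cong refl arg_cong2[where f = "(*)"] mon_cong assms) (auto simp: poly_vars_def)

lemma poly_eval_cong:
  assumes "\<And>v. v \<in> poly_vars p \<Longrightarrow> x v = y v"
  shows "poly_eval x p = poly_eval y p"
  unfolding poly_eval_eq_ev by (rule ev_cong) fact

lemma hom_id: "comm_ring_hom (id :: complex \<Rightarrow> complex)"
  by unfold_locales auto

lemma hom_Cst: "comm_ring_hom Cst"
  by unfold_locales (simp_all add: Cst_def single_add mult_single)

lemma hom_comp: "comm_ring_hom f \<Longrightarrow> comm_ring_hom g \<Longrightarrow> comm_ring_hom (\<lambda>x. f (g x))"
proof -
  assume "comm_ring_hom f" "comm_ring_hom g"
  then interpret f: comm_ring_hom f + g: comm_ring_hom g by simp_all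
  show ?thesis
    by unfold_locales (simp_all add: f.hom_add f.hom_mult g.hom_add g.hom_mult)
qed

interpretation Cst: comm_ring_hom Cst by (rule hom_Cst)

lemma hom_poly_eval: "comm_ring_hom (poly_eval x)"
  unfolding poly_eval_eq_ev by (rule ev_hom[OF hom_id])

interpretation poly_eval: comm_ring_hom "poly_eval x" by (rule hom_poly_eval)

lemma poly_eval_Cst [simp]: "poly_eval x (Cst c) = c"
  unfolding poly_eval_eq_ev by (simp add: ev_Cst[OF hom_id])

lemma poly_eval_Var [simp]: "poly_eval x (Var v) = x v"
  unfolding poly_eval_eq_ev by (simp add: ev_Var[OF hom_id])

lemma mon_Var: "mon Var \<alpha> = Poly_Mapping.single \<alpha> 1"
proof -
  have 1: "Var v ^ k = Poly_Mapping.single (Poly_Mapping.single v k) 1" for v :: 'a and k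
    by (induction k) (simp_all add: Var_def mult_single single_add[symmetric])
  have 2: "(\<Prod>v\<in>A. Poly_Mapping.single (f v) 1) = Poly_Mapping.single (\<Sum>v\<in>A. f v) (1::complex)"
    for A :: "'a set" and f :: "'a \<Rightarrow> 'a \<Rightarrow>\<^sub>0 nat"
    by (induction A rule: infinite_finite_induct) (simp_all add: mult_single)
  show ?thesis
    unfolding mon_def 1 2 by (simp only: sum_single[symmetric])
qed

lemma ev_Cst_Var: "ev Cst Var p = p"
proof -
  have "Cst c * Poly_Mapping.single \<alpha> 1 = Poly_Mapping.single \<alpha> c" for c and \<alpha> :: "'a \<Rightarrow>\<^sub>0 nat"
    by (simp add: Cst_def mult_single)
  then show ?thesis
    unfolding ev_def mon_Var by (simp only: sum_single[symmetric])
qed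

text \<open>Induction over polynomials in disguise: with \<open>ev Cst Var p = p\<close> it puts
  \<open>p\<close> itself into every set that is closed under the ring operations and contains the
  constants and the variables of \<open>p\<close>.\<close>

lemma ev_closed:
  fixes p :: "'v cpoly" and S :: "'b::comm_ring_1 set"
  assumes "\<And>a b. a \<in> S \<Longrightarrow> b \<in> S \<Longrightarrow> a + b \<in> S" "\<And>a b. a \<in> S \<Longrightarrow> b \<in> S \<Longrightarrow> a * b \<in> S"
    and "0 \<in> S" "1 \<in> S" "\<And>c. \<iota> c \<in> S" "\<And>v. v \<in> poly_vars p \<Longrightarrow> x v \<in> S"
  shows "ev \<iota> x p \<in> S"
proof -
  have s: "sum f A \<in> S" if "\<And>a. a \<in> A \<Longrightarrow> f a \<in> S" for f and A :: "('v \<Rightarrow>\<^sub>0 nat) set"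
    using that by (induction A rule: infinite_finite_induct) (auto simp: assms)
  have w: "a ^ k \<in> S" if "a \<in> S" for a k
    using that by (induction k) (auto simp: assms)
  have m: "prod f A \<in> S" if "\<And>a. a \<in> A \<Longrightarrow> f a \<in> S" for f and A :: "'v set"
    using that by (induction A rule: infinite_finite_induct) (auto simp: assms)
  show ?thesis
    unfolding ev_def mon_def
    by (intro s assms(2,5,6) m w) (auto simp: poly_vars_def)
qed

lemma poly_vars_0 [simp]: "poly_vars 0 = {}"
  by (simp add: poly_vars_def)

lemma poly_vars_Cst [simp]: "poly_vars (Cst c) = {}"
  by (simp add: poly_vars_def Cst_def)

lemma poly_vars_1 [simp]: "poly_vars 1 = {}"
  by (simp add: poly_vars_def)

lemma poly_vars_Var [simp]: "poly_vars (Var v) = {v}"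
  by (simp add: poly_vars_def Var_def)

lemma finite_poly_vars [simp]: "finite (poly_vars p)"
  by (simp add: poly_vars_def)

lemma poly_vars_add: "poly_vars (p + q) \<subseteq> poly_vars p \<union> poly_vars q"
  using Poly_Mapping.keys_add[of p q] unfolding poly_vars_def by blast

lemma poly_vars_uminus [simp]: "poly_vars (- p) = poly_vars p"
  by (simp add: poly_vars_def keys_def)

lemma poly_vars_diff: "poly_vars (p - q) \<subseteq> poly_vars p \<union> poly_vars q"
  using poly_vars_add[of p "- q"] by simp

lemma poly_vars_mult: "poly_vars (p * q) \<subseteq> poly_vars p \<union> poly_vars q"
proof
  fix v assume "v \<in> poly_vars (p * q)"
  then obtain \<gamma> where "\<gamma> \<in> pkeys (p * q)" "v \<in> pkeys \<gamma>" by (auto simp: poly_vars_def)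
  moreover then obtain \<alpha> \<beta> where "\<gamma> = \<alpha> + \<beta>" "\<alpha> \<in> pkeys p" "\<beta> \<in> pkeys q"
    using keys_mult[of p q] by blast
  ultimately show "v \<in> poly_vars p \<union> poly_vars q"
    using Poly_Mapping.keys_add[of \<alpha> \<beta>] by (auto simp: poly_vars_def)
qed

text \<open>Putting all variables to 0 leaves \<open>p\<close> unchanged, so \<open>p\<close> is its
  value there.\<close>

lemma poly_vars_empty: "poly_vars p = {} \<Longrightarrow> \<exists>c. p = Cst c"
proof -
  assume "poly_vars p = {}"
  then have "ev Cst Var p = ev Cst (\<lambda>_. 0) p"
    by (intro ev_cong) auto
  also have "\<dots> = Cst (ev id (\<lambda>_. 0) p)"
    by (simp add: hom_ev[OF hom_Cst] id_def)
  finally show ?thesis unfolding ev_Cst_Var by auto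
qed

lemma poly_eval_subst:
  "poly_eval y (ev Cst x p) = poly_eval (\<lambda>v. poly_eval y (x v)) p"
  by (simp add: hom_ev[OF hom_poly_eval]) (simp add: poly_eval_eq_ev id_def)

section \<open>One distinguished variable: the ring as univariate polynomials over itself\<close>

definition uni :: "'v \<Rightarrow> 'v cpoly \<Rightarrow> 'v cpoly poly" where
  "uni t = ev (\<lambda>c. [:Cst c:]) (\<lambda>v. if v = t then [:0, 1:] else [:Var v:])"

lemma hom_const_poly: "comm_ring_hom (\<lambda>c. [:c:])"
  by unfold_locales (auto simp: one_pCons)

lemma hom_poly: "comm_ring_hom (\<lambda>q. poly q a)"
  by unfold_locales auto

lemma hom_Cst_poly: "comm_ring_hom (\<lambda>c. [:Cst c:])"
  by (rule hom_comp[OF hom_const_poly hom_Cst])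

lemma hom_uni: "comm_ring_hom (uni t)"
  unfolding uni_def by (rule ev_hom[OF hom_Cst_poly])

text \<open>The coefficients of \<open>uni t p\<close> stay in the same ring, so
  \<open>Var t\<close> can be substituted back. Injectivity of \<open>uni t\<close> and the division
  arguments in \<open>t\<close> rest on this.\<close>

lemma poly_uni: "poly (uni t p) (Var t) = p"
proof -
  have "poly (uni t p) (Var t) = ev (\<lambda>c. poly [:Cst c:] (Var t))
    (\<lambda>v. poly (if v = t then [:0, 1:] else [:Var v:]) (Var t)) p"
    unfolding uni_def by (rule hom_ev[OF hom_poly])
  also have "\<dots> = ev Cst Var p"
    by (rule arg_cong2[where f = "\<lambda>\<iota> x. ev \<iota> x p"]) auto
  finally show ?thesis by (simp add: ev_Cst_Var)
qed

section \<open>Unique factorization\<close>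

interpretation uni: comm_ring_hom "uni t" for t by (rule hom_uni)

lemma uni_Cst [simp]: "uni t (Cst c) = [:Cst c:]"
  unfolding uni_def by (rule ev_Cst[OF hom_Cst_poly])

lemma uni_Var: "uni t (Var v) = (if v = t then [:0, 1:] else [:Var v:])"
  unfolding uni_def by (rule ev_Var[OF hom_Cst_poly])

lemma poly_vars_sum: "(\<And>a. a \<in> A \<Longrightarrow> poly_vars (f a) \<subseteq> W) \<Longrightarrow> poly_vars (sum f A) \<subseteq> W"
proof (induction A rule: infinite_finite_induct)
  case (insert x F)
  then show ?case using poly_vars_add[of "f x" "sum f F"] by auto
qed auto

lemma poly_vars_power: "poly_vars (p ^ k) \<subseteq> poly_vars p"
proof (induction k)
  case (Suc k)
  then show ?case using poly_vars_mult[of p "p ^ k"] by auto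
qed auto

lemma poly_vars_coeff_uni: "poly_vars (coeff (uni t p) i) \<subseteq> poly_vars p - {t}"
proof -
  let ?W = "poly_vars p - {t}"
  let ?S = "{q. \<forall>i. poly_vars (coeff q i) \<subseteq> ?W}"
  have "uni t p \<in> ?S"
    unfolding uni_def
  proof (rule ev_closed)
    fix a b assume a: "a \<in> ?S" and b: "b \<in> ?S"
    then show "a + b \<in> ?S"
      using poly_vars_add[of "coeff a i" "coeff b i" for i] by fastforce
    have "poly_vars (coeff a i * coeff b j) \<subseteq> ?W" for i j
      using poly_vars_mult[of "coeff a i" "coeff b j"] a b by blast
    then have "poly_vars (coeff (a * b) i) \<subseteq> ?W" for i
      unfolding coeff_mult by (rule poly_vars_sum)
    then show "a * b \<in> ?S" by blast
  qed (auto simp: coeff_pCons one_pCons split: nat.splits if_splits)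
  then show ?thesis by blast
qed

lemma uni_notin: "t \<notin> poly_vars p \<Longrightarrow> uni t p = [:p:]"
proof -
  assume t: "t \<notin> poly_vars p"
  have "uni t p = ev (\<lambda>c. [:Cst c:]) (\<lambda>v. [:Var v:]) p"
    unfolding uni_def by (rule ev_cong) (use t in auto)
  also have "\<dots> = [:ev Cst Var p:]"
    by (rule hom_ev[OF hom_const_poly, symmetric])
  finally show ?thesis by (simp add: ev_Cst_Var)
qed

lemma uni_eq_iff [simp]: "uni t p = uni t q \<longleftrightarrow> p = q"
  by (metis poly_uni)

lemma uni_eq_0_iff [simp]: "uni t p = 0 \<longleftrightarrow> p = 0"
  by (metis poly_uni poly_0 uni.hom_zero)

definition deg_in :: "'v \<Rightarrow> 'v cpoly \<Rightarrow> nat" where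
  "deg_in t p = degree (uni t p)"

lemma deg_in_pos_iff: "deg_in t p > 0 \<longleftrightarrow> t \<in> poly_vars p"
proof
  show "deg_in t p > 0 \<Longrightarrow> t \<in> poly_vars p"
    by (rule ccontr) (simp add: deg_in_def uni_notin)
next
  assume t: "t \<in> poly_vars p"
  show "deg_in t p > 0"
  proof (rule ccontr)
    assume "\<not> deg_in t p > 0"
    then obtain a where a: "uni t p = [:a:]"
      by (auto simp: deg_in_def elim: degree_eq_zeroE)
    then have "p = a" using poly_uni[of t p] by simp
    with a poly_vars_coeff_uni[of t p 0] t show False by auto
  qed
qed

text \<open>The linear order on the variables provides the instance without zero divisors, on which
  additivity rests.\<close>

lemma deg_in_mult:
  fixes p q :: "'v::linorder cpoly"
  assumes "p \<noteq> 0" "q \<noteq> 0"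
  shows "deg_in t (p * q) = deg_in t p + deg_in t q"
  using assms by (simp add: deg_in_def uni.hom_mult degree_mult_eq)

lemma poly_vars_dvd:
  fixes p q :: "'v::linorder cpoly"
  assumes "p dvd q" "q \<noteq> 0"
  shows "poly_vars p \<subseteq> poly_vars q"
proof
  fix t assume "t \<in> poly_vars p"
  then have "deg_in t p > 0" by (simp add: deg_in_pos_iff)
  moreover from assms obtain r where "q = p * r" by (elim dvdE)
  ultimately have "deg_in t q > 0"
    using assms by (auto simp: deg_in_mult)
  then show "t \<in> poly_vars q" by (simp add: deg_in_pos_iff)
qed

lemma Cst_eq_iff [simp]: "Cst c = Cst d \<longleftrightarrow> c = d"
  by (metis poly_eval_Cst)

lemma Cst_eq_0_iff [simp]: "Cst c = 0 \<longleftrightarrow> c = 0"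
  by (metis Cst.hom_zero Cst_eq_iff)

lemma Cst_dvd_1: "c \<noteq> 0 \<Longrightarrow> Cst c dvd 1"
  by (rule dvdI[of _ _ "Cst (inverse c)"]) (simp flip: Cst.hom_mult)

lemma cpoly_unit_iff:
  fixes p :: "'v::linorder cpoly"
  shows "p dvd 1 \<longleftrightarrow> (\<exists>c. c \<noteq> 0 \<and> p = Cst c)"
proof
  assume "p dvd 1"
  moreover then obtain c where "p = Cst c"
    using poly_vars_dvd[of p 1] poly_vars_empty[of p] by auto
  ultimately show "\<exists>c. c \<noteq> 0 \<and> p = Cst c" by (intro exI[of _ c]) auto
qed (auto simp: Cst_dvd_1)

lemma poly_vars_irreducible:
  fixes p :: "'v::linorder cpoly"
  assumes "irreducible p"
  shows "poly_vars p \<noteq> {}"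
proof
  assume "poly_vars p = {}"
  then obtain c where "p = Cst c" using poly_vars_empty by blast
  moreover have "p \<noteq> 0" "\<not> p dvd 1" using assms by (simp_all add: irreducible_def)
  ultimately show False using Cst_dvd_1[of c] by auto
qed

text \<open>Splitting off a nonunit factor lowers the total degree, since a nonzero nonunit contains
  a variable.\<close>

lemma exists_irreducible_factor:
  fixes p :: "'v::linorder cpoly"
  assumes "p \<noteq> 0" "\<not> p dvd 1"
  shows "\<exists>q. irreducible q \<and> q dvd p"
proof -
  \<comment> \<open>The sum runs over the variables of the fixed \<open>p\<close>, not of
    \<open>q\<close>, so that the measures of different divisors are comparable.\<close>
  let ?\<mu> = "\<lambda>q. \<Sum>t\<in>poly_vars p. deg_in t q"
  have "\<exists>r. irreducible r \<and> r dvd q" if "q dvd p" "\<not> q dvd 1" for q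
    using that
  proof (induction "?\<mu> q" arbitrary: q rule: less_induct)
    case less
    have q0: "q \<noteq> 0" using less.prems assms by auto
    show ?case
    proof (cases "irreducible q")
      case False
      then obtain a b where ab: "q = a * b" "\<not> a dvd 1" "\<not> b dvd 1"
        using less.prems q0 by (auto simp: irreducible_def)
      have nz: "a \<noteq> 0" "b \<noteq> 0" using ab q0 by auto
      have "poly_vars b \<subseteq> poly_vars p"
        using less.prems assms by (intro poly_vars_dvd) (auto simp: ab intro: dvd_mult_right)
      moreover have "poly_vars b \<noteq> {}"
        using poly_vars_empty[of b] nz ab by (auto simp: Cst_dvd_1)
      ultimately obtain t where t: "t \<in> poly_vars p" "t \<in> poly_vars b" by auto
      then have "deg_in t b > 0" by (simp add: deg_in_pos_iff)
      with t have "?\<mu> b > 0" by (simp add: sum_pos2)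
      then have "?\<mu> a < ?\<mu> q" by (simp add: ab deg_in_mult nz sum.distrib)
      moreover have "a dvd p" using less.prems(1) by (auto simp: ab intro: dvd_mult_left)
      ultimately obtain r where "irreducible r" "r dvd a"
        using less.hyps[of a] ab(2) by blast
      then show ?thesis by (intro exI[of _ r]) (auto simp: ab)
    qed auto
  qed
  then show ?thesis using assms by auto
qed

text \<open>Existence of factorizations as an induction rule. Uniqueness is not involved, so the
  rule is available for the proof that irreducible elements are prime.\<close>

lemma cpoly_factor_induct [consumes 1, case_names const mult]:
  fixes p :: "'v::linorder cpoly"
  assumes "p \<noteq> 0"
    and "\<And>c. c \<noteq> 0 \<Longrightarrow> P (Cst c)"
    and "\<And>q a. irreducible q \<Longrightarrow> a \<noteq> 0 \<Longrightarrow> P a \<Longrightarrow> P (q * a)"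
  shows "P p"
  using assms(1)
proof (induction "\<Sum>t\<in>poly_vars p. deg_in t p" arbitrary: p rule: less_induct)
  case less
  show ?case
  proof (cases "p dvd 1")
    case True
    then show ?thesis using assms(2) by (auto simp: cpoly_unit_iff)
  next
    case False
    then obtain q where q: "irreducible q" "q dvd p"
      using exists_irreducible_factor less.prems by blast
    then obtain a where p: "p = q * a" by (elim dvdE)
    then have nz: "a \<noteq> 0" "q \<noteq> 0" using less.prems by auto
    have sub: "poly_vars a \<subseteq> poly_vars p" "poly_vars q \<subseteq> poly_vars p"
      using poly_vars_dvd[of a p] poly_vars_dvd[of q p] less.prems p by simp_all
    obtain t where t: "t \<in> poly_vars q" using poly_vars_irreducible[OF q(1)] by auto
    then have "0 < (\<Sum>t\<in>poly_vars p. deg_in t q)"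
      using sub by (intro sum_pos2[of _ t]) (auto simp: deg_in_pos_iff)
    moreover have "(\<Sum>t\<in>poly_vars a. deg_in t a) \<le> (\<Sum>t\<in>poly_vars p. deg_in t a)"
      using sub by (intro sum_mono2) auto
    moreover have "(\<Sum>t\<in>poly_vars p. deg_in t p) = (\<Sum>t\<in>poly_vars p. deg_in t q) + (\<Sum>t\<in>poly_vars p. deg_in t a)"
      by (simp add: p deg_in_mult nz sum.distrib)
    ultimately have "(\<Sum>t\<in>poly_vars a. deg_in t a) < (\<Sum>t\<in>poly_vars p. deg_in t p)" by linarith
    then have "P a" using less.hyps nz by blast
    then have "P (q * a)" by (rule assms(3)[OF q(1) nz(1)])
    then show ?thesis unfolding p .
  qed
qed

section \<open>Irreducible elements are prime: Gauss's lemma and elimination\<close>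

definition prime_in :: "'v::linorder set \<Rightarrow> bool" where
  "prime_in W \<longleftrightarrow> (\<forall>p f g. irreducible p \<and> poly_vars p \<subseteq> W \<and> poly_vars f \<subseteq> W \<and> poly_vars g \<subseteq> W \<and>
     p dvd f * g \<longrightarrow> p dvd f \<or> p dvd g)"

lemma dvd_iff_coeff_uni:
  fixes p f :: "'v::linorder cpoly"
  assumes "t \<notin> poly_vars p"
  shows "p dvd f \<longleftrightarrow> (\<forall>i. p dvd coeff (uni t f) i)"
proof -
  have "p dvd f \<longleftrightarrow> [:p:] dvd uni t f"
  proof
    assume "p dvd f"
    then show "[:p:] dvd uni t f"
      using uni.hom_dvd[of p f t] by (simp add: uni_notin[OF assms])
  next
    assume "[:p:] dvd uni t f"
    then obtain q where "uni t f = [:p:] * q" by (elim dvdE)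
    then have "poly (uni t f) (Var t) = p * poly q (Var t)" by simp
    then show "p dvd f" by (simp add: poly_uni)
  qed
  then show ?thesis by (simp add: const_poly_dvd_iff)
qed

text \<open>Gauss's lemma. For the first coefficients \<open>i\<close> and \<open>j\<close> not
  divisible by \<open>p\<close>, coefficient \<open>i + j\<close> of the product is their product
  plus multiples of \<open>p\<close>; primality over \<open>W\<close> applies to that
  product.\<close>

lemma prime_in_insert_coeff:
  assumes W: "prime_in W" and "t \<notin> W"
    and p: "irreducible p" "poly_vars p \<subseteq> W"
    and fg: "poly_vars f \<subseteq> insert t W" "poly_vars g \<subseteq> insert t W" "p dvd f * g"
  shows "p dvd f \<or> p dvd g"
proof (rule ccontr)
  assume neg: "\<not> (p dvd f \<or> p dvd g)"
  have t: "t \<notin> poly_vars p" using p assms(2) by auto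
  let ?F = "uni t f" and ?G = "uni t g"
  define i where "i = (LEAST i. \<not> p dvd coeff ?F i)"
  define j where "j = (LEAST i. \<not> p dvd coeff ?G i)"
  have i: "\<not> p dvd coeff ?F i" "\<And>k. k < i \<Longrightarrow> p dvd coeff ?F k"
    using neg dvd_iff_coeff_uni[OF t, of f] LeastI[of "\<lambda>i. \<not> p dvd coeff ?F i"]
      not_less_Least[of _ "\<lambda>i. \<not> p dvd coeff ?F i"] unfolding i_def by blast+
  have j: "\<not> p dvd coeff ?G j" "\<And>k. k < j \<Longrightarrow> p dvd coeff ?G k"
    using neg dvd_iff_coeff_uni[OF t, of g] LeastI[of "\<lambda>i. \<not> p dvd coeff ?G i"]
      not_less_Least[of _ "\<lambda>i. \<not> p dvd coeff ?G i"] unfolding j_def by blast+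
  have "p dvd (\<Sum>k\<in>{..i + j} - {i}. coeff ?F k * coeff ?G (i + j - k))"
  proof (rule dvd_sum)
    fix k assume "k \<in> {..i + j} - {i}"
    then have "k < i \<or> i + j - k < j" by auto
    then show "p dvd coeff ?F k * coeff ?G (i + j - k)"
      using i j by (auto intro: dvd_mult dvd_mult2)
  qed
  moreover have "p dvd coeff (uni t (f * g)) (i + j)"
    using fg dvd_iff_coeff_uni[OF t] by blast
  then have "p dvd coeff ?F i * coeff ?G j + (\<Sum>k\<in>{..i + j} - {i}. coeff ?F k * coeff ?G (i + j - k))"
    by (simp add: uni.hom_mult coeff_mult sum.remove[of "{..i + j}" i])
  ultimately have "p dvd coeff ?F i * coeff ?G j"
    by (simp add: dvd_add_left_iff)
  moreover have "poly_vars (coeff ?F i) \<subseteq> W" "poly_vars (coeff ?G j) \<subseteq> W"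
    using poly_vars_coeff_uni[of t f i] poly_vars_coeff_uni[of t g j] fg by auto
  ultimately show False
    using W p i j unfolding prime_in_def by blast
qed

context
  fixes W :: "'v::linorder set" and t p
  assumes W: "prime_in W" and t: "t \<notin> W"
    and p: "irreducible p" "poly_vars p \<subseteq> insert t W" "t \<in> poly_vars p"
begin

text \<open>A nonunit divisor of the irreducible \<open>p\<close> is an associate of
  \<open>p\<close>, but \<open>p\<close> contains \<open>t\<close>.\<close>

lemma irreducible_not_dvd_main:
  assumes "irreducible q" "poly_vars q \<subseteq> W"
  shows "\<not> q dvd p"
proof
  assume "q dvd p"
  then obtain r where r: "p = q * r" by (elim dvdE)
  with irreducibleD[OF p(1) r] assms(1) have "r dvd 1" by (simp add: irreducible_def)
  then obtain c where c: "r = Cst c" by (auto simp: cpoly_unit_iff)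
  have "poly_vars p \<subseteq> W" using poly_vars_mult[of q r] assms r c by auto
  with p t show False by auto
qed

text \<open>The irreducible factors \<open>q\<close> of \<open>a\<close> are removed one at a time
  from \<open>a * f = p * s\<close>: by Gauss's lemma \<open>q\<close> divides \<open>p\<close> or
  \<open>s\<close>, and it cannot divide \<open>p\<close>.\<close>

lemma cancel_coeff_factor:
  assumes "a \<noteq> 0" "poly_vars a \<subseteq> W" "poly_vars f \<subseteq> insert t W" "p dvd a * f"
  shows "p dvd f"
  using assms
proof (induction a rule: cpoly_factor_induct)
  case (const c)
  obtain d :: "'v cpoly" where d: "Cst c * d = 1" using Cst_dvd_1[OF const(1)] by (metis dvdE)
  have "p dvd d * (Cst c * f)" by (rule dvd_mult) (use const in simp)
  also have "d * (Cst c * f) = Cst c * d * f" by (simp only: mult_ac)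
  finally show ?case by (simp add: d)
next
  case (mult q a)
  have nz: "q * a \<noteq> 0" using mult by (auto simp: irreducible_def)
  have v: "poly_vars q \<subseteq> W" "poly_vars a \<subseteq> W"
    using poly_vars_dvd[OF _ nz] mult.prems by (meson dvd_triv_left dvd_triv_right subset_trans)+
  obtain s where s: "q * a * f = p * s" using mult.prems by (elim dvdE)
  show ?case
  proof (cases "f = 0")
    case False
    then have s0: "p * s \<noteq> 0" using s nz by auto
    have "poly_vars s \<subseteq> poly_vars (q * a * f)"
      using poly_vars_dvd[of s "p * s"] s0 s by simp
    also have "\<dots> \<subseteq> insert t W"
      using poly_vars_mult[of "q * a" f] mult.prems by auto
    finally have vs: "poly_vars s \<subseteq> insert t W" .
    have "q dvd p * s" unfolding s[symmetric] by (simp add: mult.assoc)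
    then have "q dvd s"
      using prime_in_insert_coeff[OF W t mult(1) v(1) p(2) vs] irreducible_not_dvd_main mult(1) v
      by blast
    then obtain s' where "s = q * s'" by (elim dvdE)
    then have "q * (a * f) = q * (p * s')" using s by (simp add: algebra_simps)
    then have "a * f = p * s'" using nz by simp
    then show ?thesis using mult.IH v mult.prems by simp
  qed simp
qed

text \<open>The irreducible factors of \<open>a\<close> are divided out of
  \<open>a * p = h * s\<close> one by one, each from \<open>h\<close> or from \<open>s\<close>. In
  the end what is left of \<open>h\<close> is a unit or an associate of \<open>p\<close>, and what
  was taken from it is free of \<open>t\<close>.\<close>

lemma dvd_or_no_var:
  assumes "a \<noteq> 0" "poly_vars a \<subseteq> W" "h dvd a * p"
  shows "p dvd h \<or> t \<notin> poly_vars h"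
  using assms
proof (induction a arbitrary: h rule: cpoly_factor_induct)
  case (const c)
  obtain d :: "'v cpoly" where d: "Cst c * d = 1" using Cst_dvd_1[OF const(1)] by (metis dvdE)
  obtain q where "Cst c * p = h * q" using const by (elim dvdE)
  then have "Cst c * d * p = h * (d * q)" by (metis mult.assoc mult.left_commute)
  then have "p = h * (d * q)" by (simp add: d)
  then have "h dvd 1 \<or> d * q dvd 1"
    by (rule irreducibleD[OF p(1)])
  then show ?case
  proof
    assume "h dvd 1"
    then show ?thesis by (auto simp: cpoly_unit_iff)
  next
    assume "d * q dvd 1"
    then obtain e where "d * q * e = 1" by (metis dvdE)
    have "p * e = h * (d * q) * e" using \<open>p = h * (d * q)\<close> by simp
    also have "\<dots> = h * (d * q * e)" by (simp only: mult_ac)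
    finally have "h = p * e" by (simp add: \<open>d * q * e = 1\<close>)
    then show ?thesis by simp
  qed
next
  case (mult q a)
  have nz: "q * a \<noteq> 0" "q \<noteq> 0" using mult by (auto simp: irreducible_def)
  have v: "poly_vars q \<subseteq> W" "poly_vars a \<subseteq> W"
    using poly_vars_dvd[OF _ nz(1)] mult.prems by (meson dvd_triv_left dvd_triv_right subset_trans)+
  obtain s where s: "q * a * p = h * s" using mult.prems by (elim dvdE)
  have s0: "h * s \<noteq> 0" using s nz p by (auto simp: irreducible_def)
  have "poly_vars (q * a * p) \<subseteq> insert t W"
    using poly_vars_mult[of "q * a" p] mult.prems p by auto
  then have vs: "poly_vars s \<subseteq> insert t W" "poly_vars h \<subseteq> insert t W"
    using poly_vars_dvd[of s "h * s"] poly_vars_dvd[of h "h * s"] s0 s by auto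
  have "q dvd h * s" unfolding s[symmetric] by (simp add: mult.assoc)
  then have "q dvd h \<or> q dvd s"
    using prime_in_insert_coeff[OF W t mult(1) v(1) vs(2) vs(1)] by blast
  then show ?case
  proof
    assume "q dvd h"
    then obtain h' where h': "h = q * h'" by (elim dvdE)
    then have "q * (a * p) = q * (h' * s)" using s by (simp add: algebra_simps)
    then have "h' dvd a * p" using nz by simp
    then have "p dvd h' \<or> t \<notin> poly_vars h'" using mult.IH v by blast
    then show ?thesis using poly_vars_mult[of q h'] v t h' by auto
  next
    assume "q dvd s"
    then obtain s' where "s = q * s'" by (elim dvdE)
    then have "q * (a * p) = q * (h * s')" using s by (simp add: algebra_simps)
    then have "h dvd a * p" using nz by simp
    then show ?thesis using mult.IH v by blast
  qed
qed

text \<open>An element \<open>h\<close> of least \<open>t\<close>-degree in the ideal of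
  \<open>p\<close> and \<open>f\<close> divides, by pseudo-division, a nonzero \<open>t\<close>-free
  multiple of every element. If \<open>h\<close> contained \<open>t\<close>, the multiple of
  \<open>p\<close> would give that \<open>p\<close> divides \<open>h\<close>, and the multiple of
  \<open>f\<close> that \<open>p\<close> divides \<open>f\<close>.\<close>

lemma elimination_in:
  assumes f: "poly_vars f \<subseteq> insert t W" "\<not> p dvd f"
  shows "\<exists>h u v. h \<noteq> 0 \<and> poly_vars h \<subseteq> W \<and> h = u * p + v * f"
proof -
  let ?W = "insert t W"
  define I where "I = {w. \<exists>u v. poly_vars u \<subseteq> ?W \<and> poly_vars v \<subseteq> ?W \<and> w = u * p + v * f}"
  have pI: "p \<in> I" unfolding I_def by (rule CollectI, rule exI[of _ 1], rule exI[of _ 0]) simp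
  have fI: "f \<in> I" unfolding I_def by (rule CollectI, rule exI[of _ 0], rule exI[of _ 1]) simp
  have I_diff: "x * w - y * w' \<in> I" if xy: "w \<in> I" "w' \<in> I" "poly_vars x \<subseteq> ?W" "poly_vars y \<subseteq> ?W" for x y w w'
  proof -
    obtain u v u' v' where *: "w = u * p + v * f" "w' = u' * p + v' * f" "poly_vars u \<subseteq> ?W" "poly_vars v \<subseteq> ?W"
       "poly_vars u' \<subseteq> ?W" "poly_vars v' \<subseteq> ?W" using xy unfolding I_def by blast
    have **: "poly_vars (x * u - y * u') \<subseteq> ?W" if "poly_vars u \<subseteq> ?W" "poly_vars u' \<subseteq> ?W" for u u'
      using poly_vars_diff[of "x * u" "y * u'"] poly_vars_mult[of x u] poly_vars_mult[of y u'] xy that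
      by blast
    have "x * w - y * w' = (x * u - y * u') * p + (x * v - y * v') * f"
      by (simp add: *(1,2) algebra_simps)
    then show ?thesis unfolding I_def using ** *(3-6) by blast
  qed
  have I_vars: "poly_vars w \<subseteq> ?W" if "w \<in> I" for w
  proof -
    obtain u v where *: "w = u * p + v * f" "poly_vars u \<subseteq> ?W" "poly_vars v \<subseteq> ?W"
      using \<open>w \<in> I\<close> unfolding I_def by blast
    show ?thesis
      unfolding *(1) using poly_vars_add[of "u * p" "v * f"] poly_vars_mult[of u p] poly_vars_mult[of v f] * p f by blast
  qed
  have "p \<noteq> 0" using p by (auto simp: irreducible_def)
  then obtain h where h: "h \<in> I" "h \<noteq> 0" and least: "\<And>w. w \<in> I \<Longrightarrow> w \<noteq> 0 \<Longrightarrow> deg_in t h \<le> deg_in t w"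
    using ex_has_least_nat[of "\<lambda>w. w \<in> I \<and> w \<noteq> 0" p "deg_in t"] pI by blast
  let ?l = "lead_coeff (uni t h)"
  have l: "?l \<noteq> 0" "poly_vars ?l \<subseteq> W" using h I_vars[of h] poly_vars_coeff_uni[of t h] by auto
  have div: "\<exists>a. a \<noteq> 0 \<and> poly_vars a \<subseteq> W \<and> h dvd a * w" if "w \<in> I" for w
    using that
  proof (induction "deg_in t w" arbitrary: w rule: less_induct)
    case less
    show ?case
    proof (cases "w = 0")
      case True
      then show ?thesis by (intro exI[of _ 1]) auto
    next
      case False
      define lw where "lw = lead_coeff (uni t w)"
      define e where "e = deg_in t w - deg_in t h"
      have e: "deg_in t w = e + deg_in t h" using least[OF less.prems False] by (simp add: e_def)
      \<comment> \<open>One step of pseudo-division: both terms have the same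
        \<open>t\<close>-degree and leading coefficient, so the top coefficient cancels.\<close>
      define w' where "w' = ?l * w - (lw * Var t ^ e) * h"
      have lw: "poly_vars lw \<subseteq> W"
        using less.prems I_vars[of w] poly_vars_coeff_uni[of t w] unfolding lw_def by blast
      have ll: "uni t ?l = [:?l:]" "uni t lw = [:lw:]" using l lw t by (auto intro!: uni_notin)
      have "poly_vars (lw * Var t ^ e) \<subseteq> ?W"
        using poly_vars_mult[of lw "Var t ^ e"] lw poly_vars_power[of "Var t" e] by auto
      then have w'I: "w' \<in> I" unfolding w'_def using l less.prems h by (intro I_diff) auto
      have X: "[:0, 1:] ^ e = monom (1 :: 'v cpoly) e" by (simp add: monom_altdef)
      have uw': "uni t w' = smult ?l (uni t w) - smult lw (monom 1 e * uni t h)"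
        unfolding w'_def by (simp add: uni.hom_minus uni.hom_mult uni.hom_power uni_Var ll X mult.assoc)
      have c0: "coeff (uni t w') i = 0" if "i \<ge> deg_in t w" for i
      proof (cases "i = deg_in t w")
        case True
        then show ?thesis using e
          by (simp add: uw' coeff_monom_mult lw_def deg_in_def)
      next
        case False
        then have "i > deg_in t w" "i - e > deg_in t h" using that e by auto
        then show ?thesis
          by (simp add: uw' coeff_monom_mult deg_in_def coeff_eq_0)
      qed
      have "\<exists>a. a \<noteq> 0 \<and> poly_vars a \<subseteq> W \<and> h dvd a * w'"
      proof (cases "w' = 0")
        case True
        then show ?thesis by (intro exI[of _ 1]) auto
      next
        case False
        then have "coeff (uni t w') (deg_in t w') \<noteq> 0" by (simp add: deg_in_def)
        then have "deg_in t w' < deg_in t w" using c0 not_le by blast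
        then show ?thesis using less.hyps w'I by blast
      qed
      then obtain a where a: "a \<noteq> 0" "poly_vars a \<subseteq> W" "h dvd a * w'" by blast
      have "h dvd a * w' + a * (lw * Var t ^ e) * h" using a by simp
      also have "a * w' + a * (lw * Var t ^ e) * h = a * ?l * w"
        by (simp add: w'_def algebra_simps)
      finally show ?thesis
        using a l poly_vars_mult[of a ?l] by (intro exI[of _ "a * ?l"]) auto
    qed
  qed
  have "t \<notin> poly_vars h"
  proof
    assume th: "t \<in> poly_vars h"
    from div[OF pI] have "p dvd h" using dvd_or_no_var th by blast
    moreover from div[OF fI] obtain b where b: "b \<noteq> 0" "poly_vars b \<subseteq> W" "h dvd b * f" by blast
    ultimately have "p dvd f" using cancel_coeff_factor[OF b(1,2) f(1)] dvd_trans by blast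
    with f show False by simp
  qed
  then have "poly_vars h \<subseteq> W" using I_vars[OF h(1)] by auto
  with h show ?thesis unfolding I_def by blast
qed

end

text \<open>Induction on the variables, which is why \<open>prime_in\<close> confines them to a set.
  If \<open>p\<close> contains the new \<open>t\<close> and does not divide \<open>f\<close>,
  elimination gives a nonzero \<open>t\<close>-free \<open>h = u * p + v * f\<close>; then
  \<open>p\<close> divides \<open>h * g\<close>, and \<open>h\<close> can be cancelled.\<close>

lemma prime_in_finite: "finite W \<Longrightarrow> prime_in W"
proof (induction W rule: finite_induct)
  case empty
  show ?case unfolding prime_in_def
  proof (intro allI impI, elim conjE)
    fix p :: "'a cpoly" assume "irreducible p" "poly_vars p \<subseteq> {}"
    then show "p dvd f \<or> p dvd g" for f g
      using poly_vars_irreducible[of p] by auto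
  qed
next
  case (insert t W)
  note W = insert.IH and t = insert.hyps(2)
  show ?case unfolding prime_in_def
  proof (intro allI impI, elim conjE)
    fix p f g :: "'a cpoly"
    assume p: "irreducible p" "poly_vars p \<subseteq> insert t W" and fg: "poly_vars f \<subseteq> insert t W"
      "poly_vars g \<subseteq> insert t W" "p dvd f * g"
    show "p dvd f \<or> p dvd g"
    proof (cases "t \<in> poly_vars p")
      case False
      then have "poly_vars p \<subseteq> W" using p by auto
      then show ?thesis using prime_in_insert_coeff[OF W t p(1)] fg by blast
    next
      case True
      show ?thesis
      proof (cases "p dvd f")
        case False
        then obtain h u v where h: "h \<noteq> 0" "poly_vars h \<subseteq> W" "h = u * p + v * f"
          using elimination_in[OF W t p True fg(1)] by blast
        have "h * g = p * (u * g) + v * (f * g)" using h by (simp add: algebra_simps)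
        then have "p dvd h * g" using fg by (simp add: dvd_mult)
        then show ?thesis
          using cancel_coeff_factor[OF W t p True h(1,2) fg(2)] by blast
      qed simp
    qed
  qed
qed

lemma elimination:
  fixes p :: "'v::linorder cpoly"
  assumes "irreducible p" "t \<in> poly_vars p" "\<not> p dvd f"
  shows "\<exists>h u v. h \<noteq> 0 \<and> t \<notin> poly_vars h \<and> h = u * p + v * f"
proof -
  let ?W = "poly_vars p \<union> poly_vars f - {t}"
  have "\<exists>h u v. h \<noteq> 0 \<and> poly_vars h \<subseteq> ?W \<and> h = u * p + v * f"
    using assms by (intro elimination_in prime_in_finite) auto
  then show ?thesis by blast
qed

section \<open>Zero sets of irreducible polynomials\<close>

lemma hom_map_poly:
  assumes "comm_ring_hom h"
  shows "comm_ring_hom (map_poly h)"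
proof -
  interpret comm_ring_hom h by fact
  show ?thesis
    by unfold_locales
      (auto intro!: poly_eqI simp: coeff_map_poly hom_add coeff_mult hom_sum hom_mult)
qed

lemma hom_eval_uni: "comm_ring_hom (\<lambda>q. poly (map_poly (poly_eval x) q) s)"
  by (rule hom_comp[OF hom_poly hom_map_poly[OF hom_poly_eval]])

lemma poly_eval_upd:
  "poly_eval (x(t := s)) p = poly (map_poly (poly_eval x) (uni t p)) s"
proof -
  let ?h = "\<lambda>q. poly (map_poly (poly_eval x) q) s"
  interpret h: comm_ring_hom ?h by (rule hom_eval_uni)
  have "?h (uni t p) = ev (\<lambda>c. ?h [:Cst c:]) (\<lambda>v. ?h (if v = t then [:0, 1:] else [:Var v:])) p"
    unfolding uni_def by (rule hom_ev[OF hom_eval_uni])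
  also have "(\<lambda>c. ?h [:Cst c:]) = id" by (auto simp: map_poly_pCons)
  also have "(\<lambda>v. ?h (if v = t then [:0, 1:] else [:Var v:])) = x(t := s)"
    by (auto simp: map_poly_pCons)
  finally show ?thesis by (simp only: poly_eval_eq_ev[of "x(t := s)"])
qed

lemma poly_eval_curve: "poly (ev (\<lambda>c. [:c:]) q p) s = poly_eval (\<lambda>v. poly (q v) s) p"
  by (simp add: hom_ev[OF hom_poly] poly_eval_eq_ev id_def)

lemma exists_nonroot:
  fixes q :: "complex poly"
  assumes "q \<noteq> 0"
  obtains s where "s \<noteq> 0" "poly q s \<noteq> 0"
proof -
  have "finite ({s. poly q s = 0} \<union> {0})" using poly_roots_finite[OF assms] by simp
  then obtain s where "s \<notin> {s. poly q s = 0} \<union> {0}"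
    using ex_new_if_finite[OF infinite_UNIV_char_0] by blast
  then show ?thesis using that[of s] by simp
qed

text \<open>The leading coefficient in a variable \<open>t\<close> has fewer variables; at a point
  where it is nonzero, all but finitely many values of \<open>t\<close> work. Nonzero coordinates
  are demanded because a later construction divides by them.\<close>

lemma exists_nonvanishing_point:
  fixes p :: "'v::linorder cpoly"
  assumes "p \<noteq> 0"
  shows "\<exists>x. (\<forall>v. x v \<noteq> 0) \<and> poly_eval x p \<noteq> 0"
  using assms
proof (induction "card (poly_vars p)" arbitrary: p rule: less_induct)
  case less
  show ?case
  proof (cases "poly_vars p = {}")
    case True
    then obtain c where "p = Cst c" using poly_vars_empty by blast
    with less.prems show ?thesis by (intro exI[of _ "\<lambda>_. 1"]) auto
  next
    case False
    then obtain t where t: "t \<in> poly_vars p" by auto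
    let ?c = "lead_coeff (uni t p)"
    have "poly_vars ?c \<subset> poly_vars p" using poly_vars_coeff_uni[of t p] t by auto
    then have "card (poly_vars ?c) < card (poly_vars p)" by (intro psubset_card_mono) auto
    moreover have "?c \<noteq> 0" using less.prems by simp
    ultimately obtain x where x: "\<forall>v. x v \<noteq> 0" "poly_eval x ?c \<noteq> 0" using less.hyps by blast
    let ?q = "map_poly (poly_eval x) (uni t p)"
    have "coeff ?q (deg_in t p) \<noteq> 0" using x by (simp add: coeff_map_poly deg_in_def)
    then have "?q \<noteq> 0" by (metis coeff_0)
    then obtain s where "s \<noteq> 0" "poly ?q s \<noteq> 0" by (rule exists_nonroot)
    then show ?thesis using x by (intro exI[of _ "x(t := s)"]) (simp add: poly_eval_upd)
  qed
qed

text \<open>If \<open>p\<close> did not divide \<open>g\<close>, an eliminant \<open>h\<close>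
  without \<open>t\<close> would vanish at every zero of \<open>p\<close>. But the other coordinates
  can be chosen with \<open>h\<close> and the leading coefficient of \<open>p\<close> nonzero, and
  then \<open>t\<close> as a root of \<open>p\<close>.\<close>

lemma irreducible_dvd_if_vanishes:
  fixes p :: "'v::linorder cpoly"
  assumes p: "irreducible p" and van: "\<And>x. poly_eval x p = 0 \<Longrightarrow> poly_eval x g = 0"
  shows "p dvd g"
proof (rule ccontr)
  assume "\<not> p dvd g"
  obtain t where t: "t \<in> poly_vars p" using poly_vars_irreducible[OF p] by auto
  then obtain h u v where h: "h \<noteq> 0" "t \<notin> poly_vars h" "h = u * p + v * g"
    using elimination[OF p t \<open>\<not> p dvd g\<close>] by blast
  let ?l = "lead_coeff (uni t p)"
  have "?l \<noteq> 0" using p by (auto simp: irreducible_def)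
  then have "h * ?l \<noteq> 0" using h by simp
  then obtain x where "poly_eval x (h * ?l) \<noteq> 0" using exists_nonvanishing_point by blast
  then have x: "poly_eval x h \<noteq> 0" "poly_eval x ?l \<noteq> 0" by (simp_all add: poly_eval.hom_mult)
  let ?q = "map_poly (poly_eval x) (uni t p)"
  have "coeff ?q (deg_in t p) \<noteq> 0" using x by (simp add: coeff_map_poly deg_in_def)
  then have "degree ?q \<ge> deg_in t p" by (rule le_degree)
  moreover have "deg_in t p > 0" using t by (simp add: deg_in_pos_iff)
  ultimately have "\<not> constant (poly ?q)" by (simp add: constant_degree)
  then obtain s where "poly ?q s = 0" using fundamental_theorem_of_algebra by blast
  then have p0: "poly_eval (x(t := s)) p = 0" by (simp add: poly_eval_upd)
  then have "poly_eval (x(t := s)) h = 0"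
    using van[OF p0] h(3) by (simp add: poly_eval.hom_add poly_eval.hom_mult)
  moreover have "poly_eval (x(t := s)) h = poly_eval x h"
    by (rule poly_eval_cong) (use h in auto)
  ultimately show False using x by simp
qed

lemma irreducible_dvd_irreducible:
  fixes p q :: "'v::linorder cpoly"
  assumes "irreducible p" "irreducible q" "q dvd p"
  shows "\<exists>c. c \<noteq> 0 \<and> q = Cst c * p"
proof -
  obtain u where u: "p = q * u" using assms by (elim dvdE)
  have "u dvd 1" using irreducibleD[OF assms(1) u] assms(2) by (simp add: irreducible_def)
  then obtain c where c: "c \<noteq> 0" "u = Cst c" by (auto simp: cpoly_unit_iff)
  have "Cst (inverse c) * p = q * (Cst (inverse c) * Cst c)"
    unfolding u c by (simp only: mult_ac)
  also have "\<dots> = q" using c by (simp flip: Cst.hom_mult)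
  finally show ?thesis using c by (intro exI[of _ "inverse c"]) simp
qed

text \<open>Every irreducible factor of \<open>g\<close> vanishes only at zeros of \<open>p\<close>,
  so it divides \<open>p\<close> and is an associate of it.\<close>

lemma vanishing_subset_power:
  fixes p g :: "'v::linorder cpoly"
  assumes p: "irreducible p" and "g \<noteq> 0" and van: "\<And>x. poly_eval x g = 0 \<Longrightarrow> poly_eval x p = 0"
  shows "\<exists>c a. c \<noteq> 0 \<and> g = Cst c * p ^ a"
  using assms(2) van
proof (induction g rule: cpoly_factor_induct)
  case (const c)
  then show ?case by (intro exI[of _ c] exI[of _ 0]) simp
next
  case (mult q a)
  have "q dvd p"
    by (rule irreducible_dvd_if_vanishes[OF mult(1)]) (auto intro: mult.prems simp: poly_eval.hom_mult)
  then obtain c where c: "c \<noteq> 0" "q = Cst c * p"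
    using irreducible_dvd_irreducible[OF p mult(1)] by blast
  obtain c' k where k: "c' \<noteq> 0" "a = Cst c' * p ^ k"
    using mult.IH mult.prems by (auto simp: poly_eval.hom_mult)
  have "q * a = Cst (c * c') * p ^ Suc k"
    unfolding c k by (simp add: Cst.hom_mult mult_ac)
  then show ?case using c k by (intro exI[of _ "c * c'"] exI[of _ "Suc k"]) simp
qed

section \<open>Systems of forms with a nontrivial zero\<close>

text \<open>The value type is arbitrary because coefficients and points are later polynomials in a
  curve parameter.\<close>

definition form_at :: "nat \<Rightarrow> nat \<Rightarrow> (coeff_var \<Rightarrow> 'b) \<Rightarrow> nat \<Rightarrow> (nat \<Rightarrow> 'b) \<Rightarrow> 'b::comm_ring_1" where
  "form_at n d c i x = (\<Sum>\<alpha>\<in>monoms n d. c (i, \<alpha>) * mon x \<alpha>)"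

definition has_zero :: "nat \<Rightarrow> nat \<Rightarrow> (coeff_var \<Rightarrow> complex) \<Rightarrow> bool" where
  "has_zero n d c \<longleftrightarrow> (\<exists>x. (\<exists>i\<in>{1..n}. x i \<noteq> 0) \<and> (\<forall>i\<in>{1..n}. form_at n d c i x = 0))"

definition vanishing :: "nat \<Rightarrow> nat \<Rightarrow> coeff_var cpoly set" where
  "vanishing n d = {g. poly_vars g \<subseteq> coeff_vars n d \<and> (\<forall>c. has_zero n d c \<longrightarrow> poly_eval c g = 0)}"

lemma finite_monoms [simp]: "finite (monoms n d)"
proof -
  have "monoms n d \<subseteq> (\<lambda>f. Abs_poly_mapping (\<lambda>j. if j \<in> {1..n} then f j else 0)) ` ({1..n} \<rightarrow>\<^sub>E {0..d})"
  proof
    fix \<alpha> assume \<alpha>: "\<alpha> \<in> monoms n d"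
    then have k: "pkeys \<alpha> \<subseteq> {1..n}" and s: "(\<Sum>j\<in>{1..n}. plookup \<alpha> j) = d" by (auto simp: monoms_def)
    define f where "f = restrict (plookup \<alpha>) {1..n}"
    have "plookup \<alpha> j \<le> d" if "j \<in> {1..n}" for j
      unfolding s[symmetric] using that by (intro member_le_sum) auto
    then have "f \<in> {1..n} \<rightarrow>\<^sub>E {0..d}" by (auto simp: f_def)
    moreover have "(\<lambda>j. if j \<in> {1..n} then f j else 0) = plookup \<alpha>"
      by (rule ext) (use k in \<open>auto simp: f_def in_keys_iff subset_iff\<close>)
    ultimately show "\<alpha> \<in> (\<lambda>f. Abs_poly_mapping (\<lambda>j. if j \<in> {1..n} then f j else 0)) ` ({1..n} \<rightarrow>\<^sub>E {0..d})"
      by (intro image_eqI[of _ _ f]) (auto simp: lookup_inverse)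
  qed
  then show ?thesis by (rule finite_subset) (intro finite_imageI finite_PiE, auto)
qed

lemma single_in_monoms: "j \<in> {1..n} \<Longrightarrow> Poly_Mapping.single j d \<in> monoms n d"
  by (auto simp: monoms_def lookup_single when_def)

lemma monoms_add: "\<alpha> \<in> monoms n d \<Longrightarrow> \<beta> \<in> monoms n e \<Longrightarrow> \<alpha> + \<beta> \<in> monoms n (d + e)"
  using Poly_Mapping.keys_add[of \<alpha> \<beta>] by (auto simp: monoms_def lookup_add sum.distrib)

lemma monoms_pos_key:
  assumes "\<alpha> \<in> monoms n d" "d \<ge> 1"
  obtains j where "j \<in> {1..n}" "plookup \<alpha> j > 0"
proof -
  have "(\<Sum>j\<in>{1..n}. plookup \<alpha> j) > 0" using assms by (auto simp: monoms_def)
  then have "\<exists>j\<in>{1..n}. plookup \<alpha> j \<noteq> 0" by (metis sum.neutral less_numeral_extra(3))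
  then show ?thesis using that by auto
qed

lemma mon_eq_0:
  assumes "\<alpha> \<in> monoms n d" "plookup \<alpha> j > 0" "x j = 0"
  shows "mon x \<alpha> = (0 :: complex)"
  using assms unfolding mon_def by (intro prod_zero) (auto simp: in_keys_iff intro!: bexI[of _ j])

lemma hom_form_at:
  assumes "comm_ring_hom h"
  shows "h (form_at n d c i x) = form_at n d (\<lambda>v. h (c v)) i (\<lambda>v. h (x v))"
proof -
  interpret comm_ring_hom h by fact
  show ?thesis by (simp add: form_at_def hom_sum hom_mult hom_mon[OF assms])
qed

lemma form_at_zero_vector:
  assumes "d \<ge> 1" "\<And>j. j \<in> {1..n} \<Longrightarrow> x j = 0"
  shows "form_at n d c i x = (0 :: complex)"
  unfolding form_at_def
proof (rule sum.neutral, rule ballI)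
  fix \<alpha> assume \<alpha>: "\<alpha> \<in> monoms n d"
  then obtain j where "j \<in> {1..n}" "plookup \<alpha> j > 0" using monoms_pos_key assms(1) by blast
  then show "c (i, \<alpha>) * mon x \<alpha> = 0" using mon_eq_0[OF \<alpha>] assms(2) by simp
qed

lemma has_zero_cong:
  assumes "\<And>v. v \<in> coeff_vars n d \<Longrightarrow> c v = c' v"
  shows "has_zero n d c = has_zero n d c'"
proof -
  have "form_at n d c i x = form_at n d c' i x" if "i \<in> {1..n}" for i x
    unfolding form_at_def using that assms by (intro sum.cong) (auto simp: coeff_vars_def)
  then show ?thesis by (simp add: has_zero_def)
qed

lemma has_zero_0: "n \<ge> 1 \<Longrightarrow> has_zero n d (\<lambda>_. 0)"
  unfolding has_zero_def by (intro exI[of _ "\<lambda>_. 1"]) (auto simp: form_at_def intro!: bexI[of _ 1])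

text \<open>One of \<open>x_i^d\<close>, \<open>x_j^d\<close> and their sum is nonzero at both
  points.\<close>

lemma exists_form_nonzero_at_two:
  fixes x y :: "nat \<Rightarrow> complex"
  assumes "i \<in> {1..n}" "x i \<noteq> 0" "j \<in> {1..n}" "y j \<noteq> 0"
  shows "\<exists>\<eta>. (\<Sum>\<alpha>\<in>monoms n d. \<eta> \<alpha> * mon x \<alpha>) \<noteq> 0 \<and> (\<Sum>\<alpha>\<in>monoms n d. \<eta> \<alpha> * mon y \<alpha>) \<noteq> 0"
proof -
  define H where "H \<eta> x = (\<Sum>\<alpha>\<in>monoms n d. \<eta> \<alpha> * mon x \<alpha>)" for \<eta> and x :: "nat \<Rightarrow> complex"
  define e where "e k = (\<lambda>\<alpha>. if \<alpha> = Poly_Mapping.single k d then 1 else 0 :: complex)" for k :: nat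
  have e: "H (e k) z = z k ^ d" if "k \<in> {1..n}" for k z
  proof -
    have "H (e k) z = (\<Sum>\<alpha>\<in>monoms n d. if \<alpha> = Poly_Mapping.single k d then mon z \<alpha> else 0)"
      unfolding H_def e_def by (rule sum.cong) auto
    then show ?thesis using single_in_monoms[OF that, of d] by (simp add: mon_single)
  qed
  have add: "H (\<lambda>\<alpha>. \<eta> \<alpha> + \<eta>' \<alpha>) z = H \<eta> z + H \<eta>' z" for \<eta> \<eta>' z
    by (simp add: H_def distrib_right sum.distrib)
  have "H (e i) x \<noteq> 0" "H (e j) y \<noteq> 0" using assms by (simp_all add: e)
  then have "\<exists>\<eta>\<in>{e i, e j, \<lambda>\<alpha>. e i \<alpha> + e j \<alpha>}. H \<eta> x \<noteq> 0 \<and> H \<eta> y \<noteq> 0"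
    by (auto simp: add)
  then obtain \<eta> where "H \<eta> x \<noteq> 0 \<and> H \<eta> y \<noteq> 0" by blast
  then show ?thesis unfolding H_def by (intro exI[of _ \<eta>]) simp
qed

text \<open>
  Two systems with nontrivial zeros can be joined by a polynomial curve of such systems:
  correct the segment between them by the multiple of a fixed form that makes the point on the
  segment between the zeros a zero.
\<close>

lemma vanishing_prime:
  assumes d: "d \<ge> 1" and g: "poly_vars g1 \<subseteq> coeff_vars n d" "poly_vars g2 \<subseteq> coeff_vars n d"
    and "g1 * g2 \<in> vanishing n d"
  shows "g1 \<in> vanishing n d \<or> g2 \<in> vanishing n d"
proof (rule ccontr)
  assume "\<not> (g1 \<in> vanishing n d \<or> g2 \<in> vanishing n d)"
  then obtain c1 c2 where c: "has_zero n d c1" "poly_eval c1 g1 \<noteq> 0" "has_zero n d c2" "poly_eval c2 g2 \<noteq> 0"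
    using g by (auto simp: vanishing_def)
  obtain x1 i1 where x1: "i1 \<in> {1..n}" "x1 i1 \<noteq> 0" "\<And>i. i \<in> {1..n} \<Longrightarrow> form_at n d c1 i x1 = 0"
    using c(1) unfolding has_zero_def by blast
  obtain x2 i2 where x2: "i2 \<in> {1..n}" "x2 i2 \<noteq> 0" "\<And>i. i \<in> {1..n} \<Longrightarrow> form_at n d c2 i x2 = 0"
    using c(3) unfolding has_zero_def by blast
  obtain \<eta> where \<eta>: "(\<Sum>\<alpha>\<in>monoms n d. \<eta> \<alpha> * mon x1 \<alpha>) \<noteq> 0" "(\<Sum>\<alpha>\<in>monoms n d. \<eta> \<alpha> * mon x2 \<alpha>) \<noteq> 0"
    using exists_form_nonzero_at_two[of i1 n x1 i2 x2] x1(1,2) x2(1,2) by blast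
  define H where "H x = (\<Sum>\<alpha>\<in>monoms n d. \<eta> \<alpha> * mon x \<alpha>)" for x :: "nat \<Rightarrow> complex"
  define Y where "Y j = [:x1 j, x2 j - x1 j:]" for j
  \<comment> \<open>The divisions offset the factor \<open>HP\<close> in \<open>C\<close>, so that
    \<open>C\<close> runs from \<open>c1\<close> to \<open>c2\<close>.\<close>
  define E where "E v = [:c1 v / H x1, c2 v / H x2 - c1 v / H x1:]" for v
  define HP where "HP = (\<Sum>\<alpha>\<in>monoms n d. [:\<eta> \<alpha>:] * mon Y \<alpha>)"
  define C where "C v = E v * HP - form_at n d E (fst v) Y * [:\<eta> (snd v):]" for v
  define y where "y s j = poly (Y j) s" for s j
  have HP: "poly HP s = H (y s)" for s
    by (simp add: HP_def H_def poly_sum hom_mon[OF hom_poly] y_def[abs_def])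
  have FE: "poly (form_at n d E i Y) s = form_at n d (\<lambda>v. poly (E v) s) i (y s)" for i s
    by (simp add: hom_form_at[OF hom_poly] y_def[abs_def])
  have y01: "y 0 = x1" "y 1 = x2" by (auto simp: y_def Y_def)
  have scale: "form_at n d (\<lambda>v. a v / b) i x = form_at n d a i x / b" for a i x and b :: complex
    by (simp add: form_at_def sum_divide_distrib)
  have H0: "H x1 \<noteq> 0" "H x2 \<noteq> 0" using \<eta> by (simp_all add: H_def)
  have E01: "poly (E v) 0 = c1 v / H x1" "poly (E v) 1 = c2 v / H x2" for v by (simp_all add: E_def)
  have C0: "poly (C v) 0 = c1 v" if "v \<in> coeff_vars n d" for v
    using that x1(3) H0 by (auto simp: C_def HP FE y01 E01 scale coeff_vars_def)
  have C1: "poly (C v) 1 = c2 v" if "v \<in> coeff_vars n d" for v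
    using that x2(3) H0 by (auto simp: C_def HP FE y01 E01 scale coeff_vars_def)
  define Q where "Q g = ev (\<lambda>c. [:c:]) C g" for g
  have Q: "poly (Q g) s = poly_eval (\<lambda>v. poly (C v) s) g" for g s
    unfolding Q_def by (rule poly_eval_curve)
  have "poly (Q g1) 0 = poly_eval c1 g1" "poly (Q g2) 1 = poly_eval c2 g2"
    unfolding Q by (rule poly_eval_cong, use g C0 C1 in blast)+
  then have "Q g1 \<noteq> 0" "Q g2 \<noteq> 0" using c by auto
  \<comment> \<open>The parameter must avoid the roots of \<open>HP\<close> too: a nonzero value of
    \<open>HP\<close> keeps \<open>y s\<close> away from the zero vector.\<close>
  moreover have "HP \<noteq> 0" using HP[of 0] \<eta> by (auto simp: y01 H_def)
  ultimately have "Q g1 * Q g2 * HP \<noteq> 0" by simp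
  then obtain s where s: "poly (Q g1 * Q g2 * HP) s \<noteq> 0" by (rule exists_nonroot)
  let ?c = "\<lambda>v. poly (C v) s"
  have "form_at n d ?c i (y s) = 0" for i
  proof -
    let ?e = "\<lambda>v. poly (E v) s"
    let ?F = "form_at n d ?e i (y s)"
    have "form_at n d ?c i (y s) = (\<Sum>\<alpha>\<in>monoms n d. ?e (i, \<alpha>) * mon (y s) \<alpha> * H (y s) - ?F * (\<eta> \<alpha> * mon (y s) \<alpha>))"
      unfolding form_at_def[of n d ?c] by (rule sum.cong) (simp_all add: C_def HP FE algebra_simps)
    also have "\<dots> = ?F * H (y s) - ?F * H (y s)"
      unfolding sum_subtractf sum_distrib_left[symmetric] sum_distrib_right[symmetric]
      by (simp add: form_at_def H_def)
    finally show ?thesis by simp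
  qed
  moreover have "\<exists>i\<in>{1..n}. y s i \<noteq> 0"
  proof (rule ccontr)
    assume "\<not> (\<exists>i\<in>{1..n}. y s i \<noteq> 0)"
    then have "form_at n d (\<lambda>v. \<eta> (snd v)) 1 (y s) = 0" by (intro form_at_zero_vector[OF d]) auto
    then have "H (y s) = 0" by (simp add: H_def form_at_def)
    then show False using s HP by simp
  qed
  ultimately have "has_zero n d ?c" unfolding has_zero_def by blast
  then have "poly_eval ?c (g1 * g2) = 0" using assms(4) by (simp add: vanishing_def)
  then show False using s by (simp add: Q poly_eval.hom_mult)
qed

section \<open>Values along curves, and the role of the top coefficient\<close>

lemma mon_scale:
  fixes z :: "'v \<Rightarrow> complex"
  shows "mon (\<lambda>v. \<epsilon> ^ w v * z v) \<alpha> = \<epsilon> ^ (\<Sum>v\<in>pkeys \<alpha>. w v * plookup \<alpha> v) * mon z \<alpha>"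
  by (simp add: mon_def power_mult_distrib prod.distrib power_sum flip: power_mult)

lemma tendsto_mon:
  fixes f :: "'v \<Rightarrow> 'b \<Rightarrow> complex"
  assumes "\<And>v. v \<in> pkeys \<alpha> \<Longrightarrow> (f v \<longlongrightarrow> l v) F"
  shows "((\<lambda>\<epsilon>. mon (\<lambda>v. f v \<epsilon>) \<alpha>) \<longlongrightarrow> mon l \<alpha>) F"
  unfolding mon_def by (intro tendsto_prod tendsto_power assms)

text \<open>
  The values of \<open>a\<close> along a curve \<open>\<epsilon> \<mapsto> (\<epsilon>\<^bsup>w v\<^esup> (x\<^sub>v + o(1)))\<^sub>v\<close> are governed by the part of \<open>a\<close>
  of lowest weight, which has a nonzero value at a suitable \<open>x\<close>.
\<close>

lemma nonvanishing_along_curve: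
  fixes a :: "'v::linorder cpoly" and w :: "'v \<Rightarrow> nat"
  assumes "a \<noteq> 0"
  shows "\<exists>x. (\<forall>v. x v \<noteq> 0) \<and> (\<forall>h. (\<forall>v\<in>poly_vars a. (h v \<longlongrightarrow> 0) (at 0)) \<longrightarrow>
    (\<exists>\<epsilon>. \<epsilon> \<noteq> 0 \<and> poly_eval (\<lambda>v. \<epsilon> ^ w v * (x v + h v \<epsilon>)) a \<noteq> 0))"
proof -
  define W where "W \<alpha> = (\<Sum>v\<in>pkeys \<alpha>. w v * plookup \<alpha> v)" for \<alpha> :: "'v \<Rightarrow>\<^sub>0 nat"
  define r where "r = Min (W ` pkeys a)"
  have ne: "pkeys a \<noteq> {}" using assms by simp
  have r: "r \<le> W \<alpha>" if "\<alpha> \<in> pkeys a" for \<alpha> unfolding r_def using that by simp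
  have "r \<in> W ` pkeys a" unfolding r_def using ne by (intro Min_in) auto
  then obtain \<alpha>0 where \<alpha>0: "\<alpha>0 \<in> pkeys a" "W \<alpha>0 = r" by auto
  define L where "L = (\<Sum>\<alpha>\<in>pkeys a. Poly_Mapping.single \<alpha> (if W \<alpha> = r then plookup a \<alpha> else 0))"
  have "plookup L \<alpha>0 = (\<Sum>\<alpha>\<in>pkeys a. if \<alpha> = \<alpha>0 then plookup a \<alpha>0 else 0)"
    unfolding L_def lookup_sum using \<alpha>0 by (intro sum.cong) (auto simp: lookup_single when_def)
  then have "plookup L \<alpha>0 \<noteq> 0" using \<alpha>0 by (simp add: in_keys_iff)
  then have "L \<noteq> 0" by auto
  then obtain x where x: "\<forall>v. x v \<noteq> 0" "poly_eval x L \<noteq> 0"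
    using exists_nonvanishing_point by blast
  show ?thesis
  proof (rule exI[of _ x], intro conjI allI impI, goal_cases)
    case (1 v)
    show ?case using x by simp
  next
    case (2 h)
    then have h: "\<And>v. v \<in> poly_vars a \<Longrightarrow> (h v \<longlongrightarrow> 0) (at 0)" by blast
    show ?case
    proof (rule ccontr)
      assume "\<not> ?case"
      then have van: "\<And>\<epsilon>. \<epsilon> \<noteq> 0 \<Longrightarrow> poly_eval (\<lambda>v. \<epsilon> ^ w v * (x v + h v \<epsilon>)) a = 0" by blast
      \<comment> \<open>The value of \<open>a\<close> on the curve divided by
        \<open>\<epsilon>^r\<close>; its limit at 0 is the value of \<open>L\<close> at
        \<open>x\<close>.\<close>
      define G where "G \<epsilon> = (\<Sum>\<alpha>\<in>pkeys a. plookup a \<alpha> * (\<epsilon> ^ (W \<alpha> - r) * mon (\<lambda>v. x v + h v \<epsilon>) \<alpha>))" for \<epsilon>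
      have "G \<epsilon> = 0" if "\<epsilon> \<noteq> 0" for \<epsilon>
      proof -
        have "poly_eval (\<lambda>v. \<epsilon> ^ w v * (x v + h v \<epsilon>)) a = \<epsilon> ^ r * G \<epsilon>"
          unfolding poly_eval_eq_ev ev_def G_def sum_distrib_left
        proof (rule sum.cong)
          fix \<alpha> assume "\<alpha> \<in> pkeys a"
          then have "W \<alpha> = r + (W \<alpha> - r)" using r by simp
          then have "\<epsilon> ^ W \<alpha> = \<epsilon> ^ r * \<epsilon> ^ (W \<alpha> - r)" by (metis power_add)
          then show "id (plookup a \<alpha>) * mon (\<lambda>v. \<epsilon> ^ w v * (x v + h v \<epsilon>)) \<alpha> =
              \<epsilon> ^ r * (plookup a \<alpha> * (\<epsilon> ^ (W \<alpha> - r) * mon (\<lambda>v. x v + h v \<epsilon>) \<alpha>))"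
            unfolding mon_scale W_def[symmetric] by simp
        qed simp
        then show ?thesis using van[OF that] that by simp
      qed
      then have "eventually (\<lambda>\<epsilon>. G \<epsilon> = 0) (at 0)" by (simp add: eventually_at_filter)
      then have 1: "(G \<longlongrightarrow> 0) (at 0)" by (rule tendsto_eventually)
      have "(G \<longlongrightarrow> (\<Sum>\<alpha>\<in>pkeys a. plookup a \<alpha> * (0 ^ (W \<alpha> - r) * mon (\<lambda>v. x v + 0) \<alpha>))) (at 0)"
        unfolding G_def
        by (intro tendsto_sum tendsto_mult tendsto_const tendsto_power tendsto_mon tendsto_add h tendsto_ident_at)
          (auto simp: poly_vars_def)
      also have "(\<Sum>\<alpha>\<in>pkeys a. plookup a \<alpha> * (0 ^ (W \<alpha> - r) * mon (\<lambda>v. x v + 0) \<alpha>)) = poly_eval x L"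
        unfolding L_def poly_eval.hom_sum
      proof (rule sum.cong)
        fix \<alpha> assume "\<alpha> \<in> pkeys a"
        then show "plookup a \<alpha> * (0 ^ (W \<alpha> - r) * mon (\<lambda>v. x v + 0) \<alpha>) =
            poly_eval x (Poly_Mapping.single \<alpha> (if W \<alpha> = r then plookup a \<alpha> else 0))"
          using r[of \<alpha>] by (auto simp: poly_eval_eq_ev ev_single[OF hom_id])
      qed simp
      finally have 2: "(G \<longlongrightarrow> poly_eval x L) (at 0)" .
      from tendsto_unique[OF _ 1 2] x show False by simp
    qed
  qed
qed

text \<open>Without the coefficient of \<open>x_n^d\<close> in the last row, all variables of
  \<open>a\<close> can be prescribed to leading order on systems with a zero. The zero is a point
  near \<open>(0, ..., 0, 1)\<close>, and the coefficients of \<open>x_n^d\<close> are whatever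
  makes it a zero; its first \<open>n - 1\<close> coordinates are chosen so that in the other rows
  these coefficients come out as prescribed. Along such a curve a nonzero \<open>a\<close> cannot
  vanish.\<close>

lemma vanishing_without_top_coeff:
  assumes n: "n \<ge> 1" and d: "d \<ge> 1" and a: "a \<in> vanishing n d"
    and top: "(n, Poly_Mapping.single n d) \<notin> poly_vars a"
  shows "a = 0"
proof (rule ccontr)
  assume "a \<noteq> 0"
  define \<tau> where "\<tau> = Poly_Mapping.single n d"
  define \<delta> where "\<delta> i = Poly_Mapping.single i 1 + Poly_Mapping.single n (d - 1)" for i
  \<comment> \<open>Weight 0 for the coefficient of \<open>x_i x_n^(d-1)\<close> in row
    \<open>i < n\<close>, weight 1 for the rest: since \<open>x_i\<close> will have size
    \<open>\<epsilon>\<close>, only that term of row \<open>i\<close> competes with the coefficient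
    of \<open>x_n^d\<close> at order \<open>\<epsilon>\<close>.\<close>
  define w where "w v = (if snd v = \<delta> (fst v) \<and> fst v \<in> {1..<n} then 0 else 1 :: nat)" for v :: coeff_var
  obtain x where x: "\<forall>v. x v \<noteq> 0" and along: "\<forall>h. (\<forall>v\<in>poly_vars a. (h v \<longlongrightarrow> 0) (at 0)) \<longrightarrow>
      (\<exists>\<epsilon>. \<epsilon> \<noteq> 0 \<and> poly_eval (\<lambda>v. \<epsilon> ^ w v * (x v + h v \<epsilon>)) a \<noteq> 0)"
    using nonvanishing_along_curve[OF \<open>a \<noteq> 0\<close>, of w] by (elim exE conjE)
  have \<tau>: "\<tau> \<in> monoms n d" using n by (auto simp: \<tau>_def single_in_monoms)
  have \<delta>: "\<delta> i \<in> monoms n d" "\<delta> i \<noteq> \<tau>" if "i \<in> {1..<n}" for i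
  proof -
    have "\<delta> i \<in> monoms n (1 + (d - 1))"
      unfolding \<delta>_def using that by (intro monoms_add single_in_monoms) auto
    then show "\<delta> i \<in> monoms n d" using d by simp
    have "plookup (\<delta> i) i \<noteq> plookup \<tau> i"
      using that by (simp add: \<delta>_def \<tau>_def lookup_add lookup_single)
    then show "\<delta> i \<noteq> \<tau>" by auto
  qed
  \<comment> \<open>This makes the term of \<open>\<delta> i\<close> in row \<open>i\<close> equal
    to \<open>- \<epsilon> * x (i, \<tau>)\<close>, so the coefficient at \<open>\<tau>\<close> must
    be \<open>\<epsilon> * x (i, \<tau>)\<close> to leading order.\<close>
  define y where "y j \<epsilon> = (if j = n then 1 else - \<epsilon> * x (j, \<tau>) / x (j, \<delta> j))" for j \<epsilon>
  define c0 where "c0 \<epsilon> v = \<epsilon> ^ w v * x v" for \<epsilon> v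
  define c where "c \<epsilon> v = (if snd v = \<tau> then - (\<Sum>\<beta>\<in>monoms n d - {\<tau>}. c0 \<epsilon> (fst v, \<beta>) * mon (\<lambda>j. y j \<epsilon>) \<beta>)
    else c0 \<epsilon> v)" for \<epsilon> v
  define h where "h v \<epsilon> = (if snd v = \<tau> then - (\<Sum>\<beta>\<in>monoms n d - {\<tau>, \<delta> (fst v)}. x (fst v, \<beta>) * mon (\<lambda>j. y j \<epsilon>) \<beta>)
    else 0)" for v \<epsilon>
  have mon\<tau>: "mon (\<lambda>j. y j \<epsilon>) \<tau> = 1" for \<epsilon> by (simp add: \<tau>_def mon_single y_def)
  have form0: "form_at n d (c \<epsilon>) i (\<lambda>j. y j \<epsilon>) = 0" for \<epsilon> i
  proof -
    have "form_at n d (c \<epsilon>) i (\<lambda>j. y j \<epsilon>) = c \<epsilon> (i, \<tau>) + (\<Sum>\<beta>\<in>monoms n d - {\<tau>}. c \<epsilon> (i, \<beta>) * mon (\<lambda>j. y j \<epsilon>) \<beta>)"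
      unfolding form_at_def using \<tau> by (simp add: sum.remove[of _ \<tau>] mon\<tau>)
    also have "(\<Sum>\<beta>\<in>monoms n d - {\<tau>}. c \<epsilon> (i, \<beta>) * mon (\<lambda>j. y j \<epsilon>) \<beta>) =
        (\<Sum>\<beta>\<in>monoms n d - {\<tau>}. c0 \<epsilon> (i, \<beta>) * mon (\<lambda>j. y j \<epsilon>) \<beta>)"
      by (rule sum.cong) (auto simp: c_def)
    finally show ?thesis by (simp add: c_def[of \<epsilon> "(i, \<tau>)"])
  qed
  have "\<exists>i\<in>{1..n}. y i \<epsilon> \<noteq> 0" for \<epsilon> using n by (auto simp: y_def intro!: bexI[of _ n])
  then have "has_zero n d (c \<epsilon>)" for \<epsilon>
    unfolding has_zero_def by (intro exI[of _ "\<lambda>j. y j \<epsilon>"] conjI ballI form0)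
  then have zero: "poly_eval (c \<epsilon>) a = 0" for \<epsilon> using a by (simp add: vanishing_def)
  have c_eq: "c \<epsilon> v = \<epsilon> ^ w v * (x v + h v \<epsilon>)" if v: "v \<in> poly_vars a" for v \<epsilon>
  proof (cases "snd v = \<tau>")
    case False
    then show ?thesis by (simp add: c_def h_def c0_def)
  next
    case True
    obtain i where i: "v = (i, \<tau>)" using True by (cases v) auto
    \<comment> \<open>The last row is the only one whose coefficient at \<open>\<tau>\<close> is not
      controlled, and \<open>top\<close> excludes it.\<close>
    have "v \<in> coeff_vars n d" "v \<noteq> (n, \<tau>)" using a v top by (auto simp: vanishing_def \<tau>_def)
    then have iN: "i \<in> {1..<n}" using i by (auto simp: coeff_vars_def)
    have w\<tau>: "w v = 1" using \<delta>(2)[OF iN] by (auto simp: w_def i)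
    have w\<delta>: "w (i, \<delta> i) = 0" using iN by (simp add: w_def)
    have mon\<delta>: "mon (\<lambda>j. y j \<epsilon>) (\<delta> i) = - \<epsilon> * x (i, \<tau>) / x (i, \<delta> i)"
      using iN by (simp add: \<delta>_def mon_add mon_single y_def del: One_nat_def)
    have "(\<Sum>\<beta>\<in>monoms n d - {\<tau>}. c0 \<epsilon> (i, \<beta>) * mon (\<lambda>j. y j \<epsilon>) \<beta>) =
        c0 \<epsilon> (i, \<delta> i) * mon (\<lambda>j. y j \<epsilon>) (\<delta> i) +
        (\<Sum>\<beta>\<in>monoms n d - {\<tau>} - {\<delta> i}. c0 \<epsilon> (i, \<beta>) * mon (\<lambda>j. y j \<epsilon>) \<beta>)"
      using \<delta>[OF iN] by (intro sum.remove) auto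
    also have "c0 \<epsilon> (i, \<delta> i) * mon (\<lambda>j. y j \<epsilon>) (\<delta> i) = - \<epsilon> * x v"
      using x by (simp add: c0_def w\<delta> mon\<delta> i)
    also have "(\<Sum>\<beta>\<in>monoms n d - {\<tau>} - {\<delta> i}. c0 \<epsilon> (i, \<beta>) * mon (\<lambda>j. y j \<epsilon>) \<beta>) = - \<epsilon> * h v \<epsilon>"
    proof -
      have "(\<Sum>\<beta>\<in>monoms n d - {\<tau>} - {\<delta> i}. c0 \<epsilon> (i, \<beta>) * mon (\<lambda>j. y j \<epsilon>) \<beta>) =
          (\<Sum>\<beta>\<in>monoms n d - {\<tau>, \<delta> i}. \<epsilon> * (x (i, \<beta>) * mon (\<lambda>j. y j \<epsilon>) \<beta>))"
        by (rule sum.cong) (auto simp: c0_def w_def)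
      then show ?thesis by (simp add: h_def i flip: sum_distrib_left)
    qed
    finally have "c \<epsilon> v = \<epsilon> * x v + \<epsilon> * h v \<epsilon>" by (simp add: c_def i)
    then show ?thesis by (simp add: w\<tau> distrib_left)
  qed
  have on_curve: "poly_eval (\<lambda>v. \<epsilon> ^ w v * (x v + h v \<epsilon>)) a = 0" for \<epsilon>
    using zero[of \<epsilon>] poly_eval_cong[of a "c \<epsilon>" "\<lambda>v. \<epsilon> ^ w v * (x v + h v \<epsilon>)"] c_eq by simp
  have "(h v \<longlongrightarrow> 0) (at 0)" for v
  proof (cases "snd v = \<tau>")
    case True
    have lim: "((\<lambda>\<epsilon>. mon (\<lambda>j. y j \<epsilon>) \<beta>) \<longlongrightarrow> 0) (at 0)" if "\<beta> \<in> monoms n d" "\<beta> \<noteq> \<tau>" for \<beta>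
    proof -
      \<comment> \<open>A monomial of degree \<open>d\<close> other than \<open>x_n^d\<close>
        contains some \<open>x_j\<close> with \<open>j < n\<close>, and that coordinate tends to
        0.\<close>
      have "\<exists>j\<in>{1..<n}. plookup \<beta> j > 0"
      proof (rule ccontr)
        assume "\<not> (\<exists>j\<in>{1..<n}. plookup \<beta> j > 0)"
        then have z: "plookup \<beta> j = 0" if "j \<in> {1..<n}" for j using that by auto
        have "(\<Sum>j\<in>{1..n}. plookup \<beta> j) = plookup \<beta> n + (\<Sum>j\<in>{1..<n}. plookup \<beta> j)"
          using n by (subst sum.remove[of _ n]) (auto intro!: sum.cong)
        then have "plookup \<beta> n = d" using that z by (simp add: monoms_def)
        moreover have "plookup \<beta> j = 0" if "j \<noteq> n" for j
        proof (cases "j \<in> {1..n}")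
          case False
          then show ?thesis using \<open>\<beta> \<in> monoms n d\<close> by (auto simp: monoms_def in_keys_iff subset_iff)
        qed (use z that in auto)
        ultimately have "\<beta> = \<tau>"
          by (intro poly_mapping_eqI) (auto simp: \<tau>_def lookup_single when_def)
        with that show False by simp
      qed
      then obtain j where j: "j \<in> {1..<n}" "plookup \<beta> j > 0" by blast
      have "((\<lambda>\<epsilon>. mon (\<lambda>j. y j \<epsilon>) \<beta>) \<longlongrightarrow> mon (\<lambda>j. y j 0) \<beta>) (at 0)"
      proof (rule tendsto_mon)
        fix v
        have "((\<lambda>\<epsilon>. - \<epsilon> * x (v, \<tau>) / x (v, \<delta> v)) \<longlongrightarrow> - 0 * x (v, \<tau>) / x (v, \<delta> v)) (at 0)"
          using x by (intro tendsto_intros) auto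
        then show "(y v \<longlongrightarrow> y v 0) (at 0)" by (simp add: y_def[abs_def])
      qed
      moreover have "mon (\<lambda>j. y j 0) \<beta> = 0"
        using j by (intro mon_eq_0[OF that(1), of j]) (auto simp: y_def)
      ultimately show ?thesis by simp
    qed
    have "((\<lambda>\<epsilon>. - (\<Sum>\<beta>\<in>monoms n d - {\<tau>, \<delta> (fst v)}. x (fst v, \<beta>) * mon (\<lambda>j. y j \<epsilon>) \<beta>)) \<longlongrightarrow>
       - (\<Sum>\<beta>\<in>monoms n d - {\<tau>, \<delta> (fst v)}. x (fst v, \<beta>) * 0)) (at 0)"
      by (intro tendsto_minus tendsto_sum tendsto_mult tendsto_const lim) auto
    then show ?thesis using True by (simp add: h_def[abs_def])
  qed (simp add: h_def[abs_def])
  then have "\<exists>\<epsilon>. \<epsilon> \<noteq> 0 \<and> poly_eval (\<lambda>v. \<epsilon> ^ w v * (x v + h v \<epsilon>)) a \<noteq> 0"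
    by (intro along[THEN spec, THEN mp] ballI)
  then show False unfolding on_curve by simp
qed

section \<open>Determinants vanishing on systems with a zero\<close>

definition form_poly :: "nat \<Rightarrow> nat \<Rightarrow> (coeff_var \<Rightarrow> complex) \<Rightarrow> nat \<Rightarrow> nat cpoly" where
  "form_poly n d c i = (\<Sum>\<delta>\<in>monoms n d. Poly_Mapping.single \<delta> (c (i, \<delta>)))"

lemma poly_eval_form_poly: "poly_eval x (form_poly n d c i) = form_at n d c i x"
  by (simp add: form_poly_def form_at_def poly_eval.hom_sum) (simp add: poly_eval_eq_ev ev_single[OF hom_id])

lemma poly_vars_form_poly: "poly_vars (form_poly n d c i) \<subseteq> {1..n}"
  unfolding form_poly_def
proof (rule poly_vars_sum)
  fix \<delta> assume "\<delta> \<in> monoms n d"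
  then show "poly_vars (Poly_Mapping.single \<delta> (c (i, \<delta>))) \<subseteq> {1..n}"
    by (simp add: poly_vars_def monoms_def)
qed

lemma monoms_diff:
  assumes "\<beta> + \<delta> \<in> monoms n e" "\<delta> \<in> monoms n d"
  shows "\<beta> \<in> monoms n (e - d)"
proof -
  have "pkeys \<beta> \<subseteq> pkeys (\<beta> + \<delta>)" by (auto simp: in_keys_iff lookup_add)
  moreover have "(\<Sum>j\<in>{1..n}. plookup \<beta> j) + d = e"
    using assms by (simp add: monoms_def lookup_add sum.distrib)
  ultimately show ?thesis using assms by (auto simp: monoms_def)
qed

text \<open>Terms of \<open>G i\<close> whose degree is not \<open>e - d\<close> cannot contribute
  to \<open>\<gamma>\<close>. The sum is linear in \<open>c\<close>; with \<open>Var\<close> in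
  place of \<open>c\<close> it becomes a matrix entry that is a polynomial in the
  coefficients.\<close>

lemma lookup_combination:
  assumes "\<gamma> \<in> monoms n e"
  shows "plookup (\<Sum>i\<in>{1..n}. G i * form_poly n d c i) \<gamma> =
    (\<Sum>i\<in>{1..n}. \<Sum>\<beta>\<in>monoms n (e - d). \<Sum>\<delta>\<in>monoms n d. if \<beta> + \<delta> = \<gamma> then plookup (G i) \<beta> * c (i, \<delta>) else 0)"
  unfolding lookup_sum
proof (rule sum.cong)
  fix i assume "i \<in> {1..n}"
  define t where "t \<beta> = (\<Sum>\<delta>\<in>monoms n d. if \<beta> + \<delta> = \<gamma> then plookup (G i) \<beta> * c (i, \<delta>) else 0)" for \<beta>
  have "G i * form_poly n d c i =
      (\<Sum>\<beta>\<in>pkeys (G i). Poly_Mapping.single \<beta> (plookup (G i) \<beta>)) * form_poly n d c i"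
    by (simp only: sum_single[symmetric])
  also have "\<dots> = (\<Sum>\<beta>\<in>pkeys (G i). \<Sum>\<delta>\<in>monoms n d. Poly_Mapping.single (\<beta> + \<delta>) (plookup (G i) \<beta> * c (i, \<delta>)))"
    unfolding form_poly_def sum_product mult_single ..
  finally have "plookup (G i * form_poly n d c i) \<gamma> = (\<Sum>\<beta>\<in>pkeys (G i). t \<beta>)"
    by (simp add: lookup_sum lookup_single when_def t_def)
  also have "\<dots> = (\<Sum>\<beta>\<in>pkeys (G i) \<union> monoms n (e - d). t \<beta>)"
    by (rule sum.mono_neutral_left) (auto simp: t_def in_keys_iff intro!: sum.neutral)
  also have "\<dots> = (\<Sum>\<beta>\<in>monoms n (e - d). t \<beta>)"
  proof (rule sum.mono_neutral_right)
    show "\<forall>\<beta>\<in>pkeys (G i) \<union> monoms n (e - d) - monoms n (e - d). t \<beta> = 0"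
      unfolding t_def using monoms_diff[of _ _ n e d] assms by (auto intro!: sum.neutral)
  qed auto
  finally show "plookup (G i * form_poly n d c i) \<gamma> = (\<Sum>\<beta>\<in>monoms n (e - d). t \<beta>)" .
qed simp

lemma poly_vars_signof: "poly_vars (signof p :: 'v cpoly) = {}"
  by (simp add: sign_def)

lemma poly_vars_prod: "(\<And>a. a \<in> A \<Longrightarrow> poly_vars (f a) \<subseteq> W) \<Longrightarrow> poly_vars (prod f A) \<subseteq> W"
proof (induction A rule: infinite_finite_induct)
  case (insert x F)
  then show ?case using poly_vars_mult[of "f x" "prod f F"] by auto
qed auto

lemma poly_vars_det:
  assumes A: "A \<in> carrier_mat N N" and W: "\<And>i j. i < N \<Longrightarrow> j < N \<Longrightarrow> poly_vars (A $$ (i, j)) \<subseteq> W"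
  shows "poly_vars (Determinant.det A) \<subseteq> W"
  unfolding Determinant.det_def'[OF A]
proof (rule poly_vars_sum)
  fix p assume "p \<in> {p. p permutes {0..<N}}"
  then have p: "p i < N" if "i < N" for i using that permutes_in_image[of p "{0..<N}" i] by auto
  have "poly_vars (\<Prod>i = 0..<N. A $$ (i, p i)) \<subseteq> W"
    by (rule poly_vars_prod) (use W p in auto)
  then show "poly_vars (signof p * (\<Prod>i = 0..<N. A $$ (i, p i))) \<subseteq> W"
    using poly_vars_mult[of "signof p" "\<Prod>i = 0..<N. A $$ (i, p i)"] poly_vars_signof[of p] by auto
qed

text \<open>
  The determinant of the coefficients (of degree \<open>e\<close>) of the combinations \<open>\<Sum>\<^sub>i G \<alpha> i \<cdot> f\<^sub>i\<close>, where \<open>\<alpha>\<close>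
  ranges over the monomials of degree \<open>e\<close>: at a nontrivial zero \<open>x\<close> of the \<open>f\<^sub>i\<close> its matrix
  annihilates the vector of the \<open>x\<^bsup>\<alpha>\<^esup>\<close>.
\<close>

lemma exists_determinant:
  fixes G :: "(nat \<Rightarrow>\<^sub>0 nat) \<Rightarrow> nat \<Rightarrow> nat cpoly"
  assumes e: "d \<le> e"
  shows "\<exists>\<mu>\<in>vanishing n d. \<forall>c \<kappa>.
    (\<forall>\<alpha>\<in>monoms n e. (\<Sum>i\<in>{1..n}. G \<alpha> i * form_poly n d c i) = Poly_Mapping.single \<alpha> (\<kappa> \<alpha>)) \<longrightarrow>
    poly_eval c \<mu> = (\<Prod>\<alpha>\<in>monoms n e. \<kappa> \<alpha>)"
proof -
  define N where "N = card (monoms n e)"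
  obtain en where en: "bij_betw en {0..<N} (monoms n e)"
    using ex_bij_betw_nat_finite[OF finite_monoms] unfolding N_def by blast
  have en_in: "en a \<in> monoms n e" if "a < N" for a using en that by (auto simp: bij_betw_def)
  have en_eq: "en a = en b \<longleftrightarrow> a = b" if "a < N" "b < N" for a b
    using en that by (auto simp: bij_betw_def inj_on_def)
  define M where "M \<alpha> \<gamma> = (\<Sum>i\<in>{1..n}. \<Sum>\<beta>\<in>monoms n (e - d). \<Sum>\<delta>\<in>monoms n d.
    if \<beta> + \<delta> = \<gamma> then Cst (plookup (G \<alpha> i) \<beta>) * Var (i, \<delta>) else 0)" for \<alpha> \<gamma>
  define A where "A = mat N N (\<lambda>(a, b). M (en a) (en b))"
  have A: "A \<in> carrier_mat N N" by (simp add: A_def)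
  have evM: "poly_eval c (M \<alpha> \<gamma>) = (\<Sum>i\<in>{1..n}. \<Sum>\<beta>\<in>monoms n (e - d). \<Sum>\<delta>\<in>monoms n d.
    if \<beta> + \<delta> = \<gamma> then plookup (G \<alpha> i) \<beta> * c (i, \<delta>) else 0)" for c \<alpha> \<gamma>
    unfolding M_def poly_eval.hom_sum by (intro sum.cong refl) (simp add: poly_eval.hom_mult)
  have evA: "poly_eval c (Determinant.det A) = Determinant.det (mat N N (\<lambda>(a, b). poly_eval c (M (en a) (en b))))" for c
  proof -
    have "map_mat (poly_eval c) A = mat N N (\<lambda>(a, b). poly_eval c (M (en a) (en b)))"
      by (rule eq_matI) (auto simp: A_def)
    then show ?thesis by (simp flip: poly_eval.hom_det)
  qed
  have "Determinant.det A \<in> vanishing n d"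
    unfolding vanishing_def
  proof (intro CollectI conjI allI impI)
    show "poly_vars (Determinant.det A) \<subseteq> coeff_vars n d"
    proof (rule poly_vars_det[OF A])
      fix a b assume "a < N" "b < N"
      have "poly_vars (M \<alpha> \<gamma>) \<subseteq> coeff_vars n d" for \<alpha> \<gamma>
        unfolding M_def
      proof (intro poly_vars_sum)
        fix i \<beta> \<delta> assume "i \<in> {1..n}" "\<delta> \<in> monoms n d"
        then show "poly_vars (if \<beta> + \<delta> = \<gamma> then Cst (plookup (G \<alpha> i) \<beta>) * Var (i, \<delta>) else 0) \<subseteq> coeff_vars n d"
          using poly_vars_mult[of "Cst (plookup (G \<alpha> i) \<beta>)" "Var (i, \<delta>)"] by (auto simp: coeff_vars_def)
      qed
      then show "poly_vars (A $$ (a, b)) \<subseteq> coeff_vars n d"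
        using \<open>a < N\<close> \<open>b < N\<close> by (simp add: A_def)
    qed
  next
    fix c assume "has_zero n d c"
    then obtain x j where j: "j \<in> {1..n}" "x j \<noteq> 0" and x: "\<And>i. i \<in> {1..n} \<Longrightarrow> form_at n d c i x = 0"
      unfolding has_zero_def by blast
    let ?B = "mat N N (\<lambda>(a, b). poly_eval c (M (en a) (en b)))"
    let ?v = "vec N (\<lambda>b. mon x (en b))"
    have "(\<Sum>\<gamma>\<in>monoms n e. poly_eval c (M \<alpha> \<gamma>) * mon x \<gamma>) = 0" for \<alpha>
    proof -
      have "(\<Sum>\<gamma>\<in>monoms n e. poly_eval c (M \<alpha> \<gamma>) * mon x \<gamma>) =
        (\<Sum>\<gamma>\<in>monoms n e. \<Sum>i\<in>{1..n}. \<Sum>\<beta>\<in>monoms n (e - d). \<Sum>\<delta>\<in>monoms n d.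
          if \<beta> + \<delta> = \<gamma> then plookup (G \<alpha> i) \<beta> * c (i, \<delta>) * mon x \<gamma> else 0)"
        unfolding evM sum_distrib_right by (intro sum.cong refl) simp
      also have "\<dots> = (\<Sum>i\<in>{1..n}. \<Sum>\<beta>\<in>monoms n (e - d). \<Sum>\<delta>\<in>monoms n d. \<Sum>\<gamma>\<in>monoms n e.
          if \<beta> + \<delta> = \<gamma> then plookup (G \<alpha> i) \<beta> * c (i, \<delta>) * mon x \<gamma> else 0)"
        by (simp only: sum.swap[of _ _ "monoms n e"])
      also have "\<dots> = (\<Sum>i\<in>{1..n}. \<Sum>\<beta>\<in>monoms n (e - d). \<Sum>\<delta>\<in>monoms n d.
          plookup (G \<alpha> i) \<beta> * mon x \<beta> * (c (i, \<delta>) * mon x \<delta>))"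
      proof (intro sum.cong refl)
        fix i \<beta> \<delta> assume "\<beta> \<in> monoms n (e - d)" "\<delta> \<in> monoms n d"
        then have "\<beta> + \<delta> \<in> monoms n e" using monoms_add[of \<beta> n "e - d" \<delta> d] e by simp
        then show "(\<Sum>\<gamma>\<in>monoms n e. if \<beta> + \<delta> = \<gamma> then plookup (G \<alpha> i) \<beta> * c (i, \<delta>) * mon x \<gamma> else 0) =
          plookup (G \<alpha> i) \<beta> * mon x \<beta> * (c (i, \<delta>) * mon x \<delta>)"
          by (simp add: mon_add)
      qed
      also have "\<dots> = (\<Sum>i\<in>{1..n}. \<Sum>\<beta>\<in>monoms n (e - d). plookup (G \<alpha> i) \<beta> * mon x \<beta> * form_at n d c i x)"
        by (simp add: form_at_def sum_distrib_left)
      also have "\<dots> = 0" using x by simp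
      finally show ?thesis .
    qed
    then have row: "(\<Sum>b = 0..<N. poly_eval c (M \<alpha> (en b)) * mon x (en b)) = 0" for \<alpha>
      using sum.reindex_bij_betw[OF en, of "\<lambda>\<gamma>. poly_eval c (M \<alpha> \<gamma>) * mon x \<gamma>"] by simp
    have "?B *\<^sub>v ?v = 0\<^sub>v N"
      by (rule eq_vecI) (use row in \<open>auto simp: scalar_prod_def\<close>)
    moreover have "?v \<noteq> 0\<^sub>v N"
    proof
      assume v: "?v = 0\<^sub>v N"
      have "Poly_Mapping.single j e \<in> en ` {0..<N}"
        using single_in_monoms[OF j(1)] en by (simp add: bij_betw_def)
      then obtain b where b: "b < N" "en b = Poly_Mapping.single j e" by auto
      then have "vec_index ?v b = x j ^ e" by (simp add: mon_single)
      then show False using v b j by simp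
    qed
    moreover have "?B \<in> carrier_mat N N" by simp
    moreover have "?v \<in> carrier_vec N" by simp
    ultimately have "Determinant.det ?B = 0"
      using det_0_iff_vec_prod_zero[of ?B N] by (intro iffD2[OF det_0_iff_vec_prod_zero[of ?B N]] exI[of _ ?v]) auto
    then show "poly_eval c (Determinant.det A) = 0" by (simp add: evA)
  qed
  moreover have "poly_eval c (Determinant.det A) = (\<Prod>\<alpha>\<in>monoms n e. \<kappa> \<alpha>)"
    if \<kappa>: "\<forall>\<alpha>\<in>monoms n e. (\<Sum>i\<in>{1..n}. G \<alpha> i * form_poly n d c i) = Poly_Mapping.single \<alpha> (\<kappa> \<alpha>)" for c \<kappa>
  proof -
    have entry: "poly_eval c (M \<alpha> \<gamma>) = (if \<alpha> = \<gamma> then \<kappa> \<alpha> else 0)" if "\<alpha> \<in> monoms n e" "\<gamma> \<in> monoms n e" for \<alpha> \<gamma>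
      unfolding evM lookup_combination[OF that(2), symmetric] using \<kappa> that by (simp add: lookup_single when_def)
    let ?B = "mat N N (\<lambda>(a, b). poly_eval c (M (en a) (en b)))"
    \<comment> \<open>For this \<open>c\<close> each combination is a multiple of its own monomial,
      so the matrix is diagonal.\<close>
    have B: "?B = mat N N (\<lambda>(a, b). if a = b then \<kappa> (en a) else 0)"
      by (rule eq_matI) (auto simp: entry en_in en_eq)
    have "Determinant.det ?B = prod_list (diag_mat ?B)"
      by (rule det_upper_triangular[of _ N]) (auto simp: B)
    also have "\<dots> = (\<Prod>a = 0..<N. \<kappa> (en a))"
    proof -
      have "diag_mat ?B = map (\<lambda>a. \<kappa> (en a)) [0..<N]" unfolding B diag_mat_def by simp
      then show ?thesis using prod.distinct_set_conv_list[of "[0..<N]" "\<lambda>a. \<kappa> (en a)"] by simp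
    qed
    also have "\<dots> = (\<Prod>\<alpha>\<in>monoms n e. \<kappa> \<alpha>)"
      by (rule prod.reindex_bij_betw[OF en])
    finally show ?thesis by (simp add: evA)
  qed
  ultimately show ?thesis by (intro bexI[of _ "Determinant.det A"]) auto
qed

section \<open>A projective Nullstellensatz\<close>

definition ring_ideal :: "'a::comm_ring_1 set \<Rightarrow> bool" where
  "ring_ideal I \<longleftrightarrow> 0 \<in> I \<and> (\<forall>a\<in>I. \<forall>b\<in>I. a + b \<in> I) \<and> (\<forall>a\<in>I. \<forall>r. r * a \<in> I)"

lemma ring_idealD:
  assumes "ring_ideal I"
  shows "0 \<in> I" "a \<in> I \<Longrightarrow> b \<in> I \<Longrightarrow> a + b \<in> I" "a \<in> I \<Longrightarrow> r * a \<in> I" "a \<in> I \<Longrightarrow> a * r \<in> I"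
  using assms by (auto simp: ring_ideal_def mult.commute)

lemma ring_ideal_sum: "ring_ideal I \<Longrightarrow> (\<And>a. a \<in> A \<Longrightarrow> f a \<in> I) \<Longrightarrow> sum f A \<in> I"
  by (induction A rule: infinite_finite_induct) (auto intro: ring_idealD)

text \<open>Gaussian elimination by induction on the equations: an unknown with nonzero coefficient
  in equation \<open>k\<close> is the pivot, which leaves one unknown and one equation
  fewer.\<close>

lemma exists_linear_dependence:
  fixes M :: "'a \<Rightarrow> 'b \<Rightarrow> complex"
  assumes "finite K" "finite S" "card S > card K"
  shows "\<exists>l. (\<exists>s\<in>S. l s \<noteq> 0) \<and> (\<forall>k\<in>K. (\<Sum>s\<in>S. l s * M s k) = 0)"
  using assms
proof (induction K arbitrary: S M rule: finite_induct)
  case empty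
  then obtain s where "s \<in> S" by (metis card_gt_0_iff card.empty ex_in_conv)
  then show ?case by (intro exI[of _ "\<lambda>_. 1"]) auto
next
  case (insert k K)
  show ?case
  proof (cases "\<forall>s\<in>S. M s k = 0")
    case True
    have "card S > card K" using insert.prems insert.hyps by simp
    then obtain l where "\<exists>s\<in>S. l s \<noteq> 0" "\<forall>k\<in>K. (\<Sum>s\<in>S. l s * M s k) = 0"
      using insert.IH[OF insert.prems(1), of M] by blast
    then show ?thesis using True by (intro exI[of _ l]) auto
  next
    case False
    then obtain s0 where s0: "s0 \<in> S" "M s0 k \<noteq> 0" by blast
    define S' where "S' = S - {s0}"
    have S': "finite S'" "s0 \<notin> S'" "S = insert s0 S'" using s0 insert.prems by (auto simp: S'_def)
    have "card S' > card K" using insert.prems insert.hyps S' by auto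
    then obtain l where l: "\<exists>s\<in>S'. l s \<noteq> 0" "\<forall>j\<in>K. (\<Sum>s\<in>S'. l s * (M s j - M s k / M s0 k * M s0 j)) = 0"
      using insert.IH[OF S'(1), of "\<lambda>s j. M s j - M s k / M s0 k * M s0 j"] by auto
    define l' where "l' = l(s0 := - (\<Sum>s\<in>S'. l s * M s k) / M s0 k)"
    have eq: "(\<Sum>s\<in>S. l' s * M s j) = (\<Sum>s\<in>S'. l s * (M s j - M s k / M s0 k * M s0 j))" for j
    proof -
      have "(\<Sum>s\<in>S. l' s * M s j) = - (\<Sum>s\<in>S'. l s * M s k) / M s0 k * M s0 j + (\<Sum>s\<in>S'. l s * M s j)"
        unfolding S'(3) using S' by (simp add: l'_def) (rule sum.cong, auto)
      also have "\<dots> = (\<Sum>s\<in>S'. l s * M s j) - (\<Sum>s\<in>S'. l s * (M s k / M s0 k * M s0 j))"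
        by (simp add: sum_distrib_right sum_divide_distrib mult.assoc)
      finally show ?thesis by (simp add: right_diff_distrib sum_subtractf)
    qed
    have "(\<Sum>s\<in>S. l' s * M s j) = 0" if "j \<in> insert k K" for j
      using that l s0 unfolding eq by auto
    moreover have "\<exists>s\<in>S. l' s \<noteq> 0" using l S' by (auto simp: l'_def)
    ultimately show ?thesis by (intro exI[of _ l']) blast
  qed
qed

lemma countable_exponents: "countable (UNIV :: (nat \<Rightarrow>\<^sub>0 nat) set)"
proof -
  let ?f = "\<lambda>\<alpha> :: nat \<Rightarrow>\<^sub>0 nat. (\<lambda>v. (v, plookup \<alpha> v)) ` pkeys \<alpha>"
  have "inj ?f"
  proof (rule injI)
    fix \<alpha> \<beta> assume eq: "?f \<alpha> = ?f \<beta>"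
    have *: "plookup \<alpha> v = plookup \<beta> v" if "v \<in> pkeys \<alpha>" "?f \<alpha> = ?f \<beta>" for \<alpha> \<beta> v
    proof -
      have "(v, plookup \<alpha> v) \<in> ?f \<beta>" using that by blast
      then show ?thesis by auto
    qed
    show "\<alpha> = \<beta>"
    proof (rule poly_mapping_eqI)
      fix v
      show "plookup \<alpha> v = plookup \<beta> v"
      proof (cases "v \<in> pkeys \<alpha> \<union> pkeys \<beta>")
        case True
        then show ?thesis using *[OF _ eq] *[OF _ eq[symmetric]] by fastforce
      next
        case False
        then show ?thesis by (simp add: in_keys_iff)
      qed
    qed
  qed
  moreover have "countable (range ?f)"
    by (rule countable_subset[OF _ countable_Collect_finite]) auto
  ultimately show ?thesis using countable_image_inj_on by blast
qed

text \<open>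
  If the powers of \<open>z\<close> meet \<open>I + (t - c)\<close> for all complex \<open>c\<close>, then uncountably many of the
  multipliers of \<open>t - c\<close> lie in one finite-dimensional space, and a linear dependence between them
  puts \<open>z\<^sup>D q(t)\<close> into \<open>I\<close> for some univariate \<open>q \<noteq> 0\<close>, which splits into linear factors.
\<close>

lemma adjoin_value:
  fixes I :: "nat cpoly set"
  assumes I: "ring_ideal I" and z: "\<And>D. z ^ D \<notin> I"
  shows "\<exists>c. \<forall>D f g. f \<in> I \<longrightarrow> z ^ D \<noteq> f + g * (t - Cst c)"
proof (rule ccontr)
  assume "\<not> ?thesis"
  then have "\<forall>c. \<exists>D f g. f \<in> I \<and> z ^ D = f + g * (t - Cst c)" by blast
  then have "\<forall>c. \<exists>D g. z ^ D - g * (t - Cst c) \<in> I" by (metis add_diff_cancel_right')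
  then obtain D g where Dg: "\<And>c. z ^ D c - g c * (t - Cst c) \<in> I" by metis
  \<comment> \<open>There are only countably many pairs of an exponent and a support but uncountably
    many \<open>c\<close>, so some pair belongs to infinitely many \<open>c\<close>.\<close>
  define F where "F c = (D c, pkeys (g c))" for c
  have "countable (range F)"
  proof (rule countable_subset)
    show "range F \<subseteq> UNIV \<times> {A. finite A \<and> A \<subseteq> UNIV}" by (auto simp: F_def)
    have "countable {A. finite A \<and> A \<subseteq> (UNIV :: (nat \<Rightarrow>\<^sub>0 nat) set)}"
      by (rule countable_Collect_finite_subset[OF countable_exponents])
    then show "countable ((UNIV :: nat set) \<times> {A. finite A \<and> A \<subseteq> (UNIV :: (nat \<Rightarrow>\<^sub>0 nat) set)})"
      by (intro countable_SIGMA countableI_type)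
  qed
  have "\<exists>y. infinite (F -` {y})"
  proof (rule ccontr)
    assume "\<not> ?thesis"
    then have "countable (\<Union>y\<in>range F. F -` {y})"
      using \<open>countable (range F)\<close> by (intro countable_UN) (auto intro: countable_finite)
    moreover have "(\<Union>y\<in>range F. F -` {y}) = UNIV" by auto
    ultimately show False using uncountable_UNIV_complex by simp
  qed
  then obtain D0 K where inf: "infinite (F -` {(D0, K)})" by auto
  have K: "finite K"
  proof -
    obtain c where "c \<in> F -` {(D0, K)}" using inf by (metis finite.emptyI ex_in_conv)
    then show ?thesis by (auto simp: F_def)
  qed
  \<comment> \<open>One element more than the common support has monomials, which forces a linear
    relation between the \<open>g c\<close>.\<close>
  obtain S where S: "S \<subseteq> F -` {(D0, K)}" "finite S" "card S = Suc (card K)"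
    using infinite_arbitrarily_large[OF inf] by blast
  have DS: "D c = D0" "pkeys (g c) = K" if "c \<in> S" for c using S(1) that by (auto simp: F_def)
  obtain l where l: "\<exists>s\<in>S. l s \<noteq> 0" "\<forall>k\<in>K. (\<Sum>s\<in>S. l s * plookup (g s) k) = 0"
    using exists_linear_dependence[OF K S(2), of "\<lambda>s. plookup (g s)"] S(3) by auto
  have lin: "(\<Sum>c\<in>S. Cst (l c) * g c) = 0"
  proof (rule poly_mapping_eqI)
    fix k
    have "plookup (Cst a * p) k = a * plookup p k" for a and p :: "nat cpoly"
    proof -
      have "Cst a * p = Poly_Mapping.map ((*) a) p" by (simp add: Cst_def mult_map_scale_conv_mult)
      then show ?thesis by (simp add: Poly_Mapping.map.rep_eq when_def)
    qed
    then have "plookup (\<Sum>c\<in>S. Cst (l c) * g c) k = (\<Sum>c\<in>S. l c * plookup (g c) k)"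
      by (simp add: lookup_sum)
    also have "\<dots> = 0"
    proof (cases "k \<in> K")
      case False
      then have "plookup (g c) k = 0" if "c \<in> S" for c
        using DS(2)[OF that] by (simp add: not_in_keys_iff_lookup_eq_zero[symmetric])
      then show ?thesis by simp
    qed (use l in blast)
    finally show "plookup (\<Sum>c\<in>S. Cst (l c) * g c) k = plookup 0 k" by simp
  qed
  define \<psi> where "\<psi> q = poly (map_poly Cst q) t" for q
  interpret \<psi>: comm_ring_hom \<psi>
    unfolding \<psi>_def[abs_def] by (rule hom_comp[OF hom_poly hom_map_poly[OF hom_Cst]])
  have \<psi>_lin: "\<psi> [:-c, 1:] = t - Cst c" for c
    by (simp add: \<psi>_def map_poly_pCons Cst.hom_uminus)
  have \<psi>_const: "\<psi> [:c:] = Cst c" for c by (simp add: \<psi>_def map_poly_pCons)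
  \<comment> \<open>If the relation for \<open>c\<close> is weighted by \<open>l c\<close> and the
    product over the other nodes, the terms with \<open>g\<close> share the full product over
    \<open>S\<close> and cancel by \<open>lin\<close>; \<open>z^D0\<close> times \<open>q\<close> at
    \<open>t\<close> remains. At the node \<open>c1\<close> only one summand of \<open>q\<close>
    survives, so \<open>q\<close> is nonzero.\<close>
  define q where "q = (\<Sum>c\<in>S. [:l c:] * (\<Prod>c'\<in>S - {c}. [:-c', 1:]))"
  obtain c1 where c1: "c1 \<in> S" "l c1 \<noteq> 0" using l by blast
  have "poly q c1 = (\<Sum>c\<in>S. if c = c1 then l c1 * (\<Prod>c'\<in>S - {c1}. c1 - c') else 0)"
    unfolding q_def poly_sum
  proof (rule sum.cong)
    fix c assume "c \<in> S"
    show "poly ([:l c:] * (\<Prod>c'\<in>S - {c}. [:-c', 1:])) c1 =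
        (if c = c1 then l c1 * (\<Prod>c'\<in>S - {c1}. c1 - c') else 0)"
      using c1 S(2) by (auto simp: poly_prod)
  qed simp
  then have "poly q c1 = l c1 * (\<Prod>c'\<in>S - {c1}. c1 - c')" using c1 S(2) by simp
  moreover have "(\<Prod>c'\<in>S - {c1}. c1 - c') \<noteq> 0" using S(2) by simp
  ultimately have "q \<noteq> 0" using c1 by auto
  have zq: "z ^ D0 * \<psi> q \<in> I"
  proof -
    let ?P = "\<lambda>c. \<Prod>c'\<in>S - {c}. t - Cst c'"
    have "(\<Sum>c\<in>S. (Cst (l c) * ?P c) * (z ^ D0 - g c * (t - Cst c))) \<in> I"
      using Dg DS by (intro ring_ideal_sum[OF I] ring_idealD(3)[OF I]) metis
    also have "(\<Sum>c\<in>S. (Cst (l c) * ?P c) * (z ^ D0 - g c * (t - Cst c))) =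
        (\<Sum>c\<in>S. z ^ D0 * (Cst (l c) * ?P c)) - (\<Sum>c\<in>S. (\<Prod>c'\<in>S. t - Cst c') * (Cst (l c) * g c))"
      unfolding sum_subtractf[symmetric]
    proof (rule sum.cong)
      fix c assume "c \<in> S"
      then have *: "(\<Prod>c'\<in>S. t - Cst c') = (t - Cst c) * ?P c" using S(2) by (rule prod.remove[rotated])
      show "(Cst (l c) * ?P c) * (z ^ D0 - g c * (t - Cst c)) =
        z ^ D0 * (Cst (l c) * ?P c) - (\<Prod>c'\<in>S. t - Cst c') * (Cst (l c) * g c)"
        unfolding * by (simp add: algebra_simps)
    qed simp
    also have "\<dots> = z ^ D0 * (\<Sum>c\<in>S. Cst (l c) * ?P c)"
      by (simp add: lin flip: sum_distrib_left)
    also have "(\<Sum>c\<in>S. Cst (l c) * ?P c) = \<psi> q"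
      by (simp only: q_def \<psi>.hom_sum \<psi>.hom_mult \<psi>.hom_prod \<psi>_lin \<psi>_const)
    finally show ?thesis .
  qed
  \<comment> \<open>A root \<open>e\<close> of \<open>q\<close> is removed by its own relation,
    which replaces \<open>g e * (t - Cst e)\<close> by \<open>z^(D e)\<close> modulo
    \<open>I\<close>; a nonzero constant is left at the end.\<close>
  have "\<exists>D'. z ^ D' \<in> I" if "q \<noteq> 0" "z ^ E * \<psi> q \<in> I" for q E
    using that
  proof (induction "degree q" arbitrary: q E)
    case 0
    then obtain a where a: "q = [:a:]" "a \<noteq> 0" by (metis degree_0_id pCons_0_0 pCons_eq_0_iff degree_eq_zeroE)
    have "Cst (inverse a) * (z ^ E * \<psi> q) \<in> I" by (rule ring_idealD(3)[OF I 0(3)])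
    also have "Cst (inverse a) * (z ^ E * \<psi> q) = z ^ E * Cst (inverse a * a)"
      by (simp add: a(1) \<psi>_const Cst.hom_mult mult_ac)
    finally show ?case using a by auto
  next
    case (Suc m)
    then have "\<not> constant (poly q)" by (simp add: constant_degree)
    then obtain e where "poly q e = 0" using fundamental_theorem_of_algebra by blast
    then obtain q' where q': "q = [:-e, 1:] * q'" by (auto simp: poly_eq_0_iff_dvd)
    have q'0: "q' \<noteq> 0" using Suc.prems q' by auto
    have deg: "degree q' = m" using Suc.hyps(2) q'0 unfolding q' by (subst (asm) degree_mult_eq) auto
    have "g e * (z ^ E * \<psi> q) + (z ^ E * \<psi> q') * (z ^ D e - g e * (t - Cst e)) \<in> I"
      by (rule ring_idealD(2)[OF I ring_idealD(3)[OF I Suc.prems(2)] ring_idealD(3)[OF I Dg]])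
    also have "g e * (z ^ E * \<psi> q) + (z ^ E * \<psi> q') * (z ^ D e - g e * (t - Cst e)) = z ^ (E + D e) * \<psi> q'"
    proof -
      have *: "\<psi> q = (t - Cst e) * \<psi> q'" by (simp only: q' \<psi>.hom_mult \<psi>_lin)
      show ?thesis unfolding * by (simp add: power_add algebra_simps)
    qed
    finally show ?case using Suc.hyps(1)[OF deg[symmetric] q'0] by blast
  qed
  from this[OF \<open>q \<noteq> 0\<close> zq] z show False by blast
qed

text \<open>Adding \<open>Var (Suc m) - Cst c\<close> to the ideal, with \<open>c\<close> from
  \<open>adjoin_value\<close>, keeps all powers of \<open>z\<close> out, so values can be chosen
  variable after variable.\<close>

lemma adjoin_values:
  fixes I :: "nat cpoly set"
  assumes I: "ring_ideal I" and z: "\<And>D. z ^ D \<notin> I"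
  shows "\<exists>x J. ring_ideal J \<and> I \<subseteq> J \<and> (\<forall>D. z ^ D \<notin> J) \<and> (\<forall>i\<in>{1..m}. Var i - Cst (x i) \<in> J)"
proof (induction m)
  case 0
  then show ?case using I z by (intro exI[of _ "\<lambda>_. 0"] exI[of _ I]) auto
next
  case (Suc m)
  then obtain x J where J: "ring_ideal J" "I \<subseteq> J" "\<forall>D. z ^ D \<notin> J" "\<forall>i\<in>{1..m}. Var i - Cst (x i) \<in> J"
    by blast
  obtain c where c: "\<forall>D f g. f \<in> J \<longrightarrow> z ^ D \<noteq> f + g * (Var (Suc m) - Cst c)"
    using adjoin_value[OF J(1), of z "Var (Suc m)"] J(3) by blast
  define J' where "J' = {f + g * (Var (Suc m) - Cst c) | f g. f \<in> J}"
  have sub: "J \<subseteq> J'"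
  proof
    fix f assume "f \<in> J"
    moreover have "f = f + 0 * (Var (Suc m) - Cst c)" by simp
    ultimately show "f \<in> J'" unfolding J'_def by blast
  qed
  have "ring_ideal J'"
    unfolding ring_ideal_def
  proof (intro conjI ballI allI)
    show "0 \<in> J'" using sub ring_idealD(1)[OF J(1)] by blast
  next
    fix a b assume "a \<in> J'" "b \<in> J'"
    then obtain f g f' g' where *: "f \<in> J" "f' \<in> J" "a = f + g * (Var (Suc m) - Cst c)" "b = f' + g' * (Var (Suc m) - Cst c)"
      unfolding J'_def by blast
    have "a + b = (f + f') + (g + g') * (Var (Suc m) - Cst c)" by (simp add: * algebra_simps)
    then show "a + b \<in> J'" unfolding J'_def using ring_idealD(2)[OF J(1) *(1,2)] by blast
  next
    fix a r assume "a \<in> J'"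
    then obtain f g where *: "f \<in> J" "a = f + g * (Var (Suc m) - Cst c)"
      unfolding J'_def by blast
    have "r * a = r * f + (r * g) * (Var (Suc m) - Cst c)" by (simp add: * algebra_simps)
    then show "r * a \<in> J'" unfolding J'_def using ring_idealD(3)[OF J(1) *(1)] by blast
  qed
  moreover have "\<forall>D. z ^ D \<notin> J'" using c unfolding J'_def by blast
  moreover have "Var (Suc m) - Cst c = 0 + 1 * (Var (Suc m) - Cst c)" by simp
  then have "Var (Suc m) - Cst c \<in> J'"
    unfolding J'_def using ring_idealD(1)[OF J(1)] by blast
  then have "\<forall>i\<in>{1..Suc m}. Var i - Cst ((x(Suc m := c)) i) \<in> J'"
    using J(4) sub by (auto simp: le_Suc_eq)
  ultimately show ?case using J(2) sub by (intro exI[of _ "x(Suc m := c)"] exI[of _ J']) blast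
qed

text \<open>Congruence modulo \<open>J\<close> respects sums and products, so it passes from the
  variables to \<open>p\<close>; \<open>ev_closed\<close> supplies the induction.\<close>

lemma ideal_contains_value:
  fixes p :: "'v cpoly"
  assumes J: "ring_ideal J" and "\<And>v. v \<in> poly_vars p \<Longrightarrow> Var v - Cst (x v) \<in> J"
  shows "p - Cst (poly_eval x p) \<in> J"
proof -
  have "ev Cst Var p \<in> {p. p - Cst (poly_eval x p) \<in> J}"
  proof (rule ev_closed; (unfold mem_Collect_eq)?)
    fix a b assume a: "a - Cst (poly_eval x a) \<in> J" and b: "b - Cst (poly_eval x b) \<in> J"
    have "(a + b) - Cst (poly_eval x (a + b)) = (a - Cst (poly_eval x a)) + (b - Cst (poly_eval x b))"
      by (simp add: poly_eval.hom_add Cst.hom_add)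
    with ring_idealD(2)[OF J a b] show "(a + b) - Cst (poly_eval x (a + b)) \<in> J" by (simp only:)
    have "a * b - Cst (poly_eval x (a * b)) =
        b * (a - Cst (poly_eval x a)) + Cst (poly_eval x a) * (b - Cst (poly_eval x b))"
      by (simp add: poly_eval.hom_mult Cst.hom_mult algebra_simps)
    then show "a * b - Cst (poly_eval x (a * b)) \<in> J"
      using ring_idealD(2)[OF J] ring_idealD(3)[OF J a] ring_idealD(3)[OF J b] by metis
  qed (use assms ring_idealD(1)[OF J] in auto)
  then show ?thesis by (simp add: ev_Cst_Var)
qed

text \<open>Otherwise values \<open>x\<close> can be adjoined to the ideal without catching a power
  of \<open>Var j\<close>. They form a common zero, since a nonzero value of some \<open>f i\<close>
  would put a unit into the larger ideal; and \<open>x j = 0\<close> would put \<open>Var j\<close>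
  into it.\<close>

theorem power_in_ideal:
  fixes f :: "nat \<Rightarrow> nat cpoly"
  assumes vars: "\<And>i. i \<in> {1..n} \<Longrightarrow> poly_vars (f i) \<subseteq> {1..n}" and j: "j \<in> {1..n}"
    and nozero: "\<And>x. x j \<noteq> 0 \<Longrightarrow> \<exists>i\<in>{1..n}. poly_eval x (f i) \<noteq> 0"
  shows "\<exists>D G. Var j ^ D = (\<Sum>i\<in>{1..n}. G i * f i)"
proof (rule ccontr)
  assume neg: "\<not> ?thesis"
  define I where "I = {(\<Sum>i\<in>{1..n}. G i * f i) | G. True}"
  have "ring_ideal I"
    unfolding ring_ideal_def
  proof (intro conjI ballI allI)
    show "0 \<in> I" unfolding I_def by (auto intro!: exI[of _ "\<lambda>_. 0"])
  next
    fix a b assume "a \<in> I" "b \<in> I"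
    then obtain G H where *: "a = (\<Sum>i\<in>{1..n}. G i * f i)" "b = (\<Sum>i\<in>{1..n}. H i * f i)"
      unfolding I_def by blast
    have "a + b = (\<Sum>i\<in>{1..n}. (G i + H i) * f i)" by (simp add: * distrib_right sum.distrib)
    then show "a + b \<in> I" unfolding I_def by (auto intro!: exI[of _ "\<lambda>i. G i + H i"])
  next
    fix a r assume "a \<in> I"
    then obtain G where *: "a = (\<Sum>i\<in>{1..n}. G i * f i)" unfolding I_def by blast
    have "r * a = (\<Sum>i\<in>{1..n}. (r * G i) * f i)" by (simp add: * sum_distrib_left mult.assoc)
    then show "r * a \<in> I" unfolding I_def by (auto intro!: exI[of _ "\<lambda>i. r * G i"])
  qed
  moreover have "Var j ^ D \<notin> I" for D using neg unfolding I_def by blast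
  ultimately obtain x J where J: "ring_ideal J" "I \<subseteq> J" "\<forall>D. Var j ^ D \<notin> J"
      "\<forall>i\<in>{1..n}. Var i - Cst (x i) \<in> J"
    using adjoin_values[of I "Var j" n] by blast
  have no_unit: "Cst c \<notin> J" if "c \<noteq> 0" for c
  proof
    assume "Cst c \<in> J"
    then have "Cst (inverse c) * Cst c \<in> J" by (rule ring_idealD(3)[OF J(1)])
    then show False using that J(3)[rule_format, of 0] by (simp flip: Cst.hom_mult)
  qed
  have "x j \<noteq> 0"
  proof
    assume "x j = 0"
    then have "Var j ^ 1 \<in> J" using J(4) j by force
    then show False using J(3) by blast
  qed
  moreover have "poly_eval x (f i) = 0" if i: "i \<in> {1..n}" for i
  proof (rule ccontr)
    assume nz: "poly_eval x (f i) \<noteq> 0"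
    have "f i - Cst (poly_eval x (f i)) \<in> J"
      by (rule ideal_contains_value[OF J(1)]) (use J(4) vars[OF i] in blast)
    moreover have "f i = (\<Sum>k\<in>{1..n}. (if k = i then 1 else 0) * f k)"
      using i by (simp add: if_distrib[of "\<lambda>x. x * _"] cong: if_cong)
    then have "f i \<in> I"
      unfolding I_def by (intro CollectI exI[of _ "\<lambda>k. if k = i then 1 else 0"] conjI TrueI)
    then have "(-1) * f i \<in> J" using J(2) ring_idealD(3)[OF J(1)] by blast
    ultimately have "(f i - Cst (poly_eval x (f i))) + (-1) * f i \<in> J"
      by (rule ring_idealD(2)[OF J(1)])
    then have "Cst (- poly_eval x (f i)) \<in> J" by (simp add: Cst.hom_uminus)
    then show False using no_unit nz by simp
  qed
  ultimately show False using nozero by blast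
qed

section \<open>Existence and uniqueness of the resultant\<close>

text \<open>The system \<open>x_1^d, ..., x_n^d\<close> of the normalization. The dimension does not
  enter, so the same assignment serves for the whole system and for both blocks.\<close>

definition powers :: "nat \<Rightarrow> coeff_var \<Rightarrow> complex" where
  "powers d v = (if snd v = Poly_Mapping.single (fst v) d then 1 else 0)"

lemma form_at_powers: "i \<in> {1..n} \<Longrightarrow> form_at n d (powers d) i x = x i ^ d"
proof -
  assume i: "i \<in> {1..n}"
  have "form_at n d (powers d) i x = (\<Sum>\<alpha>\<in>monoms n d. if \<alpha> = Poly_Mapping.single i d then mon x \<alpha> else 0)"
    unfolding form_at_def powers_def by (rule sum.cong) auto
  then show ?thesis using single_in_monoms[OF i, of d] by (simp add: mon_single)
qed

lemma not_has_zero_powers: "d \<ge> 1 \<Longrightarrow> \<not> has_zero n d (powers d)"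
  by (auto simp: has_zero_def form_at_powers)

lemma Var_power: "Var v ^ k = Poly_Mapping.single (Poly_Mapping.single v k) 1"
  using mon_Var[of "Poly_Mapping.single v k"] by (simp add: mon_single)

lemma split_single:
  fixes \<alpha> :: "'a \<Rightarrow>\<^sub>0 nat"
  assumes "k \<le> plookup \<alpha> j"
  shows "(\<alpha> - Poly_Mapping.single j k) + Poly_Mapping.single j k = \<alpha>"
  by (rule poly_mapping_eqI) (use assms in \<open>auto simp: lookup_add lookup_minus lookup_single when_def\<close>)

lemma combinations_without_zero:
  assumes "\<not> has_zero n d c"
  shows "\<exists>e\<ge>d. \<exists>G. \<forall>\<alpha>\<in>monoms n e. (\<Sum>i\<in>{1..n}. G \<alpha> i * form_poly n d c i) = Poly_Mapping.single \<alpha> 1"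
proof -
  have "\<forall>j\<in>{1..n}. \<exists>p. Var j ^ fst p = (\<Sum>i\<in>{1..n}. snd p i * form_poly n d c i)"
  proof
    fix j assume j: "j \<in> {1..n}"
    have "\<exists>D G. Var j ^ D = (\<Sum>i\<in>{1..n}. G i * form_poly n d c i)"
    proof (rule power_in_ideal[OF poly_vars_form_poly j])
      fix x :: "nat \<Rightarrow> complex" assume "x j \<noteq> 0"
      then show "\<exists>i\<in>{1..n}. poly_eval x (form_poly n d c i) \<noteq> 0"
        using assms j unfolding has_zero_def poly_eval_form_poly by blast
    qed
    then show "\<exists>p. Var j ^ fst p = (\<Sum>i\<in>{1..n}. snd p i * form_poly n d c i)" by simp
  qed
  from bchoice[OF this] obtain p where
    p: "\<forall>j\<in>{1..n}. Var j ^ fst (p j) = (\<Sum>i\<in>{1..n}. snd (p j) i * form_poly n d c i)" by (elim exE)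
  define D where "D j = fst (p j)" for j
  define G where "G j = snd (p j)" for j
  have DG: "Var j ^ D j = (\<Sum>i\<in>{1..n}. G j i * form_poly n d c i)" if "j \<in> {1..n}" for j
    using p that by (simp add: D_def G_def)
  \<comment> \<open>A monomial of degree above the sum of the \<open>D j\<close> has some exponent
    at least \<open>D j\<close>, hence is a multiple of a power already expressed; the summand
    \<open>d\<close> provides \<open>d \<le> e\<close> for the determinant.\<close>
  define e where "e = d + (\<Sum>j\<in>{1..n}. D j) + 1"
  have "\<forall>\<alpha>\<in>monoms n e. \<exists>g. (\<Sum>i\<in>{1..n}. g i * form_poly n d c i) = Poly_Mapping.single \<alpha> 1"
  proof
    fix \<alpha> assume \<alpha>: "\<alpha> \<in> monoms n e"
    have "\<exists>j\<in>{1..n}. D j \<le> plookup \<alpha> j"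
    proof (rule ccontr)
      assume "\<not> ?thesis"
      then have "(\<Sum>j\<in>{1..n}. plookup \<alpha> j) \<le> (\<Sum>j\<in>{1..n}. D j)" by (intro sum_mono) (auto simp: not_le intro: less_imp_le)
      then show False using \<alpha> by (simp add: monoms_def e_def)
    qed
    then obtain j where j: "j \<in> {1..n}" "D j \<le> plookup \<alpha> j" by blast
    let ?m = "Poly_Mapping.single (\<alpha> - Poly_Mapping.single j (D j)) 1 :: nat cpoly"
    have "Poly_Mapping.single \<alpha> 1 = ?m * Var j ^ D j"
      by (simp add: Var_power mult_single split_single[OF j(2)])
    also have "\<dots> = (\<Sum>i\<in>{1..n}. (?m * G j i) * form_poly n d c i)"
      by (simp add: DG[OF j(1)] sum_distrib_left mult.assoc)
    finally show "\<exists>g. (\<Sum>i\<in>{1..n}. g i * form_poly n d c i) = Poly_Mapping.single \<alpha> 1"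
      by (intro exI[of _ "\<lambda>i. ?m * G j i"]) (rule sym)
  qed
  from bchoice[OF this] have "\<exists>G. \<forall>\<alpha>\<in>monoms n e. (\<Sum>i\<in>{1..n}. G \<alpha> i * form_poly n d c i) = Poly_Mapping.single \<alpha> 1" .
  moreover have "e \<ge> d" by (simp add: e_def)
  ultimately show ?thesis by (intro exI[of _ e] conjI)
qed

text \<open>The multipliers \<open>G\<close> are made for this \<open>c\<close>, so that the matrix
  of the determinant built from them becomes the unit matrix at \<open>c\<close>.\<close>

lemma vanishing_separates:
  assumes "\<not> has_zero n d c"
  shows "\<exists>\<mu>\<in>vanishing n d. poly_eval c \<mu> = 1"
proof -
  obtain e G where "d \<le> e" and G: "\<forall>\<alpha>\<in>monoms n e. (\<Sum>i\<in>{1..n}. G \<alpha> i * form_poly n d c i) = Poly_Mapping.single \<alpha> 1"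
    using combinations_without_zero[OF assms] by (elim exE conjE)
  obtain \<mu> where \<mu>: "\<mu> \<in> vanishing n d" "\<forall>c \<kappa>.
    (\<forall>\<alpha>\<in>monoms n e. (\<Sum>i\<in>{1..n}. G \<alpha> i * form_poly n d c i) = Poly_Mapping.single \<alpha> (\<kappa> \<alpha>)) \<longrightarrow>
    poly_eval c \<mu> = (\<Prod>\<alpha>\<in>monoms n e. \<kappa> \<alpha>)"
    using exists_determinant[OF \<open>d \<le> e\<close>, of n G] by (elim bexE)
  have "poly_eval c \<mu> = (\<Prod>\<alpha>\<in>monoms n e. 1)"
    using \<mu>(2)[THEN spec, THEN spec, of c "\<lambda>_. 1"] G by (rule mp)
  then show ?thesis using \<mu>(1) by (intro bexI[of _ \<mu>]) simp_all
qed

text \<open>Nonzero constants are outside the ideal because the zero system has nontrivial zeros;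
  primality then selects an irreducible factor of \<open>g\<close>.\<close>

lemma exists_irreducible_vanishing:
  assumes "n \<ge> 1" "d \<ge> 1" "g \<noteq> 0" "g \<in> vanishing n d"
  shows "\<exists>R. irreducible R \<and> R \<in> vanishing n d"
  using assms(3,4)
proof (induction g rule: cpoly_factor_induct)
  case (const c)
  then show ?case using has_zero_0[OF assms(1), of d] by (auto simp: vanishing_def)
next
  case (mult q a)
  have nz: "q * a \<noteq> 0" using mult.hyps by (auto simp: irreducible_def)
  have "poly_vars q \<subseteq> coeff_vars n d" "poly_vars a \<subseteq> coeff_vars n d"
    using poly_vars_dvd[of q "q * a"] poly_vars_dvd[of a "q * a"] nz mult.prems
    by (auto simp: vanishing_def)
  then have "q \<in> vanishing n d \<or> a \<in> vanishing n d"
    using vanishing_prime[OF assms(2)] mult.prems by blast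
  then show ?case using mult.IH mult.hyps(1) by blast
qed

lemma finite_coeff_vars: "finite (coeff_vars n d)"
  by (simp add: coeff_vars_def)

theorem exists_resultant_poly:
  assumes n: "n \<ge> 1" and d: "d \<ge> 1"
  shows "\<exists>R. irreducible R \<and> R \<in> vanishing n d \<and> (\<forall>c. poly_eval c R = 0 \<longleftrightarrow> has_zero n d c)"
proof -
  obtain \<mu> where \<mu>: "\<mu> \<in> vanishing n d" "poly_eval (powers d) \<mu> = 1"
    using vanishing_separates[OF not_has_zero_powers[OF d]] by blast
  then have "\<mu> \<noteq> 0" by auto
  then obtain R where R: "irreducible R" "R \<in> vanishing n d"
    using exists_irreducible_vanishing[OF n d] \<mu> by blast
  have R0: "R \<noteq> 0" using R by (auto simp: irreducible_def)
  let ?t = "(n, Poly_Mapping.single n d)"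
  let ?W = "coeff_vars n d - {?t}"
  have t: "?t \<in> poly_vars R" using vanishing_without_top_coeff[OF n d R(2)] R0 by blast
  have R_vars: "poly_vars R \<subseteq> coeff_vars n d" using R by (simp add: vanishing_def)
  then have ins: "insert ?t ?W = coeff_vars n d" using t by blast
  have dvd: "R dvd g" if g: "g \<in> vanishing n d" for g
  proof (rule ccontr)
    assume "\<not> R dvd g"
    then have "\<exists>h u v. h \<noteq> 0 \<and> poly_vars h \<subseteq> ?W \<and> h = u * R + v * g"
      using g R_vars t R
      by (intro elimination_in[of _ ?t] prime_in_finite) (auto simp: finite_coeff_vars vanishing_def ins)
    then obtain h u v where h: "h \<noteq> 0" "poly_vars h \<subseteq> ?W" "h = u * R + v * g" by blast
    have "h \<in> vanishing n d"
      using h g R unfolding vanishing_def by (auto simp: poly_eval.hom_add poly_eval.hom_mult)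
    then show False using vanishing_without_top_coeff[OF n d] h by blast
  qed
  have "has_zero n d c" if c: "poly_eval c R = 0" for c
  proof (rule ccontr)
    assume "\<not> has_zero n d c"
    then obtain \<mu> where \<mu>: "\<mu> \<in> vanishing n d" "poly_eval c \<mu> = 1"
      using vanishing_separates by blast
    from dvd[OF \<mu>(1)] obtain u where "\<mu> = R * u" by (elim dvdE)
    then show False using \<mu> c by (simp add: poly_eval.hom_mult)
  qed
  then show ?thesis using R unfolding vanishing_def by blast
qed

text \<open>\<open>is_resultant\<close> rephrased for coefficient assignments instead of tuples of
  forms.\<close>

definition is_res :: "nat \<Rightarrow> nat \<Rightarrow> coeff_var cpoly \<Rightarrow> bool" where
  "is_res n d R \<longleftrightarrow> irreducible R \<and> R \<in> vanishing n d \<and>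
    (\<forall>c. poly_eval c R = 0 \<longleftrightarrow> has_zero n d c) \<and> poly_eval (powers d) R = 1"

lemma common_nontrivial_zero_iff:
  assumes "\<And>i. i \<in> {1..n} \<Longrightarrow> f i \<in> forms n d"
  shows "common_nontrivial_zero n f \<longleftrightarrow> has_zero n d (\<lambda>(i, \<alpha>). plookup (f i) \<alpha>)"
proof -
  have "poly_eval x (f i) = form_at n d (\<lambda>(i, \<alpha>). plookup (f i) \<alpha>) i x" if "i \<in> {1..n}" for i x
    using assms[OF that] by (simp add: forms_def form_at_def poly_eval_superset[of "monoms n d"] mon_def)
  then show ?thesis by (simp add: common_nontrivial_zero_def has_zero_def)
qed

lemma lookup_form_poly: "\<alpha> \<in> monoms n d \<Longrightarrow> plookup (form_poly n d c i) \<alpha> = c (i, \<alpha>)"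
  by (simp add: form_poly_def lookup_sum lookup_single when_def)

lemma form_poly_in_forms: "form_poly n d c i \<in> forms n d"
proof -
  have "pkeys (form_poly n d c i) \<subseteq> (\<Union>\<delta>\<in>monoms n d. pkeys (Poly_Mapping.single \<delta> (c (i, \<delta>))))"
    unfolding form_poly_def by (rule keys_sum)
  then show ?thesis by (auto simp: forms_def split: if_splits)
qed

text \<open>On \<open>coeff_vars n d\<close> every assignment is read off from its
  \<open>form_poly\<close>, and neither \<open>R\<close> nor \<open>has_zero\<close> depends on
  values elsewhere.\<close>

lemma is_resultant_iff: "is_resultant n d R \<longleftrightarrow> is_res n d R"
proof -
  have pw: "(\<lambda>(i, \<alpha>). plookup (Poly_Mapping.single (Poly_Mapping.single i d) 1) \<alpha>) = powers d"
    by (auto simp: powers_def lookup_single when_def fun_eq_iff)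
  have "(\<forall>f. (\<forall>i\<in>{1..n}. f i \<in> forms n d) \<longrightarrow> (eval_at_forms f R = 0 \<longleftrightarrow> common_nontrivial_zero n f)) \<longleftrightarrow>
      (\<forall>c. poly_eval c R = 0 \<longleftrightarrow> has_zero n d c)" (is "?L \<longleftrightarrow> ?R") if R: "poly_vars R \<subseteq> coeff_vars n d"
  proof
    assume L: ?L
    show ?R
    proof
      fix c
      let ?f = "form_poly n d c"
      have eq: "(\<lambda>(i, \<alpha>). plookup (?f i) \<alpha>) v = c v" if "v \<in> coeff_vars n d" for v
        using that by (auto simp: coeff_vars_def lookup_form_poly)
      have "eval_at_forms ?f R = poly_eval c R"
        unfolding eval_at_forms_def by (rule poly_eval_cong) (use eq R in blast)
      moreover have "has_zero n d (\<lambda>(i, \<alpha>). plookup (?f i) \<alpha>) \<longleftrightarrow> has_zero n d c"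
        by (rule has_zero_cong) (rule eq)
      moreover have "common_nontrivial_zero n ?f \<longleftrightarrow> has_zero n d (\<lambda>(i, \<alpha>). plookup (?f i) \<alpha>)"
        by (rule common_nontrivial_zero_iff[OF form_poly_in_forms])
      moreover have "eval_at_forms ?f R = 0 \<longleftrightarrow> common_nontrivial_zero n ?f"
        by (rule L[THEN spec, THEN mp]) (simp add: form_poly_in_forms)
      ultimately show "poly_eval c R = 0 \<longleftrightarrow> has_zero n d c" by simp
    qed
  next
    assume ?R
    show ?L
    proof (intro allI impI)
      fix f :: "nat \<Rightarrow> nat cpoly" assume f: "\<forall>i\<in>{1..n}. f i \<in> forms n d"
      have "common_nontrivial_zero n f \<longleftrightarrow> has_zero n d (\<lambda>(i, \<alpha>). plookup (f i) \<alpha>)"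
        by (rule common_nontrivial_zero_iff) (use f in blast)
      then show "eval_at_forms f R = 0 \<longleftrightarrow> common_nontrivial_zero n f"
        using \<open>?R\<close> by (simp add: eval_at_forms_def)
    qed
  qed
  then show ?thesis
    unfolding is_resultant_def is_res_def vanishing_def eval_at_forms_def[of "\<lambda>i. Poly_Mapping.single (Poly_Mapping.single i d) 1"] pw
    by auto
qed

lemma exists_is_res:
  assumes n: "n \<ge> 1" and d: "d \<ge> 1"
  shows "\<exists>R. is_res n d R"
proof -
  obtain R where R: "irreducible R" "R \<in> vanishing n d" "\<And>c. poly_eval c R = 0 \<longleftrightarrow> has_zero n d c"
    using exists_resultant_poly[OF n d] by blast
  let ?k = "inverse (poly_eval (powers d) R)"
  have k: "poly_eval (powers d) R \<noteq> 0" using R(3) not_has_zero_powers[OF d] by simp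
  have "irreducible (Cst ?k * R)"
    using R(1) k by (subst irreducible_mult_unit_left) (auto intro: Cst_dvd_1)
  moreover have "Cst ?k * R \<in> vanishing n d"
    using R(2) poly_vars_mult[of "Cst ?k" R] by (auto simp: vanishing_def poly_eval.hom_mult)
  ultimately have "is_res n d (Cst ?k * R)"
    using k R(3) by (simp add: is_res_def poly_eval.hom_mult)
  then show ?thesis ..
qed

lemma is_res_unique:
  assumes "is_res n d R" "is_res n d R'"
  shows "R = R'"
proof -
  have "R dvd R'" using assms by (intro irreducible_dvd_if_vanishes) (auto simp: is_res_def)
  then obtain c where c: "R = Cst c * R'"
    using irreducible_dvd_irreducible[of R' R] assms by (auto simp: is_res_def)
  have "poly_eval (powers d) R = c * poly_eval (powers d) R'" by (simp add: c poly_eval.hom_mult)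
  then show ?thesis using assms c by (simp add: is_res_def)
qed

lemma is_res_resultant_poly:
  assumes "n \<ge> 1" "d \<ge> 1"
  shows "is_res n d (resultant_poly n d)"
  unfolding resultant_poly_def is_resultant_iff
  by (rule theI', rule ex_ex1I[OF exists_is_res[OF assms] is_res_unique])

section \<open>Degree of the resultant in one form\<close>

definition scale_row :: "nat \<Rightarrow> complex \<Rightarrow> (coeff_var \<Rightarrow> complex) \<Rightarrow> coeff_var \<Rightarrow> complex" where
  "scale_row i \<zeta> c v = (if fst v = i then \<zeta> * c v else c v)"

lemma form_at_scale_row:
  "form_at n d (scale_row i \<zeta> c) j x = (if j = i then \<zeta> else 1) * form_at n d c j x"
  by (auto simp: form_at_def scale_row_def sum_distrib_left mult.assoc)

lemma has_zero_scale_row: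
  assumes "\<zeta> \<noteq> 0"
  shows "has_zero n d (scale_row i \<zeta> c) \<longleftrightarrow> has_zero n d c"
proof -
  have "form_at n d (scale_row i \<zeta> c) j x = 0 \<longleftrightarrow> form_at n d c j x = 0" for j x
    using assms by (simp add: form_at_scale_row)
  then show ?thesis by (simp add: has_zero_def)
qed

lemma monom_if_no_nonzero_root:
  fixes q :: "complex poly"
  assumes "q \<noteq> 0" "\<And>s. s \<noteq> 0 \<Longrightarrow> poly q s \<noteq> 0"
  shows "\<exists>a e. q = monom a e"
  using assms
proof (induction "degree q" arbitrary: q)
  case 0
  then obtain a where "q = [:a:]" by (metis degree_eq_zeroE)
  then show ?case by (intro exI[of _ a] exI[of _ 0]) (simp add: monom_0)
next
  case (Suc m)
  then have "\<not> constant (poly q)" by (simp add: constant_degree)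
  then obtain r where r: "poly q r = 0" using fundamental_theorem_of_algebra by blast
  then have "poly q 0 = 0" using Suc.prems(2)[of r] by (cases "r = 0") simp_all
  then obtain q' where q': "q = [:0, 1:] * q'" by (auto simp: poly_eq_0_iff_dvd)
  have "q' \<noteq> 0" using Suc.prems q' by auto
  have "m = degree q'" using Suc.hyps(2) \<open>q' \<noteq> 0\<close> unfolding q' by (subst (asm) degree_mult_eq) auto
  moreover have "poly q' s \<noteq> 0" if "s \<noteq> 0" for s using Suc.prems(2)[OF that] q' by auto
  ultimately obtain a e where "q' = monom a e" using Suc.hyps(1) \<open>q' \<noteq> 0\<close> by blast
  then have "q = monom a (Suc e)" by (simp add: q' monom_Suc)
  then show ?case by blast
qed

text \<open>The new variable marks the degree in row \<open>i\<close>: coefficient \<open>k\<close>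
  collects the terms of degree \<open>k\<close> in the coefficients of form
  \<open>i\<close>.\<close>

definition grade :: "nat \<Rightarrow> coeff_var cpoly \<Rightarrow> coeff_var cpoly poly" where
  "grade i = ev (\<lambda>c. [:Cst c:]) (\<lambda>v. if fst v = i then [:0, Var v:] else [:Var v:])"

lemma eval_grade:
  "poly (map_poly (poly_eval c) (grade i p)) \<zeta> = poly_eval (scale_row i \<zeta> c) p"
proof -
  let ?h = "\<lambda>q. poly (map_poly (poly_eval c) q) \<zeta>"
  have "?h (grade i p) = ev (\<lambda>c. ?h [:Cst c:]) (\<lambda>v. ?h (if fst v = i then [:0, Var v:] else [:Var v:])) p"
    unfolding grade_def by (rule hom_ev[OF hom_eval_uni])
  also have "(\<lambda>c. ?h [:Cst c:]) = id" by (auto simp: map_poly_pCons)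
  also have "(\<lambda>v. ?h (if fst v = i then [:0, Var v:] else [:Var v:])) = scale_row i \<zeta> c"
    by (auto simp: map_poly_pCons scale_row_def fun_eq_iff)
  finally show ?thesis by (simp only: poly_eval_eq_ev[of "scale_row i \<zeta> c"])
qed

lemma scale_row_1: "scale_row i 1 c = c"
  by (auto simp: scale_row_def fun_eq_iff)

text \<open>
  Outside the zero set, \<open>\<zeta> \<mapsto> R (scale_row i \<zeta> c)\<close> has no root except \<open>0\<close> and hence is a monomial in \<open>\<zeta>\<close>;
  its degree does not depend on \<open>c\<close> because the polynomial ring has no zero divisors.
\<close>

lemma is_res_homogeneous:
  assumes R: "is_res n d R" and d: "d \<ge> 1"
  shows "\<exists>e. \<forall>c \<zeta>. poly_eval (scale_row i \<zeta> c) R = \<zeta> ^ e * poly_eval c R"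
proof -
  have R0: "poly_eval c R = 0 \<longleftrightarrow> has_zero n d c" for c using R by (simp add: is_res_def)
  define r where "r k = coeff (grade i R) k" for k
  have only_one: "r k = 0 \<or> r l = 0" if "k \<noteq> l" for k l
  proof (rule ccontr)
    assume "\<not> (r k = 0 \<or> r l = 0)"
    moreover have "R \<noteq> 0" using R by (auto simp: is_res_def)
    ultimately have "R * r k * r l \<noteq> 0" by simp
    then obtain c where c: "poly_eval c (R * r k * r l) \<noteq> 0" using exists_nonvanishing_point by blast
    let ?q = "map_poly (poly_eval c) (grade i R)"
    have cR: "poly_eval c R \<noteq> 0" using c by (auto simp: poly_eval.hom_mult)
    have "poly ?q s \<noteq> 0" if "s \<noteq> 0" for s
      using cR has_zero_scale_row[OF that] by (simp add: eval_grade R0)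
    moreover have "?q \<noteq> 0"
    proof
      assume "?q = 0"
      then have "poly ?q 1 = 0" by simp
      then show False using cR by (simp add: eval_grade scale_row_1)
    qed
    ultimately have "\<exists>a e. ?q = monom a e" by (intro monom_if_no_nonzero_root)
    then obtain a e where q: "?q = monom a e" by (elim exE)
    have "coeff ?q k * coeff ?q l = 0" unfolding q using that by simp
    then show False using c by (simp add: coeff_map_poly poly_eval.hom_mult r_def)
  qed
  have "poly_eval (powers d) R = 1" using R by (simp add: is_res_def)
  then have "poly (map_poly (poly_eval (powers d)) (grade i R)) 1 = 1" by (simp add: eval_grade scale_row_1)
  then have "grade i R \<noteq> 0" by auto
  then have e: "r e \<noteq> 0" if "e = degree (grade i R)" for e by (simp add: r_def that)
  define e where "e = degree (grade i R)"
  have e: "r e \<noteq> 0" by (rule e[OF e_def])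
  have "grade i R = monom (r e) e"
    by (rule poly_eqI) (use only_one e in \<open>auto simp: r_def\<close>)
  then have *: "poly_eval (scale_row i \<zeta> c) R = \<zeta> ^ e * poly_eval c (r e)" for \<zeta> c
    using eval_grade[of c i R \<zeta>] by (simp add: map_poly_monom poly_monom mult.commute)
  show ?thesis
  proof (intro exI[of _ e] allI)
    show "poly_eval (scale_row i \<zeta> c) R = \<zeta> ^ e * poly_eval c R" for c \<zeta>
      using *[of \<zeta> c] *[of 1 c] by (simp add: scale_row_1)
  qed
qed

section \<open>Upper bound for the degree: Macaulay's determinant\<close>

lemma form_poly_scaled_powers:
  assumes "j \<in> {1..n}"
  shows "form_poly n d (scale_row i \<zeta> (powers d)) j =
    Poly_Mapping.single (Poly_Mapping.single j d) (if j = i then \<zeta> else 1)"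
proof -
  have "form_poly n d (scale_row i \<zeta> (powers d)) j = (\<Sum>\<delta>\<in>monoms n d. if \<delta> = Poly_Mapping.single j d
      then Poly_Mapping.single \<delta> (if j = i then \<zeta> else 1) else 0)"
    unfolding form_poly_def by (rule sum.cong) (auto simp: scale_row_def powers_def)
  then show ?thesis using single_in_monoms[OF assms, of d] by simp
qed

text \<open>The exponent at \<open>i\<close> is determined by the total degree and the other
  \<open>n - 1\<close> exponents, each of which has at most \<open>d\<close> values.\<close>

lemma card_reduced_monoms:
  assumes i: "i \<in> {1..n}"
  shows "card {\<alpha> \<in> monoms n e. \<forall>j\<in>{1..n} - {i}. plookup \<alpha> j < d} \<le> d ^ (n - 1)"
proof -
  let ?A = "{\<alpha> \<in> monoms n e. \<forall>j\<in>{1..n} - {i}. plookup \<alpha> j < d}" and ?J = "{1..n} - {i}"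
  let ?f = "\<lambda>\<alpha>. restrict (plookup \<alpha>) ?J"
  have "inj_on ?f ?A"
  proof (rule inj_onI)
    fix \<alpha> \<beta> assume \<alpha>: "\<alpha> \<in> ?A" and \<beta>: "\<beta> \<in> ?A" and eq: "?f \<alpha> = ?f \<beta>"
    have J: "plookup \<alpha> j = plookup \<beta> j" if "j \<in> ?J" for j
      using fun_cong[OF eq, of j] that by (simp only: restrict_apply if_True)
    have total: "plookup \<gamma> i + (\<Sum>j\<in>?J. plookup \<gamma> j) = e" if "\<gamma> \<in> ?A" for \<gamma>
    proof -
      have "(\<Sum>j\<in>{1..n}. plookup \<gamma> j) = e" using that by (simp add: monoms_def)
      then show ?thesis using sum.remove[OF finite_atLeastAtMost i, of "plookup \<gamma>"] by linarith
    qed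
    have "(\<Sum>j\<in>?J. plookup \<alpha> j) = (\<Sum>j\<in>?J. plookup \<beta> j)" by (rule sum.cong) (use J in auto)
    then have i_eq: "plookup \<alpha> i = plookup \<beta> i" using total[OF \<alpha>] total[OF \<beta>] by linarith
    have outside: "plookup \<gamma> j = 0" if "\<gamma> \<in> ?A" "j \<notin> {1..n}" for \<gamma> j
    proof -
      have "j \<notin> pkeys \<gamma>" using that unfolding monoms_def by blast
      then show ?thesis by (simp add: in_keys_iff)
    qed
    have "plookup \<alpha> j = plookup \<beta> j" for j
    proof (cases "j \<in> {1..n}")
      case True
      then show ?thesis using J[of j] i_eq by (cases "j = i") simp_all
    next
      case False
      then show ?thesis using outside[OF \<alpha>] outside[OF \<beta>] by simp
    qed
    then show "\<alpha> = \<beta>" by (rule poly_mapping_eqI)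
  qed
  moreover have "?f ` ?A \<subseteq> ?J \<rightarrow>\<^sub>E {..<d}"
  proof (rule image_subsetI, rule PiE_I)
    fix \<alpha> j assume "\<alpha> \<in> ?A" "j \<in> ?J"
    then have "plookup \<alpha> j < d" by blast
    then show "?f \<alpha> j \<in> {..<d}" using \<open>j \<in> ?J\<close> by (simp only: restrict_apply if_True lessThan_iff)
  qed (simp only: restrict_apply if_False)
  ultimately have "card ?A \<le> card (?J \<rightarrow>\<^sub>E {..<d})"
    by (rule card_inj_on_le) (auto intro: finite_PiE)
  also have "\<dots> = d ^ (n - 1)" using i by (simp add: card_PiE)
  finally show ?thesis .
qed

text \<open>Each monomial \<open>\<alpha>\<close> of degree \<open>E\<close> is assigned to an index
  \<open>sel \<alpha> = j\<close> such that \<open>x_j^d\<close> divides it, and to \<open>i\<close>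
  only if no other choice exists. At the power system with row \<open>i\<close> scaled by
  \<open>\<zeta>\<close> the determinant is \<open>\<zeta>^k\<close>, where \<open>k\<close> counts
  the monomials assigned to \<open>i\<close>. Since \<open>R\<close> divides the determinant,
  \<open>\<zeta>^e\<close> divides \<open>\<zeta>^k\<close>.\<close>

lemma homogeneity_degree_le:
  assumes R: "is_res n d R" and d: "d \<ge> 1" and i: "i \<in> {1..n}"
    and e: "\<And>c \<zeta>. poly_eval (scale_row i \<zeta> c) R = \<zeta> ^ e * poly_eval c R"
  shows "e \<le> d ^ (n - 1)"
proof -
  \<comment> \<open>The least degree in which every monomial has an exponent of at least
    \<open>d\<close>.\<close>
  define E where "E = n * (d - 1) + 1"
  define sel where "sel \<alpha> = (if \<exists>j\<in>{1..n} - {i}. d \<le> plookup \<alpha> j then SOME j. j \<in> {1..n} - {i} \<and> d \<le> plookup \<alpha> j else i)"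
    for \<alpha> :: "nat \<Rightarrow>\<^sub>0 nat"
  have sel_other: "sel \<alpha> \<in> {1..n} - {i} \<and> d \<le> plookup \<alpha> (sel \<alpha>)" if "\<exists>j\<in>{1..n} - {i}. d \<le> plookup \<alpha> j" for \<alpha>
    using someI_ex[of "\<lambda>j. j \<in> {1..n} - {i} \<and> d \<le> plookup \<alpha> j"] that by (simp add: sel_def Bex_def)
  have sel_i: "sel \<alpha> = i \<longleftrightarrow> (\<forall>j\<in>{1..n} - {i}. plookup \<alpha> j < d)" for \<alpha>
  proof (cases "\<exists>j\<in>{1..n} - {i}. d \<le> plookup \<alpha> j")
    case True
    have "sel \<alpha> \<noteq> i" using sel_other[OF True] by blast
    moreover have "\<not> (\<forall>j\<in>{1..n} - {i}. plookup \<alpha> j < d)" using True by (simp add: not_less)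
    ultimately show ?thesis by blast
  next
    case False
    then have "sel \<alpha> = i" unfolding sel_def by (rule if_not_P)
    with False show ?thesis by (simp add: not_le)
  qed
  have sel: "sel \<alpha> \<in> {1..n} \<and> d \<le> plookup \<alpha> (sel \<alpha>)" if \<alpha>: "\<alpha> \<in> monoms n E" for \<alpha>
  proof (cases "sel \<alpha> = i")
    case False
    then have "\<exists>j\<in>{1..n} - {i}. d \<le> plookup \<alpha> j" unfolding sel_i by (simp add: not_less)
    from sel_other[OF this] show ?thesis by blast
  next
    case True
    have "(\<Sum>j\<in>{1..n} - {i}. plookup \<alpha> j) \<le> (\<Sum>j\<in>{1..n} - {i}. d - 1)"
    proof (rule sum_mono)
      fix j assume "j \<in> {1..n} - {i}"
      then have "plookup \<alpha> j < d" using True sel_i by blast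
      then show "plookup \<alpha> j \<le> d - 1" by simp
    qed
    also have "\<dots> = (n - 1) * (d - 1)" using i by simp
    finally have "E \<le> plookup \<alpha> i + (n - 1) * (d - 1)"
      using \<alpha> sum.remove[of "{1..n}" i "plookup \<alpha>"] i by (simp add: monoms_def)
    moreover have "n * (d - 1) = (n - 1) * (d - 1) + (d - 1)" using i by (cases n) auto
    ultimately have "d \<le> plookup \<alpha> i" using d by (simp add: E_def)
    then show ?thesis using True i by simp
  qed
  define G where "G \<alpha> j = (if j = sel \<alpha> then Poly_Mapping.single (\<alpha> - Poly_Mapping.single j d) 1 else 0 :: nat cpoly)" for \<alpha> j
  have "d \<le> E" using i d unfolding E_def by (cases n) auto
  obtain \<mu> where \<mu>: "\<mu> \<in> vanishing n d" "\<forall>c \<kappa>.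
    (\<forall>\<alpha>\<in>monoms n E. (\<Sum>i\<in>{1..n}. G \<alpha> i * form_poly n d c i) = Poly_Mapping.single \<alpha> (\<kappa> \<alpha>)) \<longrightarrow>
    poly_eval c \<mu> = (\<Prod>\<alpha>\<in>monoms n E. \<kappa> \<alpha>)"
    using exists_determinant[OF \<open>d \<le> E\<close>, of n G] by (elim bexE)
  define k where "k = card {\<alpha> \<in> monoms n E. \<forall>j\<in>{1..n} - {i}. plookup \<alpha> j < d}"
  have \<mu>_eval: "poly_eval (scale_row i \<zeta> (powers d)) \<mu> = \<zeta> ^ k" for \<zeta>
  proof -
    let ?c = "scale_row i \<zeta> (powers d)" and ?\<kappa> = "\<lambda>\<alpha>. if sel \<alpha> = i then \<zeta> else 1"
    have "\<forall>\<alpha>\<in>monoms n E. (\<Sum>j\<in>{1..n}. G \<alpha> j * form_poly n d ?c j) = Poly_Mapping.single \<alpha> (?\<kappa> \<alpha>)"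
    proof
      fix \<alpha> assume "\<alpha> \<in> monoms n E"
      then have s: "sel \<alpha> \<in> {1..n}" "d \<le> plookup \<alpha> (sel \<alpha>)" using sel by auto
      have "(\<Sum>j\<in>{1..n}. G \<alpha> j * form_poly n d ?c j) =
          (\<Sum>j\<in>{1..n}. if j = sel \<alpha> then Poly_Mapping.single \<alpha> (?\<kappa> \<alpha>) else 0)"
      proof (rule sum.cong)
        fix j assume j: "j \<in> {1..n}"
        show "G \<alpha> j * form_poly n d ?c j = (if j = sel \<alpha> then Poly_Mapping.single \<alpha> (?\<kappa> \<alpha>) else 0)"
          using split_single[OF s(2)] by (simp add: G_def form_poly_scaled_powers[OF j] mult_single)
      qed simp
      then show "(\<Sum>j\<in>{1..n}. G \<alpha> j * form_poly n d ?c j) = Poly_Mapping.single \<alpha> (?\<kappa> \<alpha>)"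
        using s by simp
    qed
    with \<mu>(2)[THEN spec, THEN spec, of ?c ?\<kappa>] have "poly_eval ?c \<mu> = (\<Prod>\<alpha>\<in>monoms n E. ?\<kappa> \<alpha>)"
      by (rule mp)
    also have "\<dots> = (\<Prod>\<alpha>\<in>{\<alpha> \<in> monoms n E. sel \<alpha> = i}. \<zeta>)"
      by (rule prod.inter_filter[symmetric]) simp
    also have "\<dots> = \<zeta> ^ k" by (simp add: k_def sel_i)
    finally show ?thesis .
  qed
  have "R dvd \<mu>"
  proof (rule irreducible_dvd_if_vanishes)
    show "irreducible R" using R by (simp add: is_res_def)
    fix c assume "poly_eval c R = 0"
    then have "has_zero n d c" using R by (simp add: is_res_def)
    then show "poly_eval c \<mu> = 0" using \<mu>(1) by (simp add: vanishing_def)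
  qed
  then obtain u where u: "\<mu> = R * u" by (elim dvdE)
  \<comment> \<open>The cofactor of \<open>R\<close> in the determinant, as a polynomial in
    \<open>\<zeta>\<close>.\<close>
  define Q where "Q = ev (\<lambda>c. [:c:]) (\<lambda>v. if fst v = i then [:0, powers d v:] else [:powers d v:]) u"
  have Q: "poly Q \<zeta> = poly_eval (scale_row i \<zeta> (powers d)) u" for \<zeta>
    unfolding Q_def poly_eval_curve
    by (rule arg_cong[of _ _ "\<lambda>x. poly_eval x u"]) (auto simp: scale_row_def fun_eq_iff)
  have "poly_eval (powers d) R = 1" using R by (simp add: is_res_def)
  then have "poly (monom 1 k) \<zeta> = poly (monom 1 e * Q) \<zeta>" for \<zeta>
    using \<mu>_eval[of \<zeta>] by (simp add: u poly_eval.hom_mult e Q poly_monom)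
  then have "poly (monom 1 k) = poly (monom 1 e * Q)" by (rule ext)
  then have eq: "monom 1 k = monom 1 e * Q" by (simp only: poly_eq_poly_eq_iff)
  then have "Q \<noteq> 0" by auto
  have "k = degree (monom 1 e * Q)" unfolding eq[symmetric] by (simp add: degree_monom_eq)
  also have "\<dots> = e + degree Q" using \<open>Q \<noteq> 0\<close> by (subst degree_mult_eq) (auto simp: degree_monom_eq)
  finally have "e \<le> k" by simp
  also have "k \<le> d ^ (n - 1)" unfolding k_def by (rule card_reduced_monoms[OF i])
  finally show ?thesis .
qed

section \<open>Lower bound for the degree: a cyclic system\<close>

definition swap_to_last :: "nat \<Rightarrow> nat \<Rightarrow> nat \<Rightarrow> nat" where
  "swap_to_last n i r = (if r = i then n else if r = n then i else r)"

text \<open>The successor in the cycle \<open>1, 2, ..., n, 1\<close>, conjugated by the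
  transposition of \<open>i\<close> and \<open>n\<close>.\<close>

definition next_index :: "nat \<Rightarrow> nat \<Rightarrow> nat \<Rightarrow> nat" where
  "next_index n i r = swap_to_last n i (if r = i then 1 else Suc (swap_to_last n i r))"

text \<open>
  For \<open>i = n\<close> the rows \<open>r < n\<close> of this system are \<open>x\<^sub>r\<^sup>d - x\<^sub>r\<^sub>+\<^sub>1 x\<^sub>n\<^bsup>d-1\<^esup>\<close> and the last one is \<open>a x\<^sub>n\<^sup>d - b x\<^sub>1 x\<^sub>n\<^bsup>d-1\<^esup>\<close>;
  for general \<open>i\<close> the indices \<open>i\<close> and \<open>n\<close> are swapped.
  For \<open>b = 1\<close> a nontrivial zero exists iff \<open>a\<close> is a root of unity of order \<open>d\<^bsup>n-1\<^esup>\<close>.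
\<close>

definition cyclic_system :: "nat \<Rightarrow> nat \<Rightarrow> nat \<Rightarrow> complex \<Rightarrow> complex \<Rightarrow> coeff_var \<Rightarrow> complex" where
  "cyclic_system n d i a b v =
    (if snd v = Poly_Mapping.single (fst v) d then (if fst v = i then a else 1) else 0) -
    (if snd v = Poly_Mapping.single (next_index n i (fst v)) 1 + Poly_Mapping.single i (d - 1)
     then (if fst v = i then b else 1) else 0)"

lemma swap_to_last:
  assumes "i \<in> {1..n}"
  shows "swap_to_last n i (swap_to_last n i r) = r" "r \<in> {1..n} \<Longrightarrow> swap_to_last n i r \<in> {1..n}"
    "swap_to_last n i r = n \<longleftrightarrow> r = i"
  using assms by (auto simp: swap_to_last_def)

lemma next_index_in:
  assumes i: "i \<in> {1..n}" and r: "r \<in> {1..n}"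
  shows "next_index n i r \<in> {1..n}"
proof -
  have "(if r = i then 1 else Suc (swap_to_last n i r)) \<in> {1..n}"
    using swap_to_last(2)[OF i r] swap_to_last(3)[OF i, of r] i by auto
  then show ?thesis unfolding next_index_def by (rule swap_to_last(2)[OF i])
qed

lemma form_at_cyclic_system:
  assumes d: "d \<ge> 1" and i: "i \<in> {1..n}" and r: "r \<in> {1..n}"
  shows "form_at n d (cyclic_system n d i a b) r x =
    (if r = i then a else 1) * x r ^ d - (if r = i then b else 1) * (x (next_index n i r) * x i ^ (d - 1))"
proof -
  let ?s = "Poly_Mapping.single r d"
  let ?m = "Poly_Mapping.single (next_index n i r) 1 + Poly_Mapping.single i (d - 1)"
  have s: "?s \<in> monoms n d" by (rule single_in_monoms[OF r])
  have "?m \<in> monoms n (1 + (d - 1))"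
    by (intro monoms_add single_in_monoms next_index_in i r)
  then have m: "?m \<in> monoms n d" using d by simp
  have "form_at n d (cyclic_system n d i a b) r x =
      (\<Sum>\<alpha>\<in>monoms n d. if \<alpha> = ?s then (if r = i then a else 1) * mon x \<alpha> else 0) -
      (\<Sum>\<alpha>\<in>monoms n d. if \<alpha> = ?m then (if r = i then b else 1) * mon x \<alpha> else 0)"
    unfolding form_at_def sum_subtractf[symmetric]
    by (rule sum.cong) (auto simp: cyclic_system_def left_diff_distrib)
  also have "\<dots> = (if r = i then a else 1) * mon x ?s - (if r = i then b else 1) * mon x ?m"
    using s m by simp
  finally show ?thesis by (simp add: mon_single mon_add del: One_nat_def)
qed

text \<open>After the swap the zero is \<open>x_r = T^(d^(r-1))\<close>: each coordinate is the
  \<open>d\<close>-th power of the one before, and \<open>x_n = 1\<close> by the assumption on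
  \<open>T\<close>, so the last row reads \<open>T - x_1 = 0\<close>.\<close>

lemma cyclic_system_has_zero:
  assumes d: "d \<ge> 1" and i: "i \<in> {1..n}" and T: "T ^ (d ^ (n - 1)) = 1"
  shows "has_zero n d (cyclic_system n d i T 1)"
proof -
  let ?s = "swap_to_last n i"
  define x where "x r = T ^ (d ^ (?s r - 1))" for r
  have xi: "x i = 1" using T by (simp add: x_def swap_to_last_def)
  have "form_at n d (cyclic_system n d i T 1) r x = 0" if r: "r \<in> {1..n}" for r
  proof (cases "r = i")
    case True
    then have "x (next_index n i r) = T" by (simp add: x_def next_index_def swap_to_last(1)[OF i])
    then show ?thesis using xi True by (simp add: form_at_cyclic_system[OF d i i])
  next
    case False
    obtain q where q: "?s r = Suc q" using swap_to_last(2)[OF i r] by (cases "?s r") auto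
    have "x (next_index n i r) = T ^ (d ^ Suc q)"
      using False by (simp add: x_def next_index_def swap_to_last(1)[OF i] q)
    moreover have "x r ^ d = T ^ (d ^ Suc q)"
      by (simp add: x_def q mult.commute flip: power_mult)
    ultimately show ?thesis using xi False by (simp add: form_at_cyclic_system[OF d i r])
  qed
  then show ?thesis unfolding has_zero_def using i xi by (intro exI[of _ x] conjI bexI[of _ i] ballI) auto
qed

text \<open>After the swap the last row says \<open>x_1 * x_n^(d-1) = 0\<close>. If
  \<open>x_n\<close> were nonzero, \<open>x_1 = 0\<close> would propagate up the chain to
  \<open>x_n\<close>; so \<open>x_n = 0\<close>, which propagates down to all coordinates.\<close>

lemma cyclic_system_0_no_zero:
  assumes d: "d \<ge> 1" and i: "i \<in> {1..n}"
  shows "\<not> has_zero n d (cyclic_system n d i 0 1)"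
proof
  let ?s = "swap_to_last n i"
  assume "has_zero n d (cyclic_system n d i 0 1)"
  then obtain x where nz: "\<exists>r\<in>{1..n}. x r \<noteq> 0"
    and x: "\<And>r. r \<in> {1..n} \<Longrightarrow> form_at n d (cyclic_system n d i 0 1) r x = 0"
    unfolding has_zero_def by blast
  have ends: "x (?s 1) * x i ^ (d - 1) = 0"
    using x[OF i] by (simp add: form_at_cyclic_system[OF d i i] next_index_def)
  have chain: "x (?s r) ^ d = x (?s (Suc r)) * x i ^ (d - 1)" if "r \<in> {1..<n}" for r
  proof -
    have r: "r \<in> {1..n}" "r \<noteq> n" using that by auto
    have "?s r \<in> {1..n}" by (rule swap_to_last(2)[OF i r(1)])
    moreover have "?s r \<noteq> i"
      using swap_to_last(1)[OF i, of r] swap_to_last(3)[OF i, of "?s r"] r(2) by simp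
    ultimately show ?thesis
      using x[of "?s r"] by (simp add: form_at_cyclic_system[OF d i] next_index_def swap_to_last(1)[OF i])
  qed
  have sn: "?s n = i" by (simp add: swap_to_last_def)
  have xi: "x i = 0"
  proof (rule ccontr)
    assume xi: "x i \<noteq> 0"
    have "x (?s r) = 0" if "1 \<le> r" "r \<le> n" for r
      using that
    proof (induction r rule: dec_induct)
      case base
      then show ?case using ends xi by simp
    next
      case (step r)
      then have "x (?s r) = 0" by simp
      then show ?case using chain[of r] step xi d by (simp add: power_0_left)
    qed
    from this[of n] i sn xi show False by simp
  qed
  have all: "x (?s r) = 0" if "1 \<le> r" "r \<le> n" for r
    using that(2,1)
  proof (induction r rule: inc_induct)
    case base
    then show ?case using xi sn by simp
  next
    case (step r)
    then have "x (?s r) ^ d = 0" using chain[of r] by simp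
    then show ?case by simp
  qed
  have "x r = 0" if "r \<in> {1..n}" for r
    using all[of "?s r"] swap_to_last(1)[OF i, of r] swap_to_last(2)[OF i that] by simp
  then show False using nz by blast
qed

text \<open>Along \<open>cyclic_system n d i T 1\<close> the resultant is a nonzero polynomial
  \<open>Q\<close> in \<open>T\<close> that vanishes at the \<open>d^(n-1)\<close> roots of unity.
  Its degree is at most \<open>e\<close>, because pulling \<open>T\<close> out of row
  \<open>i\<close> writes it as \<open>T^e\<close> times a polynomial \<open>Q'\<close> in
  \<open>1/T\<close>.\<close>

lemma homogeneity_degree_ge:
  assumes R: "is_res n d R" and d: "d \<ge> 1" and i: "i \<in> {1..n}"
    and e: "\<And>c \<zeta>. poly_eval (scale_row i \<zeta> c) R = \<zeta> ^ e * poly_eval c R"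
  shows "d ^ (n - 1) \<le> e"
proof -
  let ?c = "cyclic_system n d i"
  have R0: "poly_eval c R = 0 \<longleftrightarrow> has_zero n d c" for c using R by (simp add: is_res_def)
  define Q where "Q = ev (\<lambda>c. [:c:]) (\<lambda>v. [:?c 0 1 v, ?c 1 1 v - ?c 0 1 v:]) R"
  define Q' where "Q' = ev (\<lambda>c. [:c:]) (\<lambda>v. [:?c 1 0 v, ?c 1 1 v - ?c 1 0 v:]) R"
  have "poly [:?c 0 1 v, ?c 1 1 v - ?c 0 1 v:] T = ?c T 1 v" for T v
    by (simp add: cyclic_system_def)
  then have Q: "poly Q T = poly_eval (?c T 1) R" for T
    unfolding Q_def poly_eval_curve by (simp only:)
  have "poly [:?c 1 0 v, ?c 1 1 v - ?c 1 0 v:] S = ?c 1 S v" for S v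
    by (simp add: cyclic_system_def)
  then have Q': "poly Q' S = poly_eval (?c 1 S) R" for S
    unfolding Q'_def poly_eval_curve by (simp only:)
  have "poly Q 0 \<noteq> 0" using cyclic_system_0_no_zero[OF d i] by (simp add: Q R0)
  then have "Q \<noteq> 0" by auto
  have swap: "poly Q T = T ^ e * poly Q' (inverse T)" if "T \<noteq> 0" for T
  proof -
    have "(if A then (if I then T else 1) else 0) - (if B then (if I then 1 else 1) else 0) =
        (if I then T * ((if A then (if I then 1 else 1) else 0) - (if B then (if I then inverse T else 1) else 0))
         else (if A then (if I then 1 else 1) else 0) - (if B then (if I then inverse T else 1) else 0))"
      for A B I :: bool
      using that by (cases A; cases B; cases I) (simp_all add: right_diff_distrib)
    then have "?c T 1 v = scale_row i T (?c 1 (inverse T)) v" for v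
      unfolding cyclic_system_def scale_row_def .
    then have "?c T 1 = scale_row i T (?c 1 (inverse T))" by (rule ext)
    then show ?thesis by (simp add: Q Q' e)
  qed
  \<comment> \<open>The extra factor on both sides makes the identity hold at \<open>T = 0\<close>
    as well, where \<open>swap\<close> says nothing.\<close>
  have "poly (monom 1 (Suc (degree Q')) * Q) T = poly (monom 1 (Suc e) * reflect_poly Q') T" for T
  proof (cases "T = 0")
    case False
    then show ?thesis by (simp add: poly_monom swap poly_reflect_poly_nz)
  qed (simp add: poly_monom)
  then have "poly (monom 1 (Suc (degree Q')) * Q) = poly (monom 1 (Suc e) * reflect_poly Q')" by (rule ext)
  then have eq: "monom 1 (Suc (degree Q')) * Q = monom 1 (Suc e) * reflect_poly Q'"
    by (simp only: poly_eq_poly_eq_iff)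
  have "Suc (degree Q') + degree Q = degree (monom 1 (Suc (degree Q')) * Q)"
    using \<open>Q \<noteq> 0\<close> by (subst degree_mult_eq) (auto simp: degree_monom_eq)
  also have "\<dots> \<le> Suc e + degree (reflect_poly Q')"
    unfolding eq by (rule order.trans[OF degree_mult_le]) (simp add: degree_monom_eq)
  also have "\<dots> \<le> Suc e + degree Q'" using degree_reflect_poly_le[of Q'] by simp
  finally have "degree Q \<le> e" by simp
  have "d ^ (n - 1) = card {T :: complex. T ^ (d ^ (n - 1)) = 1}"
    using d by (intro card_roots_unity_eq[symmetric]) auto
  also have "\<dots> \<le> card {T. poly Q T = 0}"
  proof (rule card_mono)
    show "{T. T ^ (d ^ (n - 1)) = 1} \<subseteq> {T. poly Q T = 0}"
      using cyclic_system_has_zero[OF d i] by (auto simp: Q R0)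
  qed (rule poly_roots_finite[OF \<open>Q \<noteq> 0\<close>])
  also have "\<dots> \<le> degree Q" by (rule card_poly_roots_bound[OF \<open>Q \<noteq> 0\<close>])
  finally show ?thesis using \<open>degree Q \<le> e\<close> by simp
qed

theorem is_res_scale_row:
  assumes R: "is_res n d R" and d: "d \<ge> 1" and i: "i \<in> {1..n}"
  shows "poly_eval (scale_row i \<zeta> c) R = \<zeta> ^ (d ^ (n - 1)) * poly_eval c R"
proof -
  obtain e where e: "\<forall>c \<zeta>. poly_eval (scale_row i \<zeta> c) R = \<zeta> ^ e * poly_eval c R"
    using is_res_homogeneous[OF R d, of i] by (elim exE)
  have "e = d ^ (n - 1)"
    by (intro order.antisym homogeneity_degree_le[OF R d i] homogeneity_degree_ge[OF R d i] e[rule_format])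
  with e show ?thesis by simp
qed

section \<open>Block systems\<close>

definition shift :: "nat \<Rightarrow> (nat \<Rightarrow>\<^sub>0 nat) \<Rightarrow> (nat \<Rightarrow>\<^sub>0 nat)" where
  "shift k \<alpha> = (\<Sum>j\<in>pkeys \<alpha>. Poly_Mapping.single (j + k) (plookup \<alpha> j))"

text \<open>Exponents below \<open>k\<close> are set to 0 because the truncated \<open>j - k\<close>
  would add them to the exponent at index 0.\<close>

definition unshift :: "nat \<Rightarrow> (nat \<Rightarrow>\<^sub>0 nat) \<Rightarrow> (nat \<Rightarrow>\<^sub>0 nat)" where
  "unshift k \<gamma> = (\<Sum>j\<in>pkeys \<gamma>. Poly_Mapping.single (j - k) (if k \<le> j then plookup \<gamma> j else 0))"

lemma lookup_shift: "plookup (shift k \<alpha>) i = (if k \<le> i then plookup \<alpha> (i - k) else 0)"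
proof -
  have "plookup (shift k \<alpha>) i = (\<Sum>j\<in>pkeys \<alpha>. if j = i - k then (if k \<le> i then plookup \<alpha> j else 0) else 0)"
    unfolding shift_def lookup_sum by (rule sum.cong) (auto simp: lookup_single when_def)
  then show ?thesis by (simp add: in_keys_iff)
qed

lemma lookup_unshift: "plookup (unshift k \<gamma>) i = plookup \<gamma> (i + k)"
proof -
  have "plookup (unshift k \<gamma>) i = (\<Sum>j\<in>pkeys \<gamma>. if j = i + k then plookup \<gamma> j else 0)"
    unfolding unshift_def lookup_sum by (rule sum.cong) (auto simp: lookup_single when_def)
  then show ?thesis by (simp add: in_keys_iff)
qed

lemma unshift_shift: "unshift k (shift k \<alpha>) = \<alpha>"
  by (rule poly_mapping_eqI) (simp add: lookup_shift lookup_unshift)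

lemma shift_eq_iff: "shift k \<alpha> = shift k \<beta> \<longleftrightarrow> \<alpha> = \<beta>"
  by (metis unshift_shift)

lemma shift_add: "shift k (\<alpha> + \<beta>) = shift k \<alpha> + shift k \<beta>"
  by (rule poly_mapping_eqI) (simp add: lookup_shift lookup_add)

lemma shift_0: "shift k 0 = 0"
  by (simp add: shift_def)

lemma shift_single: "shift k (Poly_Mapping.single j e) = Poly_Mapping.single (j + k) e"
  by (rule poly_mapping_eqI) (auto simp: lookup_shift lookup_single when_def)

lemma shift_in_monoms:
  assumes "k \<le> n" "\<alpha> \<in> monoms (n - k) d"
  shows "shift k \<alpha> \<in> monoms n d" "pkeys (shift k \<alpha>) \<inter> {1..k} = {}"
proof -
  have keys: "pkeys \<alpha> \<subseteq> {1..n - k}" and s: "(\<Sum>j\<in>{1..n - k}. plookup \<alpha> j) = d"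
    using assms(2) by (simp_all add: monoms_def)
  have "0 \<notin> pkeys \<alpha>" using keys by auto
  then have 0: "plookup \<alpha> 0 = 0" by (simp add: in_keys_iff)
  have "i \<in> {k + 1..n}" if "i \<in> pkeys (shift k \<alpha>)" for i
  proof -
    have "k \<le> i" "i - k \<in> pkeys \<alpha>" using that by (auto simp: in_keys_iff lookup_shift split: if_splits)
    then have "k \<le> i" "1 \<le> i - k" "i - k \<le> n - k" using keys by auto
    then show ?thesis using assms(1) unfolding atLeastAtMost_iff by linarith
  qed
  then have sub: "pkeys (shift k \<alpha>) \<subseteq> {k + 1..n}" by blast
  show "pkeys (shift k \<alpha>) \<inter> {1..k} = {}" using sub by fastforce
  have "(\<Sum>j\<in>{1..n}. plookup (shift k \<alpha>) j) = (\<Sum>j\<in>{1 + k..n - k + k}. plookup (shift k \<alpha>) j)"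
  proof (rule sum.mono_neutral_right)
    show "\<forall>i\<in>{1..n} - {1 + k..n - k + k}. plookup (shift k \<alpha>) i = 0"
      using assms(1) 0 by (auto simp: lookup_shift)
  qed (use assms(1) in auto)
  also have "\<dots> = (\<Sum>j\<in>{1..n - k}. plookup (shift k \<alpha>) (j + k))"
    by (rule sum.shift_bounds_cl_nat_ivl)
  also have "\<dots> = d" using s by (simp add: lookup_shift)
  finally show "shift k \<alpha> \<in> monoms n d"
    using sub unfolding monoms_def by fastforce
qed

lemma shift_unshift:
  assumes "\<gamma> \<in> monoms n d" "pkeys \<gamma> \<inter> {1..k} = {}"
  shows "shift k (unshift k \<gamma>) = \<gamma>"
proof (rule poly_mapping_eqI)
  fix i
  show "plookup (shift k (unshift k \<gamma>)) i = plookup \<gamma> i"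
  proof (cases "k \<le> i")
    case False
    then have "i \<notin> pkeys \<gamma>" using assms by (cases "i = 0") (auto simp: monoms_def)
    then show ?thesis using False by (simp add: lookup_shift in_keys_iff)
  qed (simp add: lookup_shift lookup_unshift)
qed

lemma unshift_in_monoms:
  assumes "k \<le> n" "\<gamma> \<in> monoms n d" "pkeys \<gamma> \<inter> {1..k} = {}"
  shows "unshift k \<gamma> \<in> monoms (n - k) d"
proof -
  have keys: "pkeys \<gamma> \<subseteq> {k + 1..n}"
  proof
    fix j assume "j \<in> pkeys \<gamma>"
    then have "j \<in> {1..n}" "j \<notin> {1..k}" using assms by (auto simp: monoms_def)
    then show "j \<in> {k + 1..n}" by simp
  qed
  have keys': "i \<in> {1..n - k}" if "i \<in> pkeys (unshift k \<gamma>)" for i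
  proof -
    have "i + k \<in> pkeys \<gamma>" using that by (simp add: in_keys_iff lookup_unshift)
    then have "i + k \<in> {k + 1..n}" using keys by blast
    then show ?thesis by auto
  qed
  have "(\<Sum>j\<in>{1..n - k}. plookup (unshift k \<gamma>) j) = (\<Sum>j\<in>{1..n - k}. plookup \<gamma> (j + k))"
    by (simp add: lookup_unshift)
  also have "\<dots> = (\<Sum>j\<in>{1 + k..n - k + k}. plookup \<gamma> j)"
    by (rule sum.shift_bounds_cl_nat_ivl[symmetric])
  also have "\<dots> = (\<Sum>j\<in>{1..n}. plookup \<gamma> j)"
  proof (rule sum.mono_neutral_left)
    show "\<forall>i\<in>{1..n} - {1 + k..n - k + k}. plookup \<gamma> i = 0"
    proof
      fix i assume "i \<in> {1..n} - {1 + k..n - k + k}"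
      then have "i \<notin> pkeys \<gamma>" using keys assms(1) by fastforce
      then show "plookup \<gamma> i = 0" by (simp add: in_keys_iff)
    qed
  qed (use assms(1) in auto)
  also have "\<dots> = d" using assms by (simp add: monoms_def)
  finally show ?thesis unfolding monoms_def using keys' by blast
qed

lemma bij_betw_shift:
  assumes "k \<le> n"
  shows "bij_betw (shift k) (monoms (n - k) d) {\<gamma> \<in> monoms n d. pkeys \<gamma> \<inter> {1..k} = {}}"
proof (rule bij_betw_byWitness[where f' = "unshift k"])
  show "\<forall>\<alpha>\<in>monoms (n - k) d. unshift k (shift k \<alpha>) = \<alpha>" by (simp add: unshift_shift)
  show "\<forall>\<gamma>\<in>{\<gamma> \<in> monoms n d. pkeys \<gamma> \<inter> {1..k} = {}}. shift k (unshift k \<gamma>) = \<gamma>"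
    using shift_unshift by blast
  show "shift k ` monoms (n - k) d \<subseteq> {\<gamma> \<in> monoms n d. pkeys \<gamma> \<inter> {1..k} = {}}"
    using shift_in_monoms[OF assms] by blast
  show "unshift k ` {\<gamma> \<in> monoms n d. pkeys \<gamma> \<inter> {1..k} = {}} \<subseteq> monoms (n - k) d"
    using unshift_in_monoms[OF assms] by blast
qed

lemma mon_shift: "mon x (shift k \<alpha>) = mon (\<lambda>j. x (j + k)) \<alpha>"
proof -
  have "pkeys (shift k \<alpha>) = (\<lambda>j. j + k) ` pkeys \<alpha>"
  proof (intro equalityI subsetI)
    fix i assume "i \<in> pkeys (shift k \<alpha>)"
    then have "k \<le> i" "i - k \<in> pkeys \<alpha>" by (auto simp: in_keys_iff lookup_shift split: if_splits)
    then have "i = (i - k) + k" "i - k \<in> pkeys \<alpha>" by simp_all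
    then show "i \<in> (\<lambda>j. j + k) ` pkeys \<alpha>" by (rule image_eqI)
  qed (auto simp: in_keys_iff lookup_shift)
  then have "mon x (shift k \<alpha>) = (\<Prod>j\<in>(\<lambda>j. j + k) ` pkeys \<alpha>. x j ^ plookup (shift k \<alpha>) j)"
    by (simp add: mon_def)
  also have "\<dots> = (\<Prod>j\<in>pkeys \<alpha>. x (j + k) ^ plookup (shift k \<alpha>) (j + k))"
    by (subst prod.reindex) auto
  finally show ?thesis by (simp add: mon_def lookup_shift)
qed

lemma monoms_mono: "k \<le> n \<Longrightarrow> monoms k d \<subseteq> monoms n d"
proof
  fix \<alpha> assume "k \<le> n" "\<alpha> \<in> monoms k d"
  then have keys: "pkeys \<alpha> \<subseteq> {1..k}" "{1..k} \<subseteq> {1..n}" and "(\<Sum>j\<in>{1..k}. plookup \<alpha> j) = d"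
    by (auto simp: monoms_def)
  moreover have "(\<Sum>j\<in>{1..k}. plookup \<alpha> j) = (\<Sum>j\<in>{1..n}. plookup \<alpha> j)"
    using keys by (intro sum.mono_neutral_left) (auto simp: in_keys_iff subset_iff)
  moreover have "pkeys \<alpha> \<subseteq> {1..n}" using keys by (rule subset_trans)
  ultimately show "\<alpha> \<in> monoms n d" unfolding monoms_def by simp
qed

section \<open>Zeros of block systems\<close>

definition block :: "nat \<Rightarrow> nat \<Rightarrow> nat \<Rightarrow> (coeff_var \<Rightarrow> complex) \<Rightarrow> bool" where
  "block n k d c \<longleftrightarrow> (\<forall>i\<in>{k + 1..n}. \<forall>\<alpha>\<in>monoms n d. pkeys \<alpha> \<inter> {1..k} \<noteq> {} \<longrightarrow> c (i, \<alpha>) = 0)"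

text \<open>Rows and variables are renumbered to start at 1, so that the result is a system for
  dimension \<open>n - k\<close>.\<close>

definition lower :: "nat \<Rightarrow> (coeff_var \<Rightarrow> 'b) \<Rightarrow> coeff_var \<Rightarrow> 'b" where
  "lower k c v = c (fst v + k, shift k (snd v))"

lemma form_at_lower:
  assumes "k \<le> n" "block n k d c" "i \<in> {1..n - k}"
  shows "form_at n d c (i + k) x = form_at (n - k) d (lower k c) i (\<lambda>j. x (j + k))"
proof -
  let ?B = "{\<gamma> \<in> monoms n d. pkeys \<gamma> \<inter> {1..k} = {}}"
  have "i + k \<in> {k + 1..n}" using assms by auto
  then have "form_at n d c (i + k) x = (\<Sum>\<gamma>\<in>?B. c (i + k, \<gamma>) * mon x \<gamma>)"
    unfolding form_at_def using assms(2) by (intro sum.mono_neutral_right) (auto simp: block_def)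
  also have "\<dots> = (\<Sum>\<alpha>\<in>monoms (n - k) d. c (i + k, shift k \<alpha>) * mon x (shift k \<alpha>))"
    by (rule sum.reindex_bij_betw[OF bij_betw_shift[OF assms(1)], symmetric])
  finally show ?thesis by (simp add: form_at_def lower_def mon_shift)
qed

lemma form_at_upper:
  assumes "k \<le> n" "\<And>j. j \<in> {k + 1..n} \<Longrightarrow> x j = (0 :: complex)"
  shows "form_at n d c i x = form_at k d c i x"
  unfolding form_at_def
proof (rule sum.mono_neutral_right)
  show "\<forall>\<alpha>\<in>monoms n d - monoms k d. c (i, \<alpha>) * mon x \<alpha> = 0"
  proof
    fix \<alpha> assume \<alpha>: "\<alpha> \<in> monoms n d - monoms k d"
    have "\<exists>j\<in>{k + 1..n}. j \<in> pkeys \<alpha>"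
    proof (rule ccontr)
      assume neg: "\<not> ?thesis"
      have keys: "pkeys \<alpha> \<subseteq> {1..k}"
      proof
        fix j assume "j \<in> pkeys \<alpha>"
        moreover then have "j \<in> {1..n}" using \<alpha> by (auto simp: monoms_def)
        ultimately show "j \<in> {1..k}" using neg by auto
      qed
      then have "(\<Sum>j\<in>{1..k}. plookup \<alpha> j) = (\<Sum>j\<in>{1..n}. plookup \<alpha> j)"
        using assms(1) by (intro sum.mono_neutral_left) (auto simp: in_keys_iff subset_iff)
      then have "\<alpha> \<in> monoms k d" using keys \<alpha> by (simp add: monoms_def)
      with \<alpha> show False by simp
    qed
    then obtain j where "j \<in> {k + 1..n}" "plookup \<alpha> j > 0" by (auto simp: in_keys_iff)
    then show "c (i, \<alpha>) * mon x \<alpha> = 0" using mon_eq_0[of \<alpha> n d j x] \<alpha> assms(2) by simp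
  qed
qed (use monoms_mono[OF assms(1)] in auto)

text \<open>The last \<open>n - k\<close> coordinates of a zero solve the lower system, so they
  vanish; the first \<open>k\<close> are then a nontrivial zero of the upper system.\<close>

lemma has_zero_block:
  assumes k: "k \<le> n" and c: "block n k d c" "has_zero n d c" and low: "\<not> has_zero (n - k) d (lower k c)"
  shows "has_zero k d c"
proof -
  obtain x where nz: "\<exists>i\<in>{1..n}. x i \<noteq> 0" and x: "\<And>i. i \<in> {1..n} \<Longrightarrow> form_at n d c i x = 0"
    using c(2) unfolding has_zero_def by blast
  have "form_at (n - k) d (lower k c) i (\<lambda>j. x (j + k)) = 0" if "i \<in> {1..n - k}" for i
  proof -
    have "i + k \<in> {1..n}" using that by auto
    from x[OF this] show ?thesis by (simp add: form_at_lower[OF k c(1) that])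
  qed
  note low_form = this
  have low0: "x (j + k) = 0" if "j \<in> {1..n - k}" for j
  proof (rule ccontr)
    assume "x (j + k) \<noteq> 0"
    then have "has_zero (n - k) d (lower k c)"
      unfolding has_zero_def
      by (intro exI[of _ "\<lambda>j. x (j + k)"] conjI ballI low_form bexI[of _ j] that)
    with low show False ..
  qed
  have x0: "x j = 0" if "j \<in> {k + 1..n}" for j
  proof -
    have "j - k \<in> {1..n - k}" "j - k + k = j" using that by auto
    then show ?thesis using low0[of "j - k"] by simp
  qed
  have "form_at k d c i x = 0" if "i \<in> {1..k}" for i
  proof -
    have "i \<in> {1..n}" using that k by simp
    from x[OF this] show ?thesis using form_at_upper[OF k, where x = x and d = d and c = c and i = i] x0 by simp
  qed
  moreover have "\<exists>i\<in>{1..k}. x i \<noteq> 0"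
  proof -
    obtain i where i: "i \<in> {1..n}" "x i \<noteq> 0" using nz by blast
    then have "i \<notin> {k + 1..n}" using x0 by blast
    then show ?thesis using i by (intro bexI[of _ i]) auto
  qed
  ultimately show ?thesis unfolding has_zero_def by (intro exI[of _ x] conjI ballI)
qed

lemma block_powers: "block n k d (powers d)"
  unfolding block_def
proof (intro ballI impI)
  fix i and \<alpha> :: "nat \<Rightarrow>\<^sub>0 nat"
  assume i: "i \<in> {k + 1..n}" and \<alpha>: "pkeys \<alpha> \<inter> {1..k} \<noteq> {}"
  have "\<alpha> \<noteq> Poly_Mapping.single i d"
  proof
    assume "\<alpha> = Poly_Mapping.single i d"
    then have "pkeys \<alpha> \<subseteq> {i}" by simp
    then show False using \<alpha> i by auto
  qed
  then show "powers d (i, \<alpha>) = 0" by (simp add: powers_def)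
qed

lemma lower_powers: "lower k (powers d) = powers d"
proof
  fix v :: coeff_var
  have "shift k (snd v) = Poly_Mapping.single (fst v + k) d \<longleftrightarrow> snd v = Poly_Mapping.single (fst v) d"
    by (simp only: shift_eq_iff shift_single[symmetric])
  then show "lower k (powers d) v = powers d v" by (simp add: lower_def powers_def)
qed

text \<open>The upper rows are cut down to the first \<open>k\<close> variables. The value type is
  arbitrary so that one block can consist of polynomial variables while the other is fixed.\<close>

definition glue :: "nat \<Rightarrow> nat \<Rightarrow> (coeff_var \<Rightarrow> 'b) \<Rightarrow> (coeff_var \<Rightarrow> 'b) \<Rightarrow> coeff_var \<Rightarrow> 'b::zero" where
  "glue k d y z v =
    (if fst v \<le> k then (if snd v \<in> monoms k d then y v else 0)
     else if pkeys (snd v) \<inter> {1..k} = {} then z (fst v - k, unshift k (snd v)) else 0)"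

lemma block_glue: "block n k d (glue k d y z)"
  by (auto simp: block_def glue_def)

lemma glue_upper: "v \<in> coeff_vars k d \<Longrightarrow> glue k d y z v = y v"
  by (auto simp: coeff_vars_def glue_def)

lemma lower_glue:
  assumes "k \<le> n" "v \<in> coeff_vars (n - k) d"
  shows "lower k (glue k d y z) v = z v"
proof -
  obtain i \<alpha> where v: "v = (i, \<alpha>)" "i \<in> {1..n - k}" "\<alpha> \<in> monoms (n - k) d"
    using assms(2) by (auto simp: coeff_vars_def)
  have "\<not> i + k \<le> k" using v(2) by simp
  then show ?thesis
    using shift_in_monoms(2)[OF assms(1) v(3)] by (simp add: v(1) lower_def glue_def unshift_shift)
qed

lemma glue_powers:
  assumes "v \<in> coeff_vars n d"
  shows "glue k d (powers d) (powers d) v = powers d v"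
proof -
  obtain i \<alpha> where v: "v = (i, \<alpha>)" "i \<in> {1..n}" "\<alpha> \<in> monoms n d" using assms by (auto simp: coeff_vars_def)
  show ?thesis
  proof (cases "i \<le> k")
    case True
    then have "Poly_Mapping.single i d \<in> monoms k d" using v by (intro single_in_monoms) simp
    then show ?thesis using True by (auto simp: glue_def v powers_def)
  next
    case False
    show ?thesis
    proof (cases "pkeys \<alpha> \<inter> {1..k} = {}")
      case True
      have "unshift k \<alpha> = Poly_Mapping.single (i - k) d \<longleftrightarrow> \<alpha> = Poly_Mapping.single i d"
      proof -
        have "unshift k \<alpha> = Poly_Mapping.single (i - k) d \<longleftrightarrow>
            shift k (unshift k \<alpha>) = shift k (Poly_Mapping.single (i - k) d)"
          by (simp only: shift_eq_iff)
        then show ?thesis using False by (simp add: shift_unshift[OF v(3) True] shift_single)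
      qed
      then show ?thesis using False True by (simp add: glue_def v powers_def)
    next
      case F: False
      then have "powers d (i, \<alpha>) = 0"
        using block_powers[of n k d] v False unfolding block_def by auto
      then show ?thesis using False F by (simp add: glue_def v)
    qed
  qed
qed

lemma is_res_poly_vars: "is_res n d R \<Longrightarrow> poly_vars R \<subseteq> coeff_vars n d"
  by (simp add: is_res_def vanishing_def)

lemma is_res_eq_0_iff: "is_res n d R \<Longrightarrow> poly_eval c R = 0 \<longleftrightarrow> has_zero n d c"
  by (simp add: is_res_def)

lemma is_res_powers: "is_res n d R \<Longrightarrow> poly_eval (powers d) R = 1"
  by (simp add: is_res_def)

lemma is_res_eval_cong:
  assumes "is_res n d R" "\<And>v. v \<in> coeff_vars n d \<Longrightarrow> c v = c' v"
  shows "poly_eval c R = poly_eval c' R"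
  using is_res_poly_vars[OF assms(1)] assms(2) by (intro poly_eval_cong) blast

lemma power_2_inject:
  assumes "(2 :: complex) ^ a = 2 ^ b"
  shows "a = b"
proof -
  have "norm ((2 :: complex) ^ a) = norm ((2 :: complex) ^ b)" by (simp only: assms)
  then have "(2 :: real) ^ a = 2 ^ b" by (simp only: norm_power norm_numeral)
  then show ?thesis by (rule power_inject_exp[THEN iffD1, rotated]) simp
qed

text \<open>Scaling the first row determines the exponent.\<close>

lemma power_of_resultant:
  assumes R: "is_res n d R" and n: "n \<ge> 1" and d: "d \<ge> 1"
    and van: "\<And>y. poly_eval y G = 0 \<Longrightarrow> poly_eval y R = 0"
    and hom: "poly_eval (scale_row 1 2 (powers d)) G = 2 ^ (d ^ (n - 1) * a) * poly_eval (powers d) G"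
  shows "poly_eval y G = poly_eval (powers d) G * poly_eval y R ^ a"
proof -
  have Gp: "poly_eval (powers d) G \<noteq> 0" using van[of "powers d"] is_res_powers[OF R] by auto
  then have "G \<noteq> 0" by auto
  have "irreducible R" using R by (simp add: is_res_def)
  then have "\<exists>c b. c \<noteq> 0 \<and> G = Cst c * R ^ b"
    using \<open>G \<noteq> 0\<close> by (rule vanishing_subset_power) (rule van)
  then obtain C b where "C \<noteq> 0" and G: "G = Cst C * R ^ b" by (elim exE conjE)
  have G_eval: "poly_eval y G = C * poly_eval y R ^ b" for y
    by (simp add: G poly_eval.hom_mult poly_eval.hom_power)
  have C: "C = poly_eval (powers d) G" by (simp add: G_eval is_res_powers[OF R])
  let ?E = "d ^ (n - 1)"
  have "1 \<in> {1..n}" using n by simp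
  then have R2: "poly_eval (scale_row 1 2 (powers d)) R = 2 ^ ?E"
    by (simp only: is_res_scale_row[OF R d] is_res_powers[OF R] mult_1_right)
  have "C * (2 ^ ?E) ^ b = poly_eval (scale_row 1 2 (powers d)) G" by (simp only: G_eval R2)
  also have "\<dots> = C * 2 ^ (?E * a)" unfolding hom C[symmetric] by (rule mult.commute)
  finally have "(2 :: complex) ^ (?E * b) = 2 ^ (?E * a)"
    using \<open>C \<noteq> 0\<close> by (simp only: mult_cancel_left power_mult) simp
  then have "?E * b = ?E * a" by (rule power_2_inject)
  then have "b = a" using d by simp
  then show ?thesis by (simp only: G_eval[of y] C[symmetric])
qed

section \<open>The product formula\<close>

context
  fixes n k d :: nat and Rn Rk Rl :: "coeff_var cpoly"
  assumes k: "1 \<le> k" "k < n" and d: "1 \<le> d"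
    and Rn: "is_res n d Rn" and Rk: "is_res k d Rk" and Rl: "is_res (n - k) d Rl"
begin

text \<open>Left factors: the degree of a block's resultant in one of its rows. Right factors: the
  exponents of the product formula.\<close>

lemma exponents:
  "d ^ (k - 1) * d ^ (n - k) = d ^ (n - 1)" "d ^ (n - k - 1) * d ^ k = d ^ (n - 1)"
  using k by (simp_all flip: power_add)

lemma nonzero_if_block:
  assumes "block n k d c" "poly_eval c Rk \<noteq> 0" "poly_eval (lower k c) Rl \<noteq> 0"
  shows "poly_eval c Rn \<noteq> 0"
  using assms has_zero_block[of k n d c] k
  by (simp add: is_res_eq_0_iff[OF Rn] is_res_eq_0_iff[OF Rk] is_res_eq_0_iff[OF Rl]) blast

text \<open>With the powers as upper block \<open>Rk\<close> takes the value 1, so zeros of the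
  polynomial \<open>G\<close> in the lower coefficients are zeros of \<open>Rl\<close>, and
  \<open>G\<close> is a constant times a power of \<open>Rl\<close>. Normalization makes the
  constant 1.\<close>

lemma eval_glue_powers:
  "poly_eval (glue k d (powers d) z) Rn = poly_eval z Rl ^ (d ^ k)"
proof -
  define \<sigma> where "\<sigma> = glue k d (\<lambda>v. Cst (powers d v)) Var"
  define G where "G = ev Cst \<sigma> Rn"
  have \<sigma>: "poly_eval y (\<sigma> v) = glue k d (powers d) y v" for y v by (simp add: \<sigma>_def glue_def)
  have G: "poly_eval y G = poly_eval (glue k d (powers d) y) Rn" for y
    unfolding G_def poly_eval_subst \<sigma> ..
  have G1: "poly_eval (powers d) G = 1"
    unfolding G using is_res_eval_cong[OF Rn glue_powers] is_res_powers[OF Rn] by simp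
  have "poly_eval z G = poly_eval (powers d) G * poly_eval z Rl ^ (d ^ k)"
  proof (rule power_of_resultant[OF Rl])
    show "n - k \<ge> 1" "d \<ge> 1" using k d by auto
    fix y assume "poly_eval y G = 0"
    then have 0: "poly_eval (glue k d (powers d) y) Rn = 0" by (simp add: G)
    have "poly_eval (glue k d (powers d) y) Rk = 1"
      using is_res_eval_cong[OF Rk glue_upper] is_res_powers[OF Rk] by simp
    moreover have "poly_eval (lower k (glue k d (powers d) y)) Rl = poly_eval y Rl"
      by (rule is_res_eval_cong[OF Rl lower_glue]) (use k in auto)
    ultimately show "poly_eval y Rl = 0"
      using nonzero_if_block[OF block_glue, of "powers d" y] 0 by auto
  next
    \<comment> \<open>The first row of the lower block is row \<open>k + 1\<close> of the whole
      system.\<close>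
    have "glue k d (powers d) (scale_row 1 2 (powers d)) v = scale_row (Suc k) 2 (glue k d (powers d) (powers d)) v" for v
      by (auto simp: glue_def scale_row_def)
    then have eq: "glue k d (powers d) (scale_row 1 2 (powers d)) = scale_row (Suc k) 2 (glue k d (powers d) (powers d))"
      by (rule ext)
    have "Suc k \<in> {1..n}" using k by simp
    then show "poly_eval (scale_row 1 2 (powers d)) G = 2 ^ (d ^ (n - k - 1) * d ^ k) * poly_eval (powers d) G"
      unfolding G eq exponents by (rule is_res_scale_row[OF Rn d])
  qed
  then show ?thesis by (simp add: G1) (simp add: G)
qed

text \<open>The lower block is fixed; its nonzero resultant ensures that zeros of \<open>G\<close>
  come from zeros of \<open>Rk\<close>. The constant is the value at the powers as upper block,
  known from \<open>eval_glue_powers\<close>.\<close>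

lemma eval_glue:
  assumes z: "poly_eval z Rl \<noteq> 0"
  shows "poly_eval (glue k d y z) Rn = poly_eval y Rk ^ (d ^ (n - k)) * poly_eval z Rl ^ (d ^ k)"
proof -
  define \<sigma> where "\<sigma> = glue k d Var (\<lambda>v. Cst (z v))"
  define G where "G = ev Cst \<sigma> Rn"
  have \<sigma>: "poly_eval y (\<sigma> v) = glue k d y z v" for y v by (simp add: \<sigma>_def glue_def)
  have G: "poly_eval y G = poly_eval (glue k d y z) Rn" for y
    unfolding G_def poly_eval_subst \<sigma> ..
  have "poly_eval y G = poly_eval (powers d) G * poly_eval y Rk ^ (d ^ (n - k))"
  proof (rule power_of_resultant[OF Rk k(1) d])
    fix y assume "poly_eval y G = 0"
    then have 0: "poly_eval (glue k d y z) Rn = 0" by (simp add: G)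
    have "poly_eval (lower k (glue k d y z)) Rl = poly_eval z Rl"
      by (rule is_res_eval_cong[OF Rl lower_glue]) (use k in auto)
    moreover have "poly_eval (glue k d y z) Rk = poly_eval y Rk"
      by (rule is_res_eval_cong[OF Rk glue_upper])
    ultimately show "poly_eval y Rk = 0"
      using nonzero_if_block[OF block_glue, of y z] 0 z by auto
  next
    have "glue k d (scale_row 1 2 (powers d)) z v = scale_row 1 2 (glue k d (powers d) z) v" for v
      using k by (auto simp: glue_def scale_row_def)
    then have eq: "glue k d (scale_row 1 2 (powers d)) z = scale_row 1 2 (glue k d (powers d) z)"
      by (rule ext)
    have "1 \<in> {1..n}" using k by simp
    then show "poly_eval (scale_row 1 2 (powers d)) G = 2 ^ (d ^ (k - 1) * d ^ (n - k)) * poly_eval (powers d) G"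
      unfolding G eq exponents by (rule is_res_scale_row[OF Rn d])
  qed
  then show ?thesis by (simp add: G eval_glue_powers mult.commute)
qed

text \<open>
  The coefficients of \<open>f\<^sub>1, \<dots>, f\<^sub>k\<close> outside \<open>monoms k d\<close> do not matter: scaling them by \<open>s\<close> gives a
  polynomial in \<open>s\<close> without roots, that is, a constant.
\<close>

lemma eval_block_nonzero:
  assumes c: "block n k d c" "poly_eval c Rk \<noteq> 0" "poly_eval (lower k c) Rl \<noteq> 0"
  shows "poly_eval c Rn = poly_eval c Rk ^ (d ^ (n - k)) * poly_eval (lower k c) Rl ^ (d ^ k)"
proof -
  define cs where "cs s v = (if fst v \<le> k \<and> snd v \<notin> monoms k d then s * c v else c v)" for s v
  define Q where "Q = ev (\<lambda>c. [:c:]) (\<lambda>v. if fst v \<le> k \<and> snd v \<notin> monoms k d then [:0, c v:] else [:c v:]) Rn"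
  have "poly (if fst v \<le> k \<and> snd v \<notin> monoms k d then [:0, c v:] else [:c v:]) s = cs s v" for v s
    by (simp add: cs_def)
  then have Q: "poly Q s = poly_eval (cs s) Rn" for s
    unfolding Q_def poly_eval_curve by (simp only:)
  have "poly Q s \<noteq> 0" for s
  proof -
    have "block n k d (cs s)" using c(1) by (auto simp: block_def cs_def)
    moreover have "poly_eval (cs s) Rk = poly_eval c Rk"
      by (rule is_res_eval_cong[OF Rk]) (auto simp: cs_def coeff_vars_def)
    moreover have "poly_eval (lower k (cs s)) Rl = poly_eval (lower k c) Rl"
      by (rule is_res_eval_cong[OF Rl]) (auto simp: cs_def lower_def coeff_vars_def)
    ultimately show ?thesis unfolding Q using nonzero_if_block[of "cs s"] c by simp
  qed
  then have "constant (poly Q)" using fundamental_theorem_of_algebra by blast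
  then have "poly Q 1 = poly Q 0" by (simp add: constant_def)
  moreover have "cs 1 = c" by (auto simp: cs_def)
  \<comment> \<open>At \<open>s = 0\<close> the upper rows involve only the first \<open>k\<close>
    variables, which is exactly a glued system.\<close>
  moreover have "poly_eval (cs 0) Rn = poly_eval (glue k d c (lower k c)) Rn"
  proof (rule is_res_eval_cong[OF Rn])
    fix v assume "v \<in> coeff_vars n d"
    then obtain i \<alpha> where v: "v = (i, \<alpha>)" "i \<in> {1..n}" "\<alpha> \<in> monoms n d" by (auto simp: coeff_vars_def)
    show "cs 0 v = glue k d c (lower k c) v"
    proof (cases "i \<le> k")
      case False
      show ?thesis
      proof (cases "pkeys \<alpha> \<inter> {1..k} = {}")
        case True
        then show ?thesis using False shift_unshift[OF v(3) True] by (simp add: cs_def glue_def lower_def v(1))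
      next
        case F: False
        have "i \<in> {k + 1..n}" using False v by simp
        then have "c (i, \<alpha>) = 0" using c(1) v(3) F unfolding block_def by blast
        then show ?thesis using False F by (simp add: cs_def glue_def v(1))
      qed
    qed (simp add: cs_def glue_def v(1))
  qed
  ultimately show ?thesis using eval_glue[OF c(3), of c] Q[of 1] Q[of 0] by simp
qed

text \<open>Vanishing block resultants are reached along a line to the powers, which stays among
  block systems. The difference of both sides times the two block resultants vanishes on the whole
  line; these resultants are 1 at \<open>s = 1\<close>, hence nonzero polynomials in
  \<open>s\<close>, and can be cancelled.\<close>

theorem eval_block:
  assumes c: "block n k d c"
  shows "poly_eval c Rn = poly_eval c Rk ^ (d ^ (n - k)) * poly_eval (lower k c) Rl ^ (d ^ k)"
proof -
  define q where "q v = [:c v, powers d v - c v:]" for v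
  define P where "P p q = ev (\<lambda>c. [:c:]) q p" for p :: "coeff_var cpoly" and q
  let ?c = "\<lambda>s v. poly (q v) s"
  have P: "poly (P p q) s = poly_eval (\<lambda>v. poly (q v) s) p" for p q s unfolding P_def by (rule poly_eval_curve)
  have low: "(\<lambda>v. poly (lower k q v) s) = lower k (?c s)" for s by (simp add: lower_def fun_eq_iff)
  have c01: "?c 0 = c" "?c 1 = powers d" by (simp_all add: q_def fun_eq_iff)
  have bl: "block n k d (?c s)" for s
    using c block_powers[of n k d] by (simp add: block_def q_def)
  let ?D = "(P Rn q - P Rk q ^ (d ^ (n - k)) * P Rl (lower k q) ^ (d ^ k)) * (P Rk q * P Rl (lower k q))"
  have "poly ?D s = 0" for s
    using eval_block_nonzero[OF bl, of s]
    by (cases "poly_eval (?c s) Rk = 0"; cases "poly_eval (lower k (?c s)) Rl = 0") (simp_all add: P low)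
  then have "?D = 0" using poly_all_0_iff_0 by blast
  moreover have "poly (P Rk q) 1 = 1" "poly (P Rl (lower k q)) 1 = 1"
    by (simp_all add: P low c01 lower_powers is_res_powers[OF Rk] is_res_powers[OF Rl])
  then have "P Rk q * P Rl (lower k q) \<noteq> 0" by auto
  ultimately have "P Rn q = P Rk q ^ (d ^ (n - k)) * P Rl (lower k q) ^ (d ^ k)" by simp
  then have "poly (P Rn q) 0 = poly (P Rk q) 0 ^ (d ^ (n - k)) * poly (P Rl (lower k q)) 0 ^ (d ^ k)" by simp
  then show ?thesis by (simp add: P low c01)
qed

end

section \<open>Tensors\<close>

definition tensor_coeffs :: "nat \<Rightarrow> nat \<Rightarrow> tensor \<Rightarrow> coeff_var \<Rightarrow> complex" where
  "tensor_coeffs n m T v = plookup (tensor_form n m T (fst v)) (snd v)"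

lemma Edet_eq: "Edet n m T = poly_eval (tensor_coeffs n m T) (resultant_poly n (m - 1))"
proof -
  have "(\<lambda>(i, \<alpha>). plookup (tensor_form n m T i) \<alpha>) = tensor_coeffs n m T"
    by (auto simp: tensor_coeffs_def)
  then show ?thesis by (simp add: Edet_def Res_def eval_at_forms_def)
qed

definition list_exponent :: "nat list \<Rightarrow> nat \<Rightarrow>\<^sub>0 nat" where
  "list_exponent js = (\<Sum>j\<leftarrow>js. Poly_Mapping.single j 1)"

lemma list_exponent_simps [simp]:
  "list_exponent [] = 0"
  "list_exponent (j # js) = Poly_Mapping.single j 1 + list_exponent js"
  by (simp_all add: list_exponent_def)

lemma keys_list_exponent: "pkeys (list_exponent js) = set js"
proof (induction js)
  case (Cons j js)
  have "i \<in> pkeys (list_exponent (j # js)) \<longleftrightarrow> i = j \<or> i \<in> pkeys (list_exponent js)" for i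
    by (simp add: in_keys_iff lookup_add lookup_single when_def)
  then show ?case using Cons.IH by auto
qed simp

lemma shift_list_exponent: "shift k (list_exponent js) = list_exponent (map (\<lambda>j. j + k) js)"
  by (induction js) (simp_all add: shift_0 shift_add shift_single)

lemma finite_index_lists: "finite (index_lists n d)"
proof -
  have "index_lists n d = {js. set js \<subseteq> {1..n} \<and> length js = d}" by (auto simp: index_lists_def)
  then show ?thesis using finite_lists_length_eq[of "{1..n}" d] by simp
qed

text \<open>Index lists that differ only in the order of their entries give the same monomial, so
  their tensor entries add up.\<close>

lemma tensor_coeffs_eq:
  "tensor_coeffs n m T (i, \<alpha>) =
    (\<Sum>js\<in>{js \<in> index_lists n (m - 1). list_exponent js = \<alpha>}. T (i # js))"
proof -
  have "tensor_coeffs n m T (i, \<alpha>) =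
      (\<Sum>js\<in>index_lists n (m - 1). if list_exponent js = \<alpha> then T (i # js) else 0)"
    unfolding tensor_coeffs_def tensor_form_def lookup_sum
    by (rule sum.cong) (simp_all add: lookup_single when_def list_exponent_def)
  then show ?thesis by (simp only: sum.inter_filter[OF finite_index_lists])
qed

text \<open>Every list contributing to \<open>\<alpha>\<close> contains exactly the variables of
  \<open>\<alpha>\<close>, so each summand vanishes.\<close>

lemma block_tensor_coeffs:
  assumes "\<And>i js. i \<in> {k + 1..n} \<Longrightarrow> js \<in> index_lists n (m - 1) \<Longrightarrow>
           set js \<inter> {1..k} \<noteq> {} \<Longrightarrow> T (i # js) = 0"
  shows "block n k (m - 1) (tensor_coeffs n m T)"
  unfolding block_def
proof (intro ballI impI)
  fix i and \<alpha> :: "nat \<Rightarrow>\<^sub>0 nat"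
  assume "i \<in> {k + 1..n}" "pkeys \<alpha> \<inter> {1..k} \<noteq> {}"
  then show "tensor_coeffs n m T (i, \<alpha>) = 0"
    unfolding tensor_coeffs_eq by (intro sum.neutral) (use assms keys_list_exponent in blast)
qed

text \<open>A list whose monomial involves only the first \<open>k\<close> variables is a list over
  \<open>{1..k}\<close>, so both coefficients sum over the same lists.\<close>

lemma tensor_coeffs_upper:
  assumes k: "k \<le> n" and m: "m \<ge> 2" and U: "is_subtensor n m T {1..k} U"
    and v: "v \<in> coeff_vars k (m - 1)"
  shows "tensor_coeffs n m T v = tensor_coeffs k m U v"
proof -
  obtain i \<alpha> where i: "v = (i, \<alpha>)" "i \<in> {1..k}" "pkeys \<alpha> \<subseteq> {1..k}"
    using v by (auto simp: coeff_vars_def monoms_def)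
  have eq: "{js \<in> index_lists n (m - 1). list_exponent js = \<alpha>} = {js \<in> index_lists k (m - 1). list_exponent js = \<alpha>}"
    using i(3) k keys_list_exponent unfolding index_lists_def by fastforce
  have nth: "sorted_list_of_set {1..k} ! (j - 1) = j" if "j \<in> {1..k}" for j
  proof -
    have "sorted_list_of_set {1..k} = [1..<Suc k]"
      by (metis atLeastLessThanSuc_atLeastAtMost sorted_list_of_set_range)
    then show ?thesis using that by (auto simp: nth_upt simp del: upt_Suc)
  qed
  have "T (i # js) = U (i # js)" if "js \<in> index_lists k (m - 1)" for js
  proof -
    have "i # js \<in> index_lists (card {1..k}) m" using that i m by (auto simp: index_lists_def)
    then have "U (i # js) = T (map (\<lambda>i. sorted_list_of_set {1..k} ! (i - 1)) (i # js))"
      using U unfolding is_subtensor_def by blast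
    also have "map (\<lambda>i. sorted_list_of_set {1..k} ! (i - 1)) (i # js) = map (\<lambda>i. i) (i # js)"
      by (rule map_cong) (use that i nth in \<open>auto simp: index_lists_def\<close>)
    finally show ?thesis by simp
  qed
  then show ?thesis unfolding i(1) tensor_coeffs_eq eq by (intro sum.cong) auto
qed

text \<open>Adding \<open>k\<close> to all indices is a bijection from the lists for
  \<open>\<alpha>\<close> in dimension \<open>n - k\<close> to those for
  \<open>shift k \<alpha>\<close> in dimension \<open>n\<close>.\<close>

lemma tensor_coeffs_lower:
  assumes k: "k \<le> n" and m: "m \<ge> 2" and V: "is_subtensor n m T {k + 1..n} V"
    and v: "v \<in> coeff_vars (n - k) (m - 1)"
  shows "lower k (tensor_coeffs n m T) v = tensor_coeffs (n - k) m V v"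
proof -
  obtain i \<alpha> where i: "v = (i, \<alpha>)" "i \<in> {1..n - k}" "\<alpha> \<in> monoms (n - k) (m - 1)"
    using v by (auto simp: coeff_vars_def)
  let ?s = "map (\<lambda>j. j + k)"
  have "bij_betw ?s {js \<in> index_lists (n - k) (m - 1). list_exponent js = \<alpha>}
      {js \<in> index_lists n (m - 1). list_exponent js = shift k \<alpha>}"
    unfolding bij_betw_def
  proof
    show "inj_on ?s {js \<in> index_lists (n - k) (m - 1). list_exponent js = \<alpha>}"
      by (rule inj_on_subset[OF inj_mapI]) (auto simp: inj_def)
    show "?s ` {js \<in> index_lists (n - k) (m - 1). list_exponent js = \<alpha>} =
        {js \<in> index_lists n (m - 1). list_exponent js = shift k \<alpha>}"
    proof (intro equalityI subsetI)
      fix ls assume "ls \<in> ?s ` {js \<in> index_lists (n - k) (m - 1). list_exponent js = \<alpha>}"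
      then obtain js where js: "ls = ?s js" "js \<in> index_lists (n - k) (m - 1)" "list_exponent js = \<alpha>" by blast
      have "j + k \<in> {1..n}" if "j \<in> set js" for j
      proof -
        have "j \<in> {1..n - k}" using js(2) that by (auto simp: index_lists_def)
        then show ?thesis using k by auto
      qed
      then have "ls \<in> index_lists n (m - 1)" using js by (auto simp: index_lists_def)
      then show "ls \<in> {js \<in> index_lists n (m - 1). list_exponent js = shift k \<alpha>}"
        using js by (simp add: shift_list_exponent[symmetric])
    next
      fix ls assume "ls \<in> {js \<in> index_lists n (m - 1). list_exponent js = shift k \<alpha>}"
      then have ls: "ls \<in> index_lists n (m - 1)" "list_exponent ls = shift k \<alpha>" by auto
      \<comment> \<open>All indices exceed \<open>k\<close>, so the subtraction of \<open>k\<close>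
        below is not truncated.\<close>
      have above: "j \<in> {k + 1..n}" if "j \<in> set ls" for j
      proof -
        have "j \<in> pkeys (shift k \<alpha>)" using that ls(2) keys_list_exponent[of ls] by simp
        then have "j \<notin> {1..k}" using shift_in_monoms(2)[OF k i(3)] by blast
        moreover have "j \<in> {1..n}" using ls(1) that by (auto simp: index_lists_def)
        ultimately show ?thesis by simp
      qed
      define js where "js = map (\<lambda>j. j - k) ls"
      have "?s js = map (\<lambda>j. j) ls"
        unfolding js_def map_map by (rule map_cong) (use above in fastforce)+
      then have s: "?s js = ls" by simp
      have "j - k \<in> {1..n - k}" if "j \<in> set ls" for j using above[OF that] by auto
      then have "js \<in> index_lists (n - k) (m - 1)" using ls(1) by (auto simp: js_def index_lists_def)
      moreover have "shift k (list_exponent js) = shift k \<alpha>" using ls(2) s by (simp add: shift_list_exponent)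
      then have "list_exponent js = \<alpha>" by (simp only: shift_eq_iff)
      ultimately show "ls \<in> ?s ` {js \<in> index_lists (n - k) (m - 1). list_exponent js = \<alpha>}"
        using s by (intro image_eqI[of _ _ js]) auto
    qed
  qed
  from sum.reindex_bij_betw[OF this, of "\<lambda>js. T ((i + k) # js)"]
  have "lower k (tensor_coeffs n m T) v =
      (\<Sum>js\<in>{js \<in> index_lists (n - k) (m - 1). list_exponent js = \<alpha>}. T ((i + k) # ?s js))"
    by (simp add: lower_def i(1) tensor_coeffs_eq)
  also have "\<dots> = tensor_coeffs (n - k) m V v"
    unfolding i(1) tensor_coeffs_eq
  proof (rule sum.cong)
    fix js assume "js \<in> {js \<in> index_lists (n - k) (m - 1). list_exponent js = \<alpha>}"
    then have js: "i # js \<in> index_lists (n - k) m" using i(2) m by (auto simp: index_lists_def)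
    have nth: "sorted_list_of_set {k + 1..n} ! (j - 1) = j + k" if "j \<in> {1..n - k}" for j
    proof -
      have "sorted_list_of_set {k + 1..n} = [k + 1..<Suc n]"
        by (metis atLeastLessThanSuc_atLeastAtMost sorted_list_of_set_range)
      then show ?thesis using that by (auto simp: nth_upt simp del: upt_Suc)
    qed
    have "card {k + 1..n} = n - k" by simp
    then have "V (i # js) = T (map (\<lambda>i. sorted_list_of_set {k + 1..n} ! (i - 1)) (i # js))"
      using V js unfolding is_subtensor_def by metis
    also have "map (\<lambda>i. sorted_list_of_set {k + 1..n} ! (i - 1)) (i # js) = ?s (i # js)"
      by (rule map_cong) (use js nth in \<open>auto simp: index_lists_def\<close>)
    finally show "T ((i + k) # ?s js) = V (i # js)" by simp
  qed simp
  finally show ?thesis .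
qed

theorem theorem5p1:
  fixes m n k :: nat and T U V :: tensor
  assumes "m \<ge> 2" and "n \<ge> 2"
    and "1 \<le> k" and "k \<le> n - 1"
    and "\<And>i js. i \<in> {k+1..n} \<Longrightarrow> js \<in> index_lists n (m - 1) \<Longrightarrow>
           set js \<inter> {1..k} \<noteq> {} \<Longrightarrow> T (i # js) = 0"
    and "is_subtensor n m T {1..k} U"
    and "is_subtensor n m T {k+1..n} V"
  shows "Edet n m T = Edet k m U ^ ((m - 1) ^ (n - k)) * Edet (n - k) m V ^ ((m - 1) ^ k)"
proof -
  \<comment> \<open>The forms have degree \<open>m - 1\<close>, and all three dimensions are
    positive, so each of the resultants exists.\<close>
  have d: "1 \<le> m - 1" and kn: "k < n" "k \<le> n" "1 \<le> n" "1 \<le> n - k" using assms(1-4) by auto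
  note Rn = is_res_resultant_poly[OF kn(3) d] and Rk = is_res_resultant_poly[OF assms(3) d]
    and Rl = is_res_resultant_poly[OF kn(4) d]
  have "block n k (m - 1) (tensor_coeffs n m T)"
    by (rule block_tensor_coeffs) (rule assms(5))
  note eval_block[OF assms(3) kn(1) d Rn Rk Rl this]
  also have "poly_eval (tensor_coeffs n m T) (resultant_poly k (m - 1)) = Edet k m U"
    unfolding Edet_eq by (rule is_res_eval_cong[OF Rk tensor_coeffs_upper[OF kn(2) assms(1,6)]])
  also have "poly_eval (lower k (tensor_coeffs n m T)) (resultant_poly (n - k) (m - 1)) = Edet (n - k) m V"
    unfolding Edet_eq by (rule is_res_eval_cong[OF Rl tensor_coeffs_lower[OF kn(2) assms(1,7)]])
  finally show ?thesis unfolding Edet_eq[of n] .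
qed

end
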